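(* Let $m,N\in\mathbb{N}$ with $N+1\ge m$, let $a<b$ be real, $h=\frac{b-a}{N}$, and let $\omega\in\mathbb{R}$ with $\omega\ne0$ and $\omega h\in\mathbb{Z}$. Then the coefficients of the optimal quadrature formula in the sense of Sard of the form $$\int_a^b e^{2\pi i\omega x}\varphi(x)\,dx\cong\sum_{\beta=0}^N C_{\beta,\omega}[a,b]\,\varphi(h\beta+a)$$ in the space $L_2^{(m)}[a,b]$ are expressed by $$\mathring{C}_{0,\omega}[a,b]=h\left(-\frac{e^{2\pi i\omega a}}{2\pi i\omega h}+\sum_{k=1}^{m-1}\left(a_k\frac{q_k}{q_k-1}+b_k\frac{q_k^N}{1-q_k}\right)\right),$$ $$\mathring{C}_{\beta,\omega}[a,b]=h\sum_{k=1}^{m-1}\left(a_kq_k^\beta+b_kq_k^{N-\beta}\right),\quad\beta=1,2,\dots,N-1,$$ $$\mathring{C}_{N,\omega}[a,b]=h\left(\frac{e^{2\pi i\omega b}}{2\pi i\omega h}+\sum_{k=1}^{m-1}\left(a_k\frac{q_k^N}{1-q_k}+b_k\frac{q_k}{q_k-1}\right)\right),$$ where $a_k,b_k$ ($k=1,2,\dots,m-1$) are defined by the following system of $2m-2$ linear equations: for $j=1,2,\dots,m-1$, $$\sum_{k=1}^{m-1}a_k\left[\sum_{t=1}^{j}\frac{q_k\Delta^t0^j}{(q_k-1)^{t+1}}\right]+\sum_{k=1}^{m-1}b_k\left[\sum_{t=1}^j\frac{q_k^{N+t}\Delta^t0^{j}}{(1-q_k)^{t+1}}\right]=\frac{j!\,e^{2\pi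 i\omega a}}{(2\pi i\omega h)^{j+1}},$$ and, for $j=1,2,\dots,m-1$, $$\begin{aligned} &\sum_{k=1}^{m-1}a_k\left[\sum_{t=1}^j\frac{q_k^t\Delta^t0^j}{(1-q_k)^{t+1}}-\sum_{\alpha=1}^{j}\left(\tfrac{h}{b-a}\right)^{\alpha-j}\binom{j}{\alpha}\sum_{t=1}^{\alpha}\frac{q_k^{N+t}\Delta^t0^{\alpha}}{(1-q_k)^{t+1}}\right]\\ &+\sum_{k=1}^{m-1}b_k\left[\sum_{t=1}^j\frac{q_k^{N+1}\Delta^t0^j}{(q_k-1)^{t+1}}-\sum_{\alpha=1}^{j}\left(\tfrac{h}{b-a}\right)^{\alpha-j}\binom{j}{\alpha}\sum_{t=1}^{\alpha}\frac{q_k\Delta^t0^{\alpha}}{(q_k-1)^{t+1}}\right]\\ &=\frac{(-1)^{j+1}j!\,e^{2\pi i\omega a}}{(2\pi i\omega h)^{j+1}}+\sum_{\alpha=1}^{j}\left(\tfrac{h}{b-a}\right)^{\alpha-j}\frac{(-1)^{\alpha}j!\,e^{2\pi i\omega b}}{(j-\alpha)!(2\pi i\omega h)^{\alpha+1}} . \end{aligned}$$ Here $q_1,\dots,q_{m-1}$ are the roots of the Euler-Frobenius polynomial $E_{2m-2}(x)$ with $|q_k|<1$.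
   Context: $i^2=-1$. $L_2^{(m)}[a,b]$ is the Sobolev space of complex-valued functions on $[a,b]$ having an absolutely continuous $(m-1)$-th derivative on $[a,b]$ and square integrable $m$-th derivative, with inner product $\langle\varphi,\psi\rangle=\int_a^b\varphi^{(m)}(x)\overline{\psi^{(m)}(x)}\,dx$ and (semi)norm $\|\varphi\|_{L_2^{(m)}[a,b]}=\langle\varphi,\varphi\rangle^{1/2}$. For nodes $x_\beta=h\beta+a$, the error functional of a quadrature formula $\int_a^b e^{2\pi i\omega x}\varphi(x)\,dx\cong\sum_{\beta=0}^NC_\beta\varphi(x_\beta)$ (with $C_\beta\in\mathbb{C}$) is $(\ell,\varphi)=\int_a^b e^{2\pi i\omega x}\varphi(x)\,dx-\sum_{\beta=0}^NC_\beta\varphi(x_\beta)$. It is required that $(\ell,x^\alpha)=0$ for $\alpha=0,1,\dots,m-1$, so that $\ell$ is a bounded functional with norm $\|\ell\|_{L_2^{(m)*}[a,b]}=\sup\{|(\ell,\varphi)|:\|\varphi\|_{L_2^{(m)}[a,b]}\le1\}$. The formula is optimal in the sense of Sard, with optimal coefficients denoted $\mathring{C}$, if these coefficients minimize $\|\ell\|_{L_2^{(m)*}[a,b]}$ over all coefficient vectors $(C_0,\dots,C_N)$ satisfying these conditions, the nodes being fixed. The Euler-Frobenius polynomials are $E_k(x)=\frac{(1-x)^{k+2}}{x}\left(x\frac{d}{dx}\right)^k\frac{x}{(1-x)^2}$, $k=0,1,2,\dots$; $E_k$ has degree $k$, its roots are real, negative and distinct, and $E_{2m-2}$ has exactly $m-1$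 roots with absolute value less than $1$. $\Delta^t0^j=\sum_{l=1}^t(-1)^{t-l}\binom{t}{l}l^j$ for $t,j\ge1$. Empty sums are zero. *)

theory Defs
  imports
    "HOL-Analysis.Analysis"
    "HOL-Computational_Algebra.Polynomial"
begin

definition absolutely_continuous_on_interval :: "real \<Rightarrow> real \<Rightarrow> (real \<Rightarrow> complex) \<Rightarrow> bool" where
  "absolutely_continuous_on_interval a b f \<longleftrightarrow>
     (\<forall>\<epsilon>>0. \<exists>\<delta>>0. \<forall>(n::nat) (u::nat \<Rightarrow> real) (v::nat \<Rightarrow> real).
        (\<forall>i<n. a \<le> u i \<and> u i \<le> v i \<and> v i \<le> b) \<longrightarrow>
        (\<forall>i<n. \<forall>j<n. i \<noteq> j \<longrightarrow> {u i<..<v i} \<inter> {u j<..<v j} = {}) \<longrightarrow>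
        (\<Sum>i<n. v i - u i) < \<delta> \<longrightarrow>
        (\<Sum>i<n. dist (f (u i)) (f (v i))) < \<epsilon>)"

(* Derivatives are one-sided at the end points, so only the values on [a,b] matter.
   At points where the derivative does not exist the value is unspecified; for the
   derivative of order m of a function in the Sobolev space below this is a null set. *)
fun nth_deriv_on :: "real \<Rightarrow> real \<Rightarrow> nat \<Rightarrow> (real \<Rightarrow> complex) \<Rightarrow> real \<Rightarrow> complex" where
  "nth_deriv_on a b 0 f = f"
| "nth_deriv_on a b (Suc n) f = (\<lambda>x. vector_derivative (nth_deriv_on a b n f) (at x within {a..b}))"

(* Intended for m at least 1. *)
definition sobolev_space :: "nat \<Rightarrow> real \<Rightarrow> real \<Rightarrow> (real \<Rightarrow> complex) set" where
  "sobolev_space m a b =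
     {f. (\<forall>i<m - 1. \<forall>x\<in>{a..b}. nth_deriv_on a b i f differentiable (at x within {a..b})) \<and>
         absolutely_continuous_on_interval a b (nth_deriv_on a b (m - 1) f) \<and>
         set_borel_measurable lebesgue {a..b} (nth_deriv_on a b m f) \<and>
         set_integrable lebesgue {a..b} (\<lambda>x. (cmod (nth_deriv_on a b m f x))\<^sup>2)}"

definition sobolev_inner ::
  "nat \<Rightarrow> real \<Rightarrow> real \<Rightarrow> (real \<Rightarrow> complex) \<Rightarrow> (real \<Rightarrow> complex) \<Rightarrow> complex" where
  "sobolev_inner m a b f g =
     (LINT x:{a..b}|lebesgue. nth_deriv_on a b m f x * cnj (nth_deriv_on a b m g x))"

definition sobolev_norm :: "nat \<Rightarrow> real \<Rightarrow> real \<Rightarrow> (real \<Rightarrow> complex) \<Rightarrow> real" where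
  "sobolev_norm m a b f = sqrt (Re (sobolev_inner m a b f f))"

definition wave :: "real \<Rightarrow> real \<Rightarrow> complex" where
  "wave \<omega> x = exp (2 * of_real pi * \<i> * of_real \<omega> * of_real x)"

(* Only C 0, ..., C N matter; h is the spacing of the nodes. *)
definition error_functional ::
  "real \<Rightarrow> real \<Rightarrow> real \<Rightarrow> real \<Rightarrow> nat \<Rightarrow> (nat \<Rightarrow> complex) \<Rightarrow> (real \<Rightarrow> complex) \<Rightarrow> complex" where
  "error_functional \<omega> a b h N C f =
     (LINT x:{a..b}|lebesgue. wave \<omega> x * f x) - (\<Sum>\<beta>=0..N. C \<beta> * f (h * real \<beta> + a))"

(* Extended-real valued, so that the supremum is meaningful without knowing boundedness. *)
definition error_norm ::
  "nat \<Rightarrow> real \<Rightarrow> real \<Rightarrow> real \<Rightarrow> real \<Rightarrow> nat \<Rightarrow> (nat \<Rightarrow> complex) \<Rightarrow> ereal" where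
  "error_norm m \<omega> a b h N C =
     (SUP f\<in>{f \<in> sobolev_space m a b. sobolev_norm m a b f \<le> 1}.
        ereal (cmod (error_functional \<omega> a b h N C f)))"

definition exact_on_polynomials ::
  "nat \<Rightarrow> real \<Rightarrow> real \<Rightarrow> real \<Rightarrow> real \<Rightarrow> nat \<Rightarrow> (nat \<Rightarrow> complex) \<Rightarrow> bool" where
  "exact_on_polynomials m \<omega> a b h N C \<longleftrightarrow>
     (\<forall>\<alpha><m. error_functional \<omega> a b h N C (\<lambda>x. of_real x ^ \<alpha>) = 0)"

definition sard_optimal ::
  "nat \<Rightarrow> real \<Rightarrow> real \<Rightarrow> real \<Rightarrow> real \<Rightarrow> nat \<Rightarrow> (nat \<Rightarrow> complex) \<Rightarrow> bool" where
  "sard_optimal m \<omega> a b h N C \<longleftrightarrow>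
     exact_on_polynomials m \<omega> a b h N C \<and>
     (\<forall>C'. exact_on_polynomials m \<omega> a b h N C' \<longrightarrow>
        error_norm m \<omega> a b h N C \<le> error_norm m \<omega> a b h N C')"

(* The defining expression has removable singularities at 0 and 1, hence the polynomial
   is described by its values elsewhere; see euler_frobenius_ex1 for well-definedness. *)
definition euler_frobenius_spec :: "nat \<Rightarrow> complex poly \<Rightarrow> bool" where
  "euler_frobenius_spec k p \<longleftrightarrow>
     (\<forall>x. x \<noteq> 0 \<longrightarrow> x \<noteq> 1 \<longrightarrow>
        poly p x = (1 - x) ^ (k + 2) / x *
          (((\<lambda>f z. z * deriv f z) ^^ k) (\<lambda>z. z / (1 - z)\<^sup>2)) x)"

definition euler_frobenius :: "nat \<Rightarrow> complex poly" where
  "euler_frobenius k = (THE p. euler_frobenius_spec k p)"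

lemma euler_frobenius_form:
  "\<exists>p. \<forall>x::complex. x \<noteq> 1 \<longrightarrow>
     (((\<lambda>f z. z * deriv f z) ^^ k) (\<lambda>z. z / (1 - z)\<^sup>2)) x = x * poly p x / (1 - x) ^ (k + 2)"
proof (induction k)
  case 0
  show ?case by (rule exI[of _ 1]) (simp add: power2_eq_square)
next
  case (Suc k)
  define F where "F = ((\<lambda>f z. z * deriv f z) ^^ k) (\<lambda>z::complex. z / (1 - z)\<^sup>2)"
  from Suc obtain p where p: "\<And>x. x \<noteq> 1 \<Longrightarrow> F x = x * poly p x / (1 - x) ^ (k + 2)"
    unfolding F_def by blast
  define r where "r = [:1, -1:] * (p + [:0, 1:] * pderiv p) + smult (of_nat (k + 2)) ([:0, 1:] * p)"
  have "x * deriv F x = x * poly r x / (1 - x) ^ (Suc k + 2)" if x: "x \<noteq> 1" for x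
  proof -
    let ?G = "\<lambda>x. x * poly p x / (1 - x) ^ (k + 2)"
    have nz: "1 - x \<noteq> 0" using x by simp
    have "eventually (\<lambda>z. z \<in> - {1}) (nhds x)"
      using x by (intro eventually_nhds_in_open) auto
    then have "eventually (\<lambda>z. F z = ?G z) (nhds x)"
      by eventually_elim (use p in auto)
    then have "deriv F x = deriv ?G x"
      by (intro deriv_cong_ev) auto
    also have "deriv ?G x =
      ((poly p x + x * poly (pderiv p) x) * (1 - x) ^ (k + 2)
         + x * poly p x * (of_nat (k + 2) * (1 - x) ^ (k + 1))) / ((1 - x) ^ (k + 2)) ^ 2"
    proof (rule DERIV_imp_deriv)
      have num: "((\<lambda>x. x * poly p x) has_field_derivative (poly p x + x * poly (pderiv p) x)) (at x)"
        by (auto intro!: derivative_eq_intros)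
      have den: "((\<lambda>x. (1 - x) ^ (k + 2)) has_field_derivative (- (of_nat (k + 2) * (1 - x) ^ (k + 1)))) (at x)"
        by (rule derivative_eq_intros refl)+ simp
      show "(?G has_field_derivative
          ((poly p x + x * poly (pderiv p) x) * (1 - x) ^ (k + 2)
             + x * poly p x * (of_nat (k + 2) * (1 - x) ^ (k + 1))) / ((1 - x) ^ (k + 2)) ^ 2) (at x)"
        using DERIV_divide[OF num den] nz by (simp add: power2_eq_square)
    qed
    also have "\<dots> = poly r x / (1 - x) ^ (Suc k + 2)"
    proof -
      define y where "y = 1 - x"
      have y: "y \<noteq> 0" using nz y_def by simp
      have r: "poly r x = y * (poly p x + x * poly (pderiv p) x) + of_nat (k + 2) * (x * poly p x)"
        by (simp add: r_def y_def algebra_simps)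
      have "(A * y ^ (k + 2) + B * (n * y ^ (k + 1))) / (y ^ (k + 2)) ^ 2
             = (y * A + n * B) / y ^ (Suc k + 2)" for A B n
        using y by (simp add: field_simps power_add power2_eq_square)
      then show ?thesis
        unfolding y_def[symmetric] r .
    qed
    finally show ?thesis by simp
  qed
  then show ?case by (auto simp: F_def)
qed

lemma euler_frobenius_ex1: "\<exists>!p. euler_frobenius_spec k p"
proof (rule ex_ex1I)
  show "\<exists>p. euler_frobenius_spec k p"
  proof -
    obtain p where "\<forall>x::complex. x \<noteq> 1 \<longrightarrow>
       (((\<lambda>f z. z * deriv f z) ^^ k) (\<lambda>z. z / (1 - z)\<^sup>2)) x = x * poly p x / (1 - x) ^ (k + 2)"
      using euler_frobenius_form by blast
    then show ?thesis
      unfolding euler_frobenius_spec_def by (intro exI[of _ p]) auto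
  qed
next
  fix p r assume "euler_frobenius_spec k p" "euler_frobenius_spec k r"
  then have eq: "poly (p - r) x = 0" if "x \<notin> {0, 1}" for x
    using that by (auto simp: euler_frobenius_spec_def)
  have "infinite (- {0, 1 :: complex})"
    by (simp add: finite_compl infinite_UNIV_char_0)
  then have "infinite {x. poly (p - r) x = 0}"
    by (rule infinite_super[rotated]) (use eq in auto)
  then have "p - r = 0"
    using poly_roots_finite by blast
  then show "p = r" by simp
qed

(* The difference of order t of x^j at x = 0. *)
definition diff0 :: "nat \<Rightarrow> nat \<Rightarrow> complex" where
  "diff0 t j = (\<Sum>l=1..t. (-1) ^ (t - l) * of_nat (t choose l) * of_nat l ^ j)"

definition coefficient_system ::
  "nat \<Rightarrow> nat \<Rightarrow> real \<Rightarrow> real \<Rightarrow> real \<Rightarrow> real \<Rightarrow> (nat \<Rightarrow> complex)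
     \<Rightarrow> (nat \<Rightarrow> complex) \<Rightarrow> (nat \<Rightarrow> complex) \<Rightarrow> bool" where
  "coefficient_system m N a b h \<omega> q A B \<longleftrightarrow>
     (\<forall>j\<in>{1..m - 1}.
        (\<Sum>k=1..m - 1. A k * (\<Sum>t=1..j. q k * diff0 t j / (q k - 1) ^ (t + 1)))
      + (\<Sum>k=1..m - 1. B k * (\<Sum>t=1..j. q k ^ (N + t) * diff0 t j / (1 - q k) ^ (t + 1)))
      = fact j * wave \<omega> a / (2 * of_real pi * \<i> * of_real \<omega> * of_real h) ^ (j + 1)) \<and>
     (\<forall>j\<in>{1..m - 1}.
        (\<Sum>k=1..m - 1. A k *
           ((\<Sum>t=1..j. q k ^ t * diff0 t j / (1 - q k) ^ (t + 1))
            - (\<Sum>\<alpha>=1..j. of_real (h / (b - a)) powi (int \<alpha> - int j) * of_nat (j choose \<alpha>) *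
                 (\<Sum>t=1..\<alpha>. q k ^ (N + t) * diff0 t \<alpha> / (1 - q k) ^ (t + 1)))))
      + (\<Sum>k=1..m - 1. B k *
           ((\<Sum>t=1..j. q k ^ (N + 1) * diff0 t j / (q k - 1) ^ (t + 1))
            - (\<Sum>\<alpha>=1..j. of_real (h / (b - a)) powi (int \<alpha> - int j) * of_nat (j choose \<alpha>) *
                 (\<Sum>t=1..\<alpha>. q k * diff0 t \<alpha> / (q k - 1) ^ (t + 1)))))
      = (-1) ^ (j + 1) * fact j * wave \<omega> a
            / (2 * of_real pi * \<i> * of_real \<omega> * of_real h) ^ (j + 1)
        + (\<Sum>\<alpha>=1..j. of_real (h / (b - a)) powi (int \<alpha> - int j) *
             ((-1) ^ \<alpha> * fact j * wave \<omega> b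
              / (fact (j - \<alpha>) * (2 * of_real pi * \<i> * of_real \<omega> * of_real h) ^ (\<alpha> + 1)))))"

definition optimal_coefficient ::
  "nat \<Rightarrow> nat \<Rightarrow> real \<Rightarrow> real \<Rightarrow> real \<Rightarrow> real \<Rightarrow> (nat \<Rightarrow> complex)
     \<Rightarrow> (nat \<Rightarrow> complex) \<Rightarrow> (nat \<Rightarrow> complex) \<Rightarrow> nat \<Rightarrow> complex" where
  "optimal_coefficient m N a b h \<omega> q A B \<beta> =
     (if \<beta> = 0 then
        of_real h * (- (wave \<omega> a / (2 * of_real pi * \<i> * of_real \<omega> * of_real h))
          + (\<Sum>k=1..m - 1. A k * (q k / (q k - 1)) + B k * (q k ^ N / (1 - q k))))
      else if \<beta> = N then
        of_real h * (wave \<omega> b / (2 * of_real pi * \<i> * of_real \<omega> * of_real h)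
          + (\<Sum>k=1..m - 1. A k * (q k ^ N / (1 - q k)) + B k * (q k / (q k - 1))))
      else
        of_real h * (\<Sum>k=1..m - 1. A k * q k ^ \<beta> + B k * q k ^ (N - \<beta>)))"

end

(* Since \<omega> h is an integer, exp (2 \<pi> i \<omega> x) takes the same value at all nodes. The error functional of
   a formula that is exact on polynomials of degree < m is integration of the m-th derivative against a
   kernel K. By a perturbation argument the formula is the unique optimal one as soon as K is the conjugate
   of the m-th derivative of a smooth function that is constant at the nodes.

   Such a function is the exponential divided by (2 \<pi> i \<omega>)^(2m), minus a spline of degree 2m-1 that vanishes
   at the nodes. Every such spline has knot coefficients a_k q_k^\<beta> + b_k q_k^(N-\<beta>): because \<Sum>_r r^(2m-1) q^r
   vanishes at the roots q of E_(2m-2) in the unit disc, the truncated powers with knot coefficients q^\<beta>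
   (or q^(-\<beta>)) agree at the nodes with a polynomial of degree 2m-1. The two halves of the linear system are
   equivalent to the vanishing of the derivatives of K at the two end points. The system is uniquely
   solvable, since a natural spline with N + 1 \<ge> m nodes at all of which it vanishes is zero.

   The Sobolev space contains functions whose (m-1)-th derivative is merely absolutely continuous, so the
   integration by parts needs the fundamental theorem of calculus for these; the differentiability almost
   everywhere is obtained by applying the Vitali covering theorem twice, directly to the function without
   a decomposition into monotone parts. *)
theory Submission
  imports Defs
begin

section \<open>Absolutely continuous functions on an interval\<close>

text \<open>Constancy at the nodes suffices because admissible formulas are exact on constants: the
  coefficients of two of them differ by a vector of sum zero, so both functionals take the same
  value on the function behind \<open>K\<close>. Integrality of \<omega> h thus lets the subtracted
  spline vanish at the nodes instead of interpolating the exponential there. The task of the spline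
  is to remove the derivatives of orders m, ..., 2m-2 of the exponential at both ends. These are m-1
  conditions per end, the 2m-2 equations; the boundary term left over at each end multiplies the
  value of the integrated function itself and becomes the end coefficient C_0 or C_N. Splines are
  written in the variable (x - a) / h, with knots 1, ..., N-1, which turns the derivatives of the
  exponential into quotients by powers of p = 2 \<pi> i \<omega> h. Integration by parts is done
  once, with a factor e before the exponential: e = 1 represents the error functional, e = 0 gives
  the energy identity behind unique solvability.\<close>

abbreviation ivl :: "real \<times> real \<Rightarrow> real set" where
  "ivl i \<equiv> {fst i..snd i}"

abbreviation disjoint_ivls :: "(real \<times> real) set \<Rightarrow> bool" where
  "disjoint_ivls \<equiv> pairwise (\<lambda>i j. disjnt (ivl i) (ivl j))"

text \<open>The index type is free because the families that occur are indexed by naturals, by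
  intervals, by pairs of intervals and by tagged pieces of a division. Only the open interiors have
  to be disjoint, so abutting intervals are allowed.\<close>

definition interval_family :: "real \<Rightarrow> real \<Rightarrow> 'i set \<Rightarrow> ('i \<Rightarrow> real) \<Rightarrow> ('i \<Rightarrow> real) \<Rightarrow> bool" where
  "interval_family a b S u v \<longleftrightarrow> finite S \<and> (\<forall>i\<in>S. a \<le> u i \<and> u i \<le> v i \<and> v i \<le> b) \<and>
     (\<forall>i\<in>S. \<forall>j\<in>S. i \<noteq> j \<longrightarrow> {u i<..<v i} \<inter> {u j<..<v j} = {})"

text \<open>Renumbering along a bijection with an initial segment of the naturals frees the defining
  property from its index type.\<close>

lemma absolutely_continuousD:
  assumes ac: "absolutely_continuous_on_interval a b f" and e: "e > 0"
  shows "\<exists>d>0. \<forall>(S::'i set) u v. interval_family a b S u v \<longrightarrow>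
           (\<Sum>i\<in>S. v i - u i) < d \<longrightarrow> (\<Sum>i\<in>S. dist (f (u i)) (f (v i))) < e"
proof -
  obtain d where d: "d > 0" and D: "\<And>n (u::nat \<Rightarrow> real) v. \<lbrakk>\<forall>i<n. a \<le> u i \<and> u i \<le> v i \<and> v i \<le> b;
        \<forall>i<n. \<forall>j<n. i \<noteq> j \<longrightarrow> {u i<..<v i} \<inter> {u j<..<v j} = {};
        (\<Sum>i<n. v i - u i) < d\<rbrakk> \<Longrightarrow> (\<Sum>i<n. dist (f (u i)) (f (v i))) < e"
    using ac[unfolded absolutely_continuous_on_interval_def, THEN spec, THEN mp, OF e] by blast
  show ?thesis
  proof (intro exI[of _ d] conjI d allI impI)
    fix S :: "'i set" and u v
    assume "interval_family a b S u v" and lt: "(\<Sum>i\<in>S. v i - u i) < d"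
    then have S: "finite S" "\<forall>i\<in>S. a \<le> u i \<and> u i \<le> v i \<and> v i \<le> b"
      "\<forall>i\<in>S. \<forall>j\<in>S. i \<noteq> j \<longrightarrow> {u i<..<v i} \<inter> {u j<..<v j} = {}"
      by (auto simp only: interval_family_def)
    obtain h where h: "bij_betw h {..<card S} S"
      using ex_bij_betw_nat_finite[OF S(1)] by (auto simp: atLeast0LessThan)
    have hS: "i < card S \<Longrightarrow> h i \<in> S" for i
      using h by (auto simp: bij_betw_def)
    have inj: "i < card S \<Longrightarrow> j < card S \<Longrightarrow> i \<noteq> j \<Longrightarrow> h i \<noteq> h j" for i j
      using h by (auto simp: bij_betw_def inj_on_def)
    have "(\<Sum>i<card S. dist (f (u (h i))) (f (v (h i)))) < e"
    proof (rule D)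
      show "(\<Sum>i<card S. v (h i) - u (h i)) < d"
        using lt sum.reindex_bij_betw[OF h, of "\<lambda>i. v i - u i"] by simp
    qed (use S hS inj in auto)
    then show "(\<Sum>i\<in>S. dist (f (u i)) (f (v i))) < e"
      using sum.reindex_bij_betw[OF h, of "\<lambda>i. dist (f (u i)) (f (v i))"] by simp
  qed
qed

lemma absolutely_continuousI:
  assumes "\<And>e. e > 0 \<Longrightarrow> \<exists>d>0. \<forall>(S::nat set) u v. interval_family a b S u v \<longrightarrow>
           (\<Sum>i\<in>S. v i - u i) < d \<longrightarrow> (\<Sum>i\<in>S. dist (f (u i)) (f (v i))) < e"
  shows "absolutely_continuous_on_interval a b f"
  unfolding absolutely_continuous_on_interval_def
proof (intro allI impI)
  fix e :: real assume "e > 0"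
  then obtain d where d: "d > 0" and D: "\<And>(S::nat set) u v. interval_family a b S u v \<Longrightarrow>
           (\<Sum>i\<in>S. v i - u i) < d \<Longrightarrow> (\<Sum>i\<in>S. dist (f (u i)) (f (v i))) < e"
    using assms by blast
  show "\<exists>\<delta>>0. \<forall>(n::nat) u v.
          (\<forall>i<n. a \<le> u i \<and> u i \<le> v i \<and> v i \<le> b) \<longrightarrow>
          (\<forall>i<n. \<forall>j<n. i \<noteq> j \<longrightarrow> {u i<..<v i} \<inter> {u j<..<v j} = {}) \<longrightarrow>
          (\<Sum>i<n. v i - u i) < \<delta> \<longrightarrow> (\<Sum>i<n. dist (f (u i)) (f (v i))) < e"
    by (intro exI[of _ d] conjI d allI impI D) (simp_all add: interval_family_def)
qed

text \<open>A common source for products, sums and the passage to real and imaginary parts: only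
  increments are compared, each time with another constant \<open>B\<close>.\<close>

lemma absolutely_continuous_combine:
  fixes f g :: "real \<Rightarrow> complex"
  assumes f: "absolutely_continuous_on_interval a b f" and g: "absolutely_continuous_on_interval a b g"
    and k: "\<And>x y. x \<in> {a..b} \<Longrightarrow> y \<in> {a..b} \<Longrightarrow> dist (k x) (k y) \<le> B * (dist (f x) (f y) + dist (g x) (g y))"
  shows "absolutely_continuous_on_interval a b k"
proof (rule absolutely_continuousI)
  fix e :: real assume e: "e > 0"
  define B' where "B' = \<bar>B\<bar> + 1"
  have B': "B' > 0" "B \<le> B'" by (auto simp: B'_def)
  define e' where "e' = e / (2 * B')"
  have e': "e' > 0" using e B' by (auto simp: e'_def)
  obtain d1 where d1: "d1 > 0" and D1: "\<And>(S::nat set) u v. interval_family a b S u v \<Longrightarrow>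
      (\<Sum>i\<in>S. v i - u i) < d1 \<Longrightarrow> (\<Sum>i\<in>S. dist (f (u i)) (f (v i))) < e'"
    using absolutely_continuousD[OF f e'] by blast
  obtain d2 where d2: "d2 > 0" and D2: "\<And>(S::nat set) u v. interval_family a b S u v \<Longrightarrow>
      (\<Sum>i\<in>S. v i - u i) < d2 \<Longrightarrow> (\<Sum>i\<in>S. dist (g (u i)) (g (v i))) < e'"
    using absolutely_continuousD[OF g e'] by blast
  show "\<exists>d>0. \<forall>(S::nat set) u v. interval_family a b S u v \<longrightarrow>
           (\<Sum>i\<in>S. v i - u i) < d \<longrightarrow> (\<Sum>i\<in>S. dist (k (u i)) (k (v i))) < e"
  proof (intro exI[of _ "min d1 d2"] conjI allI impI)
    fix S :: "nat set" and u v
    assume uv: "interval_family a b S u v" and lt: "(\<Sum>i\<in>S. v i - u i) < min d1 d2"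
    have "(\<Sum>i\<in>S. dist (k (u i)) (k (v i))) \<le> (\<Sum>i\<in>S. B' * (dist (f (u i)) (f (v i)) + dist (g (u i)) (g (v i))))"
    proof (rule sum_mono)
      fix i assume "i \<in> S"
      then have "u i \<in> {a..b}" "v i \<in> {a..b}" using uv unfolding interval_family_def by force+
      then have "dist (k (u i)) (k (v i)) \<le> B * (dist (f (u i)) (f (v i)) + dist (g (u i)) (g (v i)))" by (rule k)
      also have "\<dots> \<le> B' * (dist (f (u i)) (f (v i)) + dist (g (u i)) (g (v i)))"
        using B' by (intro mult_right_mono) auto
      finally show "dist (k (u i)) (k (v i)) \<le> B' * (dist (f (u i)) (f (v i)) + dist (g (u i)) (g (v i)))" .
    qed
    also have "\<dots> = B' * ((\<Sum>i\<in>S. dist (f (u i)) (f (v i))) + (\<Sum>i\<in>S. dist (g (u i)) (g (v i))))"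
      by (simp add: sum_distrib_left sum.distrib[symmetric] distrib_left)
    also have "\<dots> < B' * (e' + e')"
      using D1[OF uv] D2[OF uv] lt B' by (intro mult_strict_left_mono) auto
    also have "\<dots> = e" using B' by (simp add: e'_def field_simps)
    finally show "(\<Sum>i\<in>S. dist (k (u i)) (k (v i))) < e" .
  qed (use d1 d2 in auto)
qed

lemma absolutely_continuous_C1:
  fixes f :: "real \<Rightarrow> complex"
  assumes D: "\<And>x. x \<in> {a..b} \<Longrightarrow> (f has_vector_derivative f' x) (at x within {a..b})"
    and cont: "continuous_on {a..b} f'"
  shows "absolutely_continuous_on_interval a b f"
proof -
  obtain B where B: "\<And>x. x \<in> {a..b} \<Longrightarrow> norm (f' x) \<le> B"
    using compact_imp_bounded[OF compact_continuous_image[OF cont compact_Icc]] unfolding bounded_iff by blast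
  define B' where "B' = \<bar>B\<bar> + 1"
  have B': "B' > 0" "B \<le> B'" by (auto simp: B'_def)
  have Lip: "dist (f x) (f y) \<le> B' * (y - x)" if xy: "x \<in> {a..b}" "y \<in> {a..b}" "x \<le> y" for x y
  proof -
    have "norm (f x - f y) \<le> B' * norm (x - y)"
    proof (rule differentiable_bound[OF _ _ _ xy(1,2)])
      fix z assume z: "z \<in> {a..b}"
      show "(f has_derivative (\<lambda>h. h *\<^sub>R f' z)) (at z within {a..b})"
        using D[OF z] by (simp add: has_vector_derivative_def)
      have "norm (f' z) \<le> B'" using B[OF z] B' by linarith
      from mult_left_mono[OF this abs_ge_zero] show "onorm (\<lambda>h. h *\<^sub>R f' z) \<le> B'"
        by (intro onorm_le) (simp add: mult.commute)
    qed auto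
    then show ?thesis using xy(3) by (simp add: dist_norm)
  qed
  show ?thesis
  proof (rule absolutely_continuousI)
    fix e :: real assume e: "e > 0"
    show "\<exists>d>0. \<forall>(S::nat set) u v. interval_family a b S u v \<longrightarrow>
           (\<Sum>i\<in>S. v i - u i) < d \<longrightarrow> (\<Sum>i\<in>S. dist (f (u i)) (f (v i))) < e"
    proof (intro exI[of _ "e / B'"] conjI allI impI)
      fix S :: "nat set" and u v
      assume uv: "interval_family a b S u v" and lt: "(\<Sum>i\<in>S. v i - u i) < e / B'"
      have "(\<Sum>i\<in>S. dist (f (u i)) (f (v i))) \<le> (\<Sum>i\<in>S. B' * (v i - u i))"
        using uv by (intro sum_mono Lip) (force simp: interval_family_def)+
      also have "\<dots> = B' * (\<Sum>i\<in>S. v i - u i)" by (simp add: sum_distrib_left)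
      also have "\<dots> < e" using lt B' by (simp add: field_simps)
      finally show "(\<Sum>i\<in>S. dist (f (u i)) (f (v i))) < e" .
    qed (use e B' in auto)
  qed
qed

lemma absolutely_continuous_subinterval:
  assumes "absolutely_continuous_on_interval a b f" "a \<le> c" "d \<le> b"
  shows "absolutely_continuous_on_interval c d f"
proof (rule absolutely_continuousI)
  have "interval_family c d S u v \<Longrightarrow> interval_family a b S u v" for S :: "nat set" and u v
    using assms(2,3) unfolding interval_family_def by force
  then show "\<exists>\<delta>>0. \<forall>(S::nat set) u v. interval_family c d S u v \<longrightarrow>
           (\<Sum>i\<in>S. v i - u i) < \<delta> \<longrightarrow> (\<Sum>i\<in>S. dist (f (u i)) (f (v i))) < e" if "e > 0" for e
    using absolutely_continuousD[OF assms(1) that, where 'i = nat] by meson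
qed

section \<open>Vitali coverings by intervals with steep chords\<close>

lemma interval_gaps:
  fixes c d :: real
  assumes "finite C" "c \<le> d" "\<And>u v. (u,v) \<in> C \<Longrightarrow> c \<le> u \<and> u < v \<and> v \<le> d"
    "disjoint_ivls C"
  shows "\<exists>D. finite D \<and> (\<forall>(u,v)\<in>D. c \<le> u \<and> u \<le> v \<and> v \<le> d) \<and>
    (\<forall>i\<in>D. \<forall>j\<in>D. i \<noteq> j \<longrightarrow> {fst i<..<snd i} \<inter> {fst j<..<snd j} = {}) \<and>
    (\<forall>\<phi>::real \<Rightarrow> real. \<phi> d - \<phi> c = (\<Sum>i\<in>C. \<phi> (snd i) - \<phi> (fst i)) + (\<Sum>i\<in>D. \<phi> (snd i) - \<phi> (fst i)))"
  using assms
proof (induction "card C" arbitrary: C d)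
  case 0
  then have "C = {}" by simp
  then show ?case using 0 by (intro exI[of _ "{(c,d)}"]) auto
next
  case (Suc n)
  \<comment> \<open>The rightmost interval is split off: what lies to its left is handled by
    induction on [c, u], and the only new gap is (v, d), which may be degenerate.\<close>
  then have "snd ` C \<noteq> {}" "finite (snd ` C)" by auto
  then obtain i where i: "i \<in> C" "snd i = Max (snd ` C)"
    by (metis (no_types, lifting) Max_in imageE)
  obtain u v where uv: "i = (u,v)" by force
  have c: "c \<le> u" "u < v" "v \<le> d" using Suc.prems i uv by auto
  have mx: "snd j \<le> v" if "j \<in> C" for j using i uv that Suc.prems(1) by simp
  let ?C = "C - {i}"
  have cu: "c \<le> u' \<and> u' < v' \<and> v' \<le> u" if "(u',v') \<in> ?C" for u' v'
  proof -
    have "disjnt {u..v} {u'..v'}"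
      using Suc.prems(4) i that unfolding pairwise_def uv by fastforce
    moreover have "v' \<le> v" "c \<le> u'" "u' < v'" using mx[of "(u',v')"] that Suc.prems(3) by auto
    ultimately show ?thesis using c by (auto simp: disjnt_iff dest: spec[of _ v'])
  qed
  have "card ?C = n" "finite ?C" using Suc.hyps(2) i Suc.prems by auto
  moreover have "disjoint_ivls ?C"
    using Suc.prems(4) by (rule pairwise_subset) auto
  ultimately obtain D where D: "finite D" "\<forall>(u',v')\<in>D. c \<le> u' \<and> u' \<le> v' \<and> v' \<le> u"
    "\<forall>i\<in>D. \<forall>j\<in>D. i \<noteq> j \<longrightarrow> {fst i<..<snd i} \<inter> {fst j<..<snd j} = {}"
    "\<And>\<phi>::real \<Rightarrow> real. \<phi> u - \<phi> c = (\<Sum>i\<in>?C. \<phi> (snd i) - \<phi> (fst i)) + (\<Sum>i\<in>D. \<phi> (snd i) - \<phi> (fst i))"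
    using Suc.hyps(1)[of ?C u] c cu by auto
  have nD: "(v,d) \<notin> D" using D(2) c by force
  show ?case
  proof (intro exI[of _ "insert (v,d) D"] conjI allI)
    show "\<forall>i\<in>insert (v, d) D. \<forall>j\<in>insert (v, d) D. i \<noteq> j \<longrightarrow> {fst i<..<snd i} \<inter> {fst j<..<snd j} = {}"
      using D(2,3) c by (fastforce simp: disjoint_iff)
    fix \<phi> :: "real \<Rightarrow> real"
    have "(\<Sum>i\<in>C. \<phi> (snd i) - \<phi> (fst i)) = \<phi> v - \<phi> u + (\<Sum>i\<in>?C. \<phi> (snd i) - \<phi> (fst i))"
      using sum.remove[OF Suc.prems(1) i(1), of "\<lambda>i. \<phi> (snd i) - \<phi> (fst i)"] uv by simp
    then show "\<phi> d - \<phi> c = (\<Sum>i\<in>C. \<phi> (snd i) - \<phi> (fst i)) + (\<Sum>i\<in>insert (v, d) D. \<phi> (snd i) - \<phi> (fst i))"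
      using D(4)[of \<phi>] D(1) nD by simp
  qed (use D c in auto)
qed

text \<open>The intervals inside \<open>T\<close> with a chord steeper than \<open>r\<close> form a
  Vitali cover of \<open>S\<close>. The sign of \<open>r\<close> is free, so descents of a function
  can be treated as ascents of its negative.\<close>

lemma Vitali_steep_intervals:
  fixes g :: "real \<Rightarrow> real"
  assumes S: "S \<in> sets lebesgue" "S \<subseteq> T" and T: "open T" "bounded T"
    and up: "\<And>x d. x \<in> S \<Longrightarrow> d > 0 \<Longrightarrow> \<exists>u v. u < x \<and> x < v \<and> v - u < d \<and> r * (v - u) < g v - g u"
    and \<kappa>: "\<kappa> > 0"
  shows "\<exists>C. finite C \<and> (\<forall>u v. (u,v) \<in> C \<longrightarrow> u < v \<and> {u..v} \<subseteq> T \<and> r * (v - u) < g v - g u) \<and>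
    disjoint_ivls C \<and>
    measure lebesgue (S - (\<Union>i\<in>C. ivl i)) < \<kappa>"
proof -
  define K where "K = {(u,v). u < v \<and> {u..v} \<subseteq> T \<and> r * (v - u) < g v - g u}"
  \<comment> \<open>The covering theorem speaks of balls, so intervals are recoded by centre and
    radius.\<close>
  define ce where "ce i = (fst i + snd i) / 2" for i :: "real \<times> real"
  define ra where "ra i = (snd i - fst i) / 2" for i :: "real \<times> real"
  have cb: "cball (ce i) (ra i) = ivl i" for i
    by (simp add: cball_eq_atLeastAtMost ce_def ra_def field_simps)
  obtain C where C: "countable C" "C \<subseteq> K"
     "pairwise (\<lambda>i j. disjnt (cball (ce i) (ra i)) (cball (ce j) (ra j))) C"
     "negligible(S - (\<Union>i \<in> C. cball (ce i) (ra i)))"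
  proof (rule Vitali_covering_theorem_cballs[of K ra S ce])
    show "\<And>i. i \<in> K \<Longrightarrow> 0 < ra i" by (auto simp: K_def ra_def)
    fix x d :: real assume x: "x \<in> S" "0 < d"
    obtain e where e: "e > 0" "ball x e \<subseteq> T"
      using x S T(1) by (meson openE subsetD)
    obtain u v where uv: "u < x" "x < v" "v - u < min d e" "r * (v - u) < g v - g u"
      using up[OF x(1), of "min d e"] x e by auto
    have "{u..v} \<subseteq> ball x e" using uv by (auto simp: dist_real_def)
    then show "\<exists>i. i \<in> K \<and> x \<in> cball (ce i) (ra i) \<and> ra i < d"
      using uv e x(2) unfolding cb by (intro exI[of _ "(u,v)"]) (auto simp: K_def ra_def)
  qed
  \<comment> \<open>\<open>A n\<close> is what the first \<open>n\<close> members of an enumeration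
    of \<open>C\<close> leave uncovered. These sets have finite measure and decrease to a null set,
    so finitely many intervals suffice up to \<kappa>. Intersecting with \<open>C\<close> takes care
    of an empty \<open>C\<close>.\<close>
  define A where "A n = S - (\<Union>i\<in>C \<inter> from_nat_into C ` {..<n}. ivl i)" for n
  have Sfin: "S \<in> lmeasurable"
    using S T by (meson bounded_set_imp_lmeasurable bounded_subset)
  have Am: "A n \<in> lmeasurable" for n
    unfolding A_def using Sfin
    by (intro fmeasurable_Diff sets.finite_UN) auto
  have "(\<lambda>n. measure lebesgue (A n)) \<longlonglongrightarrow> measure lebesgue (\<Inter>n. A n)"
  proof (rule Lim_measure_decseq)
    show "range A \<subseteq> sets lebesgue" using Am by (auto simp: fmeasurableD)
    show "decseq A" unfolding decseq_def A_def by fastforce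
    show "\<And>i. emeasure lebesgue (A i) \<noteq> \<infinity>" using fmeasurableD2[OF Am] by simp
  qed
  moreover have "measure lebesgue (\<Inter>n. A n) = 0"
  proof -
    have "(\<Inter>n. A n) \<subseteq> S - (\<Union>i \<in> C. cball (ce i) (ra i))"
    proof
      fix x assume x: "x \<in> (\<Inter>n. A n)"
      have "x \<notin> ivl i" if i: "i \<in> C" for i
      proof -
        obtain n where "from_nat_into C n = i"
          using from_nat_into_surj[OF C(1) i] by blast
        then have "i \<in> C \<inter> from_nat_into C ` {..<Suc n}" using i by auto
        moreover have "x \<in> A (Suc n)" using x by blast
        ultimately show ?thesis unfolding A_def by blast
      qed
      moreover have "x \<in> A 0" using x by blast
      ultimately show "x \<in> S - (\<Union>i \<in> C. cball (ce i) (ra i))" by (auto simp: A_def cb)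
    qed
    then show ?thesis using C(4) negligible_imp_measure0 negligible_subset by blast
  qed
  ultimately have "eventually (\<lambda>n. measure lebesgue (A n) < \<kappa>) sequentially"
    using \<kappa> by (metis order_tendstoD(2))
  then obtain n where n: "measure lebesgue (A n) < \<kappa>"
    by (auto simp: eventually_sequentially)
  show ?thesis
  proof (intro exI[of _ "C \<inter> from_nat_into C ` {..<n}"] conjI)
    show "\<forall>u v. (u, v) \<in> C \<inter> from_nat_into C ` {..<n} \<longrightarrow>
           u < v \<and> {u..v} \<subseteq> T \<and> r * (v - u) < g v - g u"
      using C(2) by (auto simp: K_def)
    show "disjoint_ivls (C \<inter> from_nat_into C ` {..<n})"
      using C(3) unfolding cb by (rule pairwise_subset) auto
    show "measure lebesgue (S - (\<Union>i\<in>C \<inter> from_nat_into C ` {..<n}. ivl i)) < \<kappa>"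
      using n by (simp add: A_def)
  qed auto
qed


text \<open>\<open>S\<close> is covered up to small measure by disjoint intervals \<open>C\<close>
  on which \<open>g\<close> rises slower than \<open>s\<close>, and inside these by disjoint
  intervals \<open>D\<close> on which it rises faster than \<open>r\<close>. The parts of
  \<open>C\<close> outside \<open>D\<close> are short, so \<open>g\<close> changes little there by
  absolute continuity. Comparing increments gives r |S| \<le> s |S| up to an arbitrarily small
  error.\<close>

lemma absolutely_continuous_crossing_slopes_negligible:
  fixes g :: "real \<Rightarrow> real"
  assumes ac: "absolutely_continuous_on_interval a b (\<lambda>x. of_real (g x))"
    and sr: "s < r"
    and S: "S \<in> sets lebesgue" "S \<subseteq> {a<..<b}"
    and up: "\<And>x d. x \<in> S \<Longrightarrow> d > 0 \<Longrightarrow> \<exists>u v. u < x \<and> x < v \<and> v - u < d \<and> r * (v - u) < g v - g u"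
    and dn: "\<And>x d. x \<in> S \<Longrightarrow> d > 0 \<Longrightarrow> \<exists>u v. u < x \<and> x < v \<and> v - u < d \<and> g v - g u < s * (v - u)"
  shows "negligible S"
proof -
  have Sfin: "S \<in> lmeasurable"
    using S bounded_subset[OF bounded_box[of a b]] by (auto intro: bounded_set_imp_lmeasurable)
  let ?\<mu> = "measure lebesgue"
  have main: "(r - s) * ?\<mu> S \<le> (\<bar>r\<bar> + \<bar>s\<bar> + 1) * \<eta>" if \<eta>: "\<eta> > 0" for \<eta>
  proof -
    obtain d0 where d0: "d0 > 0" and AC: "\<And>(T::((real \<times> real) \<times> (real \<times> real)) set) u v. interval_family a b T u v \<Longrightarrow>
        (\<Sum>i\<in>T. v i - u i) < d0 \<Longrightarrow> (\<Sum>i\<in>T. dist (complex_of_real (g (u i))) (of_real (g (v i)))) < \<eta>"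
      using absolutely_continuousD[OF ac \<eta>] by blast
    \<comment> \<open>Each of the two coverings and the open set \<open>T\<close> costs at most
      \<delta> of measure. The gaps thus have length at most 3 \<delta> < \<open>d0\<close>, and the
      lengths of \<open>C\<close> and \<open>D\<close> differ from the measure of \<open>S\<close>
      by at most 2 \<delta> \<le> \<eta> / 2.\<close>
    define \<delta> where "\<delta> = min d0 \<eta> / 4"
    have \<delta>: "\<delta> > 0" "4 * \<delta> \<le> d0" "4 * \<delta> \<le> \<eta>" using d0 \<eta> by (auto simp: \<delta>_def)
    obtain T0 where T0: "open T0" "S \<subseteq> T0" "T0 - S \<in> lmeasurable" "emeasure lebesgue (T0 - S) < ennreal \<delta>"
      using sets_lebesgue_outer_open[OF S(1) \<delta>(1)] by blast
    define T where "T = T0 \<inter> {a<..<b}"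
    have T: "open T" "bounded T" "S \<subseteq> T" "T \<subseteq> {a<..<b}"
      using T0 S by (auto simp: T_def)
    have Tm: "T \<in> lmeasurable" using T by (simp add: lmeasurable_open)
    have TS: "?\<mu> (T - S) < \<delta>"
    proof -
      have "?\<mu> (T - S) \<le> ?\<mu> (T0 - S)"
        using T0 Tm Sfin by (intro measure_mono_fmeasurable) (auto simp: T_def)
      also have "\<dots> < \<delta>" using T0(3,4) \<delta>(1)
        by (metis emeasure_eq_measure2 ennreal_less_iff measure_nonneg)
      finally show ?thesis .
    qed
    have dn': "\<exists>u v. u < x \<and> x < v \<and> v - u < d \<and> (-s) * (v - u) < (- g v) - (- g u)"
      if x: "x \<in> S" "d > 0" for x d
    proof -
      obtain u v where "u < x" "x < v" "v - u < d" "g v - g u < s * (v - u)" using dn[OF x] by blast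
      then show ?thesis by (intro exI[of _ u] exI[of _ v]) auto
    qed
    obtain C where C: "finite C" "\<And>u v. (u,v) \<in> C \<Longrightarrow> u < v \<and> {u..v} \<subseteq> T \<and> (-s) * (v - u) < (- g v) - (- g u)"
      "disjoint_ivls C"
      "?\<mu> (S - (\<Union>i\<in>C. ivl i)) < \<delta>"
      using Vitali_steep_intervals[OF S(1) T(3,1,2) dn' \<delta>(1)] by blast
    \<comment> \<open>The second covering runs inside the open interiors of \<open>C\<close>, so
      that each interval of \<open>D\<close> lies in exactly one interval of
      \<open>C\<close>.\<close>
    define T' where "T' = (\<Union>i\<in>C. {fst i<..<snd i})"
    define S' where "S' = S \<inter> T'"
    have "open T'" unfolding T'_def by auto
    moreover have T'T: "T' \<subseteq> T" using C(2) unfolding T'_def by fastforce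
    ultimately have T': "open T'" "bounded T'" using T(2) bounded_subset by blast+
    have S': "S' \<in> sets lebesgue" "S' \<subseteq> T'" "S' \<subseteq> S"
      using S(1) T'(1) by (auto simp: S'_def)
    have up': "\<exists>u v. u < x \<and> x < v \<and> v - u < d \<and> r * (v - u) < g v - g u"
      if x: "x \<in> S'" "d > 0" for x d
      using up[of x d] x S'(3) by blast
    obtain D where D: "finite D" "\<And>u v. (u,v) \<in> D \<Longrightarrow> u < v \<and> {u..v} \<subseteq> T' \<and> r * (v - u) < g v - g u"
      "disjoint_ivls D"
      "?\<mu> (S' - (\<Union>i\<in>D. ivl i)) < \<delta>"
      using Vitali_steep_intervals[OF S'(1,2) T' up' \<delta>(1)] by blast
    define P where "P i = {j \<in> D. fst i \<le> fst j \<and> snd j \<le> snd i}" for i :: "real \<times> real"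
    have memb: "\<exists>i\<in>C. j \<in> P i" if j: "j \<in> D" for j
    proof -
      obtain u v where uv: "j = (u,v)" by force
      have *: "u < v" "{u..v} \<subseteq> T'" using D(2) j uv by auto
      then have "u \<in> T'" by auto
      then obtain i where i: "i \<in> C" "fst i < u" "u < snd i" unfolding T'_def by auto
      \<comment> \<open>Otherwise the right end point of \<open>i\<close> would be interior to a
        second member of \<open>C\<close>, against the disjointness of the closed intervals.\<close>
      have "v \<le> snd i"
      proof (rule ccontr)
        assume "\<not> v \<le> snd i"
        then have "snd i \<in> T'" using i * by auto
        then obtain i' where i': "i' \<in> C" "fst i' < snd i" "snd i < snd i'" unfolding T'_def by auto
        then have "disjnt (ivl i) (ivl i')" using C(3) i(1) by (auto simp: pairwise_def)
        then show False using i i' unfolding disjnt_iff by (auto dest: spec[of _ "snd i"])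
      qed
      then show ?thesis using i j uv by (intro bexI[of _ i]) (auto simp: P_def)
    qed
    have Punique: "P i \<inter> P i' = {}" if "i \<in> C" "i' \<in> C" "i \<noteq> i'" for i i'
    proof -
      have "disjnt (ivl i) (ivl i')" using C(3) that by (auto simp: pairwise_def)
      then have "fst j < snd j \<Longrightarrow> \<not> (j \<in> P i \<and> j \<in> P i')" for j
        unfolding disjnt_iff P_def by (auto dest: spec[of _ "fst j"])
      moreover have "fst j < snd j" if "j \<in> P i" for j
        using D(2)[of "fst j" "snd j"] that by (simp add: P_def)
      ultimately show ?thesis by blast
    qed
    have Dun: "D = (\<Union>i\<in>C. P i)" using memb by (auto simp: P_def)
    define gaps where "gaps i G \<longleftrightarrow> finite G \<and> (\<forall>(u,v)\<in>G. fst i \<le> u \<and> u \<le> v \<and> v \<le> snd i) \<and>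
      (\<forall>i\<in>G. \<forall>j\<in>G. i \<noteq> j \<longrightarrow> {fst i<..<snd i} \<inter> {fst j<..<snd j} = {}) \<and>
      (\<forall>\<phi>::real \<Rightarrow> real. \<phi> (snd i) - \<phi> (fst i) = (\<Sum>j\<in>P i. \<phi> (snd j) - \<phi> (fst j)) + (\<Sum>j\<in>G. \<phi> (snd j) - \<phi> (fst j)))"
      for i G
    have "\<exists>G. gaps i G"
      if i: "i \<in> C" for i
      unfolding gaps_def
    proof (rule interval_gaps)
      show "finite (P i)" using D(1) by (auto simp: P_def)
      show "fst i \<le> snd i" using C(2)[of "fst i" "snd i"] i by simp
      show "\<And>u v. (u,v) \<in> P i \<Longrightarrow> fst i \<le> u \<and> u < v \<and> v \<le> snd i" using D(2) by (auto simp: P_def)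
      show "disjoint_ivls (P i)"
        using D(3) by (rule pairwise_subset) (auto simp: P_def)
    qed
    then obtain G where G0: "\<And>i. i \<in> C \<Longrightarrow> gaps i (G i)"
      by metis
    have G: "\<And>i. i \<in> C \<Longrightarrow> finite (G i)"
      "\<And>i u v. i \<in> C \<Longrightarrow> (u,v) \<in> G i \<Longrightarrow> fst i \<le> u \<and> u \<le> v \<and> v \<le> snd i"
      "\<And>i k j. \<lbrakk>i \<in> C; k \<in> G i; j \<in> G i; k \<noteq> j\<rbrakk> \<Longrightarrow> {fst k<..<snd k} \<inter> {fst j<..<snd j} = {}"
      "\<And>i \<phi>. i \<in> C \<Longrightarrow> \<phi> (snd i) - \<phi> (fst i) = (\<Sum>j\<in>P i. \<phi> (snd j) - \<phi> (fst j)) + (\<Sum>j\<in>G i. (\<phi> (snd j) - \<phi> (fst j) :: real))"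
      using G0 unfolding gaps_def by blast+
    \<comment> \<open>For the identity function this measures the gaps, for \<phi> =
      \<open>g\<close> it compares the increments over \<open>C\<close>, \<open>D\<close> and the
      gaps.\<close>
    have tot: "(\<Sum>i\<in>C. \<phi> (snd i) - \<phi> (fst i)) = (\<Sum>j\<in>D. \<phi> (snd j) - \<phi> (fst j)) + (\<Sum>t\<in>Sigma C G. \<phi> (snd (snd t)) - \<phi> (fst (snd t)))"
      for \<phi> :: "real \<Rightarrow> real"
    proof -
      have "(\<Sum>i\<in>C. \<phi> (snd i) - \<phi> (fst i)) = (\<Sum>i\<in>C. (\<Sum>j\<in>P i. \<phi> (snd j) - \<phi> (fst j)) + (\<Sum>j\<in>G i. \<phi> (snd j) - \<phi> (fst j)))"
        by (rule sum.cong[OF refl]) (rule G(4))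
      moreover have "(\<Sum>i\<in>C. \<Sum>j\<in>P i. \<phi> (snd j) - \<phi> (fst j)) = (\<Sum>j\<in>D. \<phi> (snd j) - \<phi> (fst j))"
        unfolding Dun using C(1) D(1) Punique by (intro sum.UNION_disjoint[symmetric]) (auto simp: P_def)
      moreover have "(\<Sum>i\<in>C. \<Sum>j\<in>G i. \<phi> (snd j) - \<phi> (fst j)) = (\<Sum>t\<in>Sigma C G. \<phi> (snd (snd t)) - \<phi> (fst (snd t)))"
        using C(1) G(1) by (subst sum.Sigma) (auto simp: case_prod_beta)
      ultimately show ?thesis by (simp add: sum.distrib)
    qed
    have meas: "?\<mu> (\<Union>i\<in>E. ivl i) = (\<Sum>i\<in>E. snd i - fst i)"
      if "finite E" "\<And>i. i \<in> E \<Longrightarrow> fst i < snd i" "disjoint_ivls E"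
      for E :: "(real \<times> real) set"
    proof -
      have "?\<mu> (\<Union>i\<in>E. ivl i) = (\<Sum>i\<in>E. ?\<mu> (ivl i))"
        using that by (intro measure_UNION') (auto simp: pairwise_def)
      also have "\<dots> = (\<Sum>i\<in>E. snd i - fst i)"
        using that(2) by (intro sum.cong) (auto simp: less_imp_le)
      finally show ?thesis .
    qed
    define lC where "lC = (\<Sum>i\<in>C. snd i - fst i)"
    define lD where "lD = (\<Sum>i\<in>D. snd i - fst i)"
    have CT: "(\<Union>i\<in>C. ivl i) \<subseteq> T" using C(2) by fastforce
    have DT: "(\<Union>i\<in>D. ivl i) \<subseteq> T" using D(2) T'T by fastforce
    have mC: "?\<mu> (\<Union>i\<in>C. ivl i) = lC" unfolding lC_def
      using C by (intro meas) (auto simp: C(2))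
    have mD: "?\<mu> (\<Union>i\<in>D. ivl i) = lD" unfolding lD_def
      using D by (intro meas) (auto simp: D(2))
    have [simp]: "(\<Union>i\<in>C. ivl i) \<in> lmeasurable" "(\<Union>i\<in>D. ivl i) \<in> lmeasurable"
      using C(1) D(1) by (auto intro!: fmeasurable.finite_UN)
    have Tle: "?\<mu> T \<le> ?\<mu> S + \<delta>"
      using TS measure_Diff[of lebesgue T S] measurable_measure_Diff[OF Tm S(1) T(3)] by simp
    have up_bounds: "lC \<le> ?\<mu> T" "lD \<le> ?\<mu> T"
      unfolding mC[symmetric] mD[symmetric] using CT DT Tm
      by (intro measure_mono_fmeasurable; auto intro: fmeasurableD)+
    have low: "?\<mu> X \<le> ?\<mu> Y + ?\<mu> (X - Y)" if "X \<in> lmeasurable" "Y \<in> lmeasurable" for X Y :: "real set"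
    proof -
      have "?\<mu> X \<le> ?\<mu> (Y \<union> (X - Y))"
        using that by (intro measure_mono_fmeasurable) (auto intro: fmeasurable.Un fmeasurable.Diff)
      also have "\<dots> \<le> ?\<mu> Y + ?\<mu> (X - Y)"
        using that by (intro measure_Un_le) (auto intro: fmeasurableD)
      finally show ?thesis .
    qed
    have lC: "?\<mu> S - \<delta> \<le> lC"
      using low[OF Sfin, of "\<Union>i\<in>C. ivl i"] C(4) mC by simp
    have lD: "?\<mu> S - 2 * \<delta> \<le> lD"
    proof -
      have S'm: "S' \<in> lmeasurable" using S' Sfin by (metis fmeasurableI2)
      \<comment> \<open>Besides the part of \<open>S\<close> missed by \<open>C\<close>, passing to
        interiors loses only finitely many end points.\<close>
      have "?\<mu> S - \<delta> \<le> ?\<mu> S'"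
      proof -
        have "negligible (\<Union>i\<in>C. {fst i, snd i})" using C(1) by (intro negligible_finite) auto
        then have n0: "(\<Union>i\<in>C. {fst i, snd i}) \<in> lmeasurable" "?\<mu> (\<Union>i\<in>C. {fst i, snd i}) = 0"
          using negligible_imp_measurable negligible_imp_measure0 by blast+
        let ?R = "S - (\<Union>i\<in>C. ivl i)"
        have Rm: "?R \<in> lmeasurable" using Sfin by (intro fmeasurable.Diff) (auto intro: fmeasurableD)
        have sub: "S - S' \<subseteq> ?R \<union> (\<Union>i\<in>C. {fst i, snd i})"
        proof
          fix x assume x: "x \<in> S - S'"
          show "x \<in> ?R \<union> (\<Union>i\<in>C. {fst i, snd i})"
          proof (cases "\<exists>i\<in>C. fst i \<le> x \<and> x \<le> snd i")
            case True
            then obtain i where i: "i \<in> C" "fst i \<le> x" "x \<le> snd i" by blast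
            moreover have "\<not> (fst i < x \<and> x < snd i)" using x i(1) by (auto simp: S'_def T'_def)
            ultimately have "x \<in> {fst i, snd i}" by auto
            then show ?thesis using i(1) by blast
          qed (use x in auto)
        qed
        have "?\<mu> (S - S') \<le> ?\<mu> (?R \<union> (\<Union>i\<in>C. {fst i, snd i}))"
          using Sfin S'm n0 Rm
          by (intro measure_mono_fmeasurable sub) (auto intro!: fmeasurable.Un fmeasurableD)
        also have "\<dots> \<le> ?\<mu> ?R + ?\<mu> (\<Union>i\<in>C. {fst i, snd i})"
          using n0 Rm by (intro measure_Un_le) (auto intro: fmeasurableD)
        also have "\<dots> \<le> \<delta>" using C(4) n0 by simp
        finally show ?thesis using low[OF Sfin S'm] by simp
      qed
      then show ?thesis using low[OF S'm, of "\<Union>i\<in>D. ivl i"] D(4) mD by simp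
    qed
    have "(\<Sum>t\<in>Sigma C G. dist (complex_of_real (g (fst (snd t)))) (of_real (g (snd (snd t))))) < \<eta>"
    proof (rule AC)
      have 1: "a \<le> fst (snd t) \<and> fst (snd t) \<le> snd (snd t) \<and> snd (snd t) \<le> b" if t: "t \<in> Sigma C G" for t
      proof -
        obtain i u v where t': "t = (i,(u,v))" "i \<in> C" "(u,v) \<in> G i" using t by auto
        have "ivl i \<subseteq> {a<..<b}" "fst i < snd i" using C(2)[of "fst i" "snd i"] T(4) t'(2) by auto
        then have "fst i \<in> {a<..<b}" "snd i \<in> {a<..<b}" by (auto simp: subset_iff)
        then show ?thesis using G(2)[OF t'(2,3)] t' by auto
      qed
      have 2: "{fst (snd t)<..<snd (snd t)} \<inter> {fst (snd t')<..<snd (snd t')} = {}"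
        if t: "t \<in> Sigma C G" and t': "t' \<in> Sigma C G" and ne: "t \<noteq> t'" for t t'
      proof (cases "fst t = fst t'")
        case True
        then show ?thesis using t t' ne G(3)[of "fst t" "snd t" "snd t'"] by (auto simp: prod_eq_iff)
      next
        case False
        have "disjnt {fst (fst t)..snd (fst t)} {fst (fst t')..snd (fst t')}"
        proof -
          have "fst t \<in> C" "fst t' \<in> C" using t t' by auto
          then show ?thesis using C(3) False unfolding pairwise_def by blast
        qed
        moreover have "fst (fst t) \<le> fst (snd t) \<and> snd (snd t) \<le> snd (fst t)"
          using G(2)[of "fst t" "fst (snd t)" "snd (snd t)"] t by auto
        moreover have "fst (fst t') \<le> fst (snd t') \<and> snd (snd t') \<le> snd (fst t')"
          using G(2)[of "fst t'" "fst (snd t')" "snd (snd t')"] t' by auto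
        ultimately have *: "fst (fst t) \<le> fst (snd t)" "snd (snd t) \<le> snd (fst t)" "fst (fst t') \<le> fst (snd t')"
            "snd (snd t') \<le> snd (fst t')" "\<And>x. x \<in> {fst (fst t)..snd (fst t)} \<Longrightarrow> x \<notin> {fst (fst t')..snd (fst t')}"
          by (auto simp: disjnt_iff)
        show ?thesis
        proof (rule equals0I)
          fix x assume "x \<in> {fst (snd t)<..<snd (snd t)} \<inter> {fst (snd t')<..<snd (snd t')}"
          then have "x \<in> {fst (fst t)..snd (fst t)}" "x \<in> {fst (fst t')..snd (fst t')}"
            using *(1-4) by simp_all
          then show False using *(5) by blast
        qed
      qed
      show "interval_family a b (Sigma C G) (\<lambda>t. fst (snd t)) (\<lambda>t. snd (snd t))"
        unfolding interval_family_def using C(1) G(1) 1 2 by blast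
      have "(\<Sum>t\<in>Sigma C G. snd (snd t) - fst (snd t)) = lC - lD"
        using tot[of "\<lambda>x. x"] by (simp add: lC_def lD_def)
      also have "\<dots> \<le> 3 * \<delta>" using up_bounds Tle lD by linarith
      finally show "(\<Sum>t\<in>Sigma C G. snd (snd t) - fst (snd t)) < d0" using \<delta> by linarith
    qed
    moreover have "\<bar>\<Sum>t\<in>Sigma C G. g (snd (snd t)) - g (fst (snd t))\<bar> \<le> (\<Sum>t\<in>Sigma C G. dist (complex_of_real (g (fst (snd t)))) (of_real (g (snd (snd t)))))"
      by (rule order_trans[OF sum_abs]) (simp add: dist_norm flip: of_real_diff, simp add: abs_minus_commute)
    ultimately have gaps: "\<bar>\<Sum>t\<in>Sigma C G. g (snd (snd t)) - g (fst (snd t))\<bar> < \<eta>" by linarith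
    have "(\<Sum>i\<in>C. g (snd i) - g (fst i)) \<le> (\<Sum>i\<in>C. s * (snd i - fst i))"
      using C(2) by (intro sum_mono) (fastforce simp: less_imp_le)
    then have "(\<Sum>i\<in>C. g (snd i) - g (fst i)) \<le> s * lC" by (simp add: lC_def sum_distrib_left)
    moreover have "(\<Sum>i\<in>D. r * (snd i - fst i)) \<le> (\<Sum>i\<in>D. g (snd i) - g (fst i))"
      using D(2) by (intro sum_mono) (fastforce simp: less_imp_le)
    then have "r * lD \<le> (\<Sum>i\<in>D. g (snd i) - g (fst i))" by (simp add: lD_def sum_distrib_left)
    ultimately have key: "r * lD - \<eta> \<le> s * lC" using tot[of g] gaps by linarith
    have b1: "\<bar>lD - ?\<mu> S\<bar> \<le> \<eta>/2" "\<bar>lC - ?\<mu> S\<bar> \<le> \<eta>/2"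
      using up_bounds Tle lD lC \<delta> by linarith+
    have X: "\<bar>r * (lD - ?\<mu> S)\<bar> \<le> \<bar>r\<bar> * (\<eta>/2)"
      unfolding abs_mult by (rule mult_left_mono[OF b1(1) abs_ge_zero])
    have Y: "\<bar>s * (lC - ?\<mu> S)\<bar> \<le> \<bar>s\<bar> * (\<eta>/2)"
      unfolding abs_mult by (rule mult_left_mono[OF b1(2) abs_ge_zero])
    have "rm - sm \<le> 2 * ra + 2 * sa + \<eta>"
      if "\<bar>x\<bar> \<le> ra" "\<bar>y\<bar> \<le> sa" "(x + rm) - \<eta> \<le> y + sm" for x y rm sm ra sa :: real
      using that by linarith
    from this[OF X Y, of "r * ?\<mu> S" "s * ?\<mu> S"] show ?thesis
      using key by (simp add: algebra_simps)
  qed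
  have "(r - s) * ?\<mu> S \<le> 0"
  proof (rule field_le_epsilon)
    fix e :: real assume "e > 0"
    then show "(r - s) * ?\<mu> S \<le> 0 + e"
      using main[of "e / (\<bar>r\<bar> + \<bar>s\<bar> + 1)"] by (simp add: add_nonneg_pos)
  qed
  then have "?\<mu> S = 0" using sr measure_nonneg[of lebesgue S] by (simp add: mult_le_0_iff)
  then show ?thesis using Sfin by (simp add: negligible_iff_measure0)
qed

section \<open>Differentiability almost everywhere\<close>

lemma absolutely_continuous_imp_continuous:
  assumes ac: "absolutely_continuous_on_interval a b f"
  shows "continuous_on {a..b} f"
  unfolding continuous_on_iff
proof (intro ballI allI impI)
  fix x e :: real assume x: "x \<in> {a..b}" and e: "0 < e"
  obtain d where d: "d > 0" and D: "\<And>(S::nat set) u v. interval_family a b S u v \<Longrightarrow>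
      (\<Sum>i\<in>S. v i - u i) < d \<Longrightarrow> (\<Sum>i\<in>S. dist (f (u i)) (f (v i))) < e"
    using absolutely_continuousD[OF ac e] by blast
  show "\<exists>d>0. \<forall>x'\<in>{a..b}. dist x' x < d \<longrightarrow> dist (f x') (f x) < e"
  proof (intro exI[of _ d] conjI d ballI impI)
    fix y assume y: "y \<in> {a..b}" "dist y x < d"
    show "dist (f y) (f x) < e"
      using D[of "{0}" "\<lambda>_. min x y" "\<lambda>_. max x y"] x y
      by (cases "x \<le> y") (auto simp: interval_family_def dist_real_def min_def max_def dist_commute)
  qed
qed

text \<open>The chords straddle the point instead of starting at it. This makes the set a countable
  intersection of open sets, hence measurable whatever \<open>g\<close> is, and matches the
  intervals that a Vitali cover requires.\<close>

definition steep_points :: "real \<Rightarrow> real \<Rightarrow> (real \<Rightarrow> real) \<Rightarrow> real \<Rightarrow> real set" where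
  "steep_points a b g r =
     (\<Inter>n. \<Union>(u,v)\<in>{(u,v). a < u \<and> v < b \<and> v - u < inverse (real (Suc n)) \<and> r * (v - u) < g v - g u}. {u<..<v})"

lemma steep_points_subset: "steep_points a b g r \<subseteq> {a<..<b}"
  unfolding steep_points_def by force

lemma steep_points_measurable [measurable]: "steep_points a b g r \<in> sets lebesgue"
proof -
  have "steep_points a b g r \<in> sets borel"
    unfolding steep_points_def by (intro sets.countable_INT') (auto intro!: borel_open open_UN)
  then show ?thesis by auto
qed

lemma steep_pointsD:
  assumes "x \<in> steep_points a b g r" "d > 0"
  shows "\<exists>u v. u < x \<and> x < v \<and> a < u \<and> v < b \<and> v - u < d \<and> r * (v - u) < g v - g u"
proof -
  obtain n where n: "inverse (real (Suc n)) < d" using assms(2) reals_Archimedean by blast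
  have "x \<in> (\<Union>(u,v)\<in>{(u,v). a < u \<and> v < b \<and> v - u < inverse (real (Suc n)) \<and> r * (v - u) < g v - g u}. {u<..<v})"
    using assms(1) unfolding steep_points_def by blast
  then obtain u v where "a < u" "v < b" "v - u < inverse (real (Suc n))" "r * (v - u) < g v - g u" "u < x" "x < v"
    by auto
  then show ?thesis using n by (intro exI[of _ u] exI[of _ v]) auto
qed

text \<open>By continuity a straddling chord becomes a chord from \<open>x\<close> when its other
  end point tends to \<open>x\<close>, so a bound on straddling slopes passes to the difference
  quotients on both sides.\<close>

lemma not_steep_slope_le:
  fixes g :: "real \<Rightarrow> real"
  assumes cont: "continuous_on {a..b} g" and x: "x \<in> {a<..<b}" "x \<notin> steep_points a b g r"
  shows "\<exists>d>0. \<forall>y. \<bar>y - x\<bar> < d \<longrightarrow> y \<noteq> x \<longrightarrow> (g y - g x) / (y - x) \<le> r"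
proof -
  obtain n where n: "\<And>u v. a < u \<Longrightarrow> v < b \<Longrightarrow> v - u < inverse (real (Suc n)) \<Longrightarrow> u < x \<Longrightarrow> x < v \<Longrightarrow> g v - g u \<le> r * (v - u)"
    using x(2) unfolding steep_points_def by fastforce
  have gx: "(g \<longlongrightarrow> g x) (at x)"
    using cont x(1) by (metis at_within_interior continuous_on_def greaterThanLessThan_subseteq_atLeastAtMost_iff
        interior_atLeastAtMost_real order_refl subsetD)
  define d where "d = min (inverse (real (Suc n))) (min (x - a) (b - x))"
  have d: "d > 0" using x(1) by (auto simp: d_def)
  have "(g y - g x) / (y - x) \<le> r" if y: "\<bar>y - x\<bar> < d" "y \<noteq> x" for y
  proof (cases "y > x")
    case True
    have "g y - g x \<le> r * (y - x)"
    proof (rule tendsto_le)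
      show "((\<lambda>u. r * (y - u)) \<longlongrightarrow> r * (y - x)) (at_left x)" by (auto intro!: tendsto_intros)
      show "((\<lambda>u. g y - g u) \<longlongrightarrow> g y - g x) (at_left x)"
        using gx by (intro tendsto_intros) (auto simp: filterlim_at_split)
      have "eventually (\<lambda>u. u \<in> {y - d<..<x}) (at_left x)"
        by (rule eventually_at_left_real) (use y True in auto)
      moreover have "eventually (\<lambda>u. u \<in> {a<..<x}) (at_left x)"
        by (rule eventually_at_left_real) (use x in auto)
      ultimately show "eventually (\<lambda>u. g y - g u \<le> r * (y - u)) (at_left x)"
        by eventually_elim (rule n, use y True x in \<open>auto simp: d_def\<close>)
    qed auto
    then show ?thesis using True by (simp add: field_simps)
  next
    case False
    then have yx: "y < x" using y by auto
    have "g x - g y \<le> r * (x - y)"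
    proof (rule tendsto_le)
      show "((\<lambda>u. r * (u - y)) \<longlongrightarrow> r * (x - y)) (at_right x)" by (auto intro!: tendsto_intros)
      show "((\<lambda>u. g u - g y) \<longlongrightarrow> g x - g y) (at_right x)"
        using gx by (intro tendsto_intros) (auto simp: filterlim_at_split)
      have "eventually (\<lambda>u. u \<in> {x<..<y + d}) (at_right x)"
        by (rule eventually_at_right_real) (use y yx in auto)
      moreover have "eventually (\<lambda>u. u \<in> {x<..<b}) (at_right x)"
        by (rule eventually_at_right_real) (use x in auto)
      ultimately show "eventually (\<lambda>u. g u - g y \<le> r * (u - y)) (at_right x)"
        by eventually_elim (rule n, use y yx x in \<open>auto simp: d_def\<close>)
    qed auto
    moreover have "(g y - g x) / (y - x) = (g x - g y) / (x - y)"
      by (metis minus_diff_eq minus_divide_divide)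
    ultimately show ?thesis using yx by (simp add: field_simps)
  qed
  then show ?thesis using d by blast
qed

text \<open>Disjoint intervals of total length below \<open>d\<close> carry variation less than 1.
  If all of them have slope above \<open>r\<close>, their total length is at most 1/r, and
  \<open>r\<close> is arbitrary.\<close>

lemma absolutely_continuous_vertical_negligible:
  fixes g :: "real \<Rightarrow> real"
  assumes ac: "absolutely_continuous_on_interval a b (\<lambda>x. of_real (g x))"
  shows "negligible (\<Inter>r::nat. steep_points a b g (real r))"
proof -
  define S where "S = (\<Inter>r::nat. steep_points a b g (real r))"
  have Sm: "S \<in> sets lebesgue" "S \<subseteq> {a<..<b}"
    unfolding S_def using steep_points_subset by (blast intro: sets.countable_INT' steep_points_measurable)+
  obtain d where d: "d > 0" and AC: "\<And>(T::(real \<times> real) set) u v. interval_family a b T u v \<Longrightarrow>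
        (\<Sum>i\<in>T. v i - u i) < d \<Longrightarrow> (\<Sum>i\<in>T. dist (complex_of_real (g (u i))) (of_real (g (v i)))) < 1"
    using absolutely_continuousD[OF ac zero_less_one] by blast
  \<comment> \<open>Inside an interval shorter than \<open>d\<close> every disjoint family has
    admissible total length. Such intervals are enough, since negligibility is a local
    property.\<close>
  have loc: "negligible (S \<inter> {c<..<e})" if ce: "e - c < d" "c < e" "a \<le> c" "e \<le> b" for c e
  proof -
    let ?E = "S \<inter> {c<..<e}"
    have Em: "?E \<in> sets lebesgue" using Sm by auto
    have Ef: "?E \<in> lmeasurable"
      using Em bounded_subset[OF bounded_box[of c e]] by (auto intro: bounded_set_imp_lmeasurable)
    have bound: "real r * (measure lebesgue ?E - \<kappa>) \<le> 1" if \<kappa>: "\<kappa> > 0" for \<kappa> and r :: nat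
    proof -
      have up: "\<exists>u v. u < x \<and> x < v \<and> v - u < d' \<and> real r * (v - u) < g v - g u" if "x \<in> ?E" "d' > 0" for x d'
        using steep_pointsD[of x a b g "real r" d'] that unfolding S_def by blast
      obtain C where C: "finite C" "\<And>u v. (u,v) \<in> C \<Longrightarrow> u < v \<and> {u..v} \<subseteq> {c<..<e} \<and> real r * (v - u) < g v - g u"
        "disjoint_ivls C"
        "measure lebesgue (?E - (\<Union>i\<in>C. ivl i)) < \<kappa>"
        using Vitali_steep_intervals[OF Em _ _ _ up \<kappa>, of "{c<..<e}"] bounded_box[of c e] by auto
      let ?U = "\<Union>i\<in>C. ivl i"
      have CC: "fst i < snd i" "c < fst i" "snd i < e" "real r * (snd i - fst i) < g (snd i) - g (fst i)" if "i \<in> C" for i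
      proof -
        have *: "fst i < snd i \<and> ivl i \<subseteq> {c<..<e} \<and> real r * (snd i - fst i) < g (snd i) - g (fst i)"
          using C(2)[of "fst i" "snd i"] that by simp
        then have "fst i \<in> {c<..<e}" "snd i \<in> {c<..<e}" by (auto simp: subset_iff)
        with * show "fst i < snd i" "c < fst i" "snd i < e" "real r * (snd i - fst i) < g (snd i) - g (fst i)" by auto
      qed
      have Um: "?U \<in> lmeasurable" using C(1) by (intro fmeasurable.finite_UN) auto
      have mU: "measure lebesgue ?U = (\<Sum>i\<in>C. snd i - fst i)"
      proof -
        have "measure lebesgue ?U = (\<Sum>i\<in>C. measure lebesgue (ivl i))"
          using C by (intro measure_UNION') (auto simp: pairwise_def)
        also have "\<dots> = (\<Sum>i\<in>C. snd i - fst i)"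
          using CC(1) by (intro sum.cong) (auto simp: less_imp_le)
        finally show ?thesis .
      qed
      have "measure lebesgue ?U \<le> measure lebesgue {c<..<e}"
      proof (rule measure_mono_fmeasurable)
        show "?U \<subseteq> {c<..<e}"
        proof (rule UN_least)
          fix i assume "i \<in> C"
          then show "ivl i \<subseteq> {c<..<e}" using CC[of i] by auto
        qed
      qed (use Um in \<open>auto intro: fmeasurableD lmeasurable_open\<close>)
      then have lt: "(\<Sum>i\<in>C. snd i - fst i) < d" using mU ce by simp
      have "measure lebesgue ?E \<le> measure lebesgue (?U \<union> (?E - ?U))"
        using Ef Um by (intro measure_mono_fmeasurable) (auto intro: fmeasurable.Un fmeasurable.Diff fmeasurableD)
      also have "\<dots> \<le> measure lebesgue ?U + measure lebesgue (?E - ?U)"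
        using Ef Um by (intro measure_Un_le) (auto intro: fmeasurableD)
      finally have low: "measure lebesgue ?E - \<kappa> \<le> (\<Sum>i\<in>C. snd i - fst i)" using C(4) mU by linarith
      have "(\<Sum>i\<in>C. dist (complex_of_real (g (fst i))) (of_real (g (snd i)))) < 1"
      proof (rule AC)
        have 1: "{fst i<..<snd i} \<inter> {fst j<..<snd j} = {}" if "i \<in> C" "j \<in> C" "i \<noteq> j" for i j
        proof -
          have "disjnt (ivl i) (ivl j)" using C(3) that unfolding pairwise_def by blast
          then show ?thesis unfolding disjnt_iff disjoint_iff
            by (metis atLeastAtMost_iff greaterThanLessThan_iff less_imp_le)
        qed
        have 2: "a \<le> fst i \<and> fst i \<le> snd i \<and> snd i \<le> b" if "i \<in> C" for i
          using CC[OF that] ce by linarith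
        show "interval_family a b C fst snd" unfolding interval_family_def using C(1) 1 2 by blast
      qed (rule lt)
      moreover have "(\<Sum>i\<in>C. real r * (snd i - fst i)) \<le> (\<Sum>i\<in>C. dist (complex_of_real (g (fst i))) (of_real (g (snd i))))"
      proof (rule sum_mono)
        fix i assume "i \<in> C"
        then show "real r * (snd i - fst i) \<le> dist (complex_of_real (g (fst i))) (of_real (g (snd i)))"
          using CC(4)[of i] unfolding dist_norm of_real_diff[symmetric] norm_of_real by linarith
      qed
      ultimately have "real r * (\<Sum>i\<in>C. snd i - fst i) \<le> 1" by (simp add: sum_distrib_left)
      moreover have "real r * (measure lebesgue ?E - \<kappa>) \<le> real r * (\<Sum>i\<in>C. snd i - fst i)"
        using low by (intro mult_left_mono) auto
      ultimately show ?thesis by linarith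
    qed
    have "measure lebesgue ?E = 0"
    proof (rule ccontr)
      assume "measure lebesgue ?E \<noteq> 0"
      then have pos: "measure lebesgue ?E > 0" using measure_nonneg[of lebesgue ?E] by linarith
      obtain r :: nat where "real r > 2 / measure lebesgue ?E" using reals_Archimedean2 by blast
      then have "real r * (measure lebesgue ?E / 2) > 1" using pos by (simp add: field_simps)
      then show False using bound[of "measure lebesgue ?E / 2" r] pos by simp
    qed
    then show ?thesis using Ef by (simp add: negligible_iff_measure0)
  qed
  have "negligible S"
  proof (rule locally_negligible_alt[THEN iffD2], rule ballI)
    fix x assume x: "x \<in> S"
    then have xab: "a < x" "x < b" using Sm by auto
    let ?I = "{max a (x - d/3)<..<min b (x + d/3)}"
    have "negligible (S \<inter> ?I)" by (rule loc) (use d xab in auto)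
    moreover have "openin (top_of_set S) (S \<inter> ?I)" by (intro openin_open_Int) auto
    moreover have "x \<in> S \<inter> ?I" using x xab d by auto
    ultimately show "\<exists>U. openin (top_of_set S) U \<and> x \<in> U \<and> negligible U" by blast
  qed
  then show ?thesis by (simp add: S_def)
qed

lemma absolutely_continuous_real_ae_differentiable:
  fixes g :: "real \<Rightarrow> real"
  assumes ac: "absolutely_continuous_on_interval a b (\<lambda>x. of_real (g x))"
  shows "negligible {x \<in> {a<..<b}. \<not> (\<exists>D. (g has_real_derivative D) (at x))}"
proof -
  have acm: "absolutely_continuous_on_interval a b (\<lambda>x. of_real (- g x))"
    using ac unfolding absolutely_continuous_on_interval_def by (simp add: dist_minus)
  have "continuous_on {a..b} (\<lambda>x. Re (of_real (g x)))"
    by (intro continuous_intros absolutely_continuous_imp_continuous ac)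
  then have cont: "continuous_on {a..b} g" by simp
  then have contm: "continuous_on {a..b} (\<lambda>x. - g x)" by (intro continuous_intros)
  \<comment> \<open>The points that have, for some rationals s < r, arbitrarily short straddling
    chords of slope above r and others of slope below s.\<close>
  define Z1 where "Z1 = (\<Union>(s,r)\<in>{(s,r). s \<in> \<rat> \<and> r \<in> \<rat> \<and> s < r}. steep_points a b g r \<inter> steep_points a b (\<lambda>x. - g x) (- s))"
  have "negligible Z1"
    unfolding Z1_def
  proof (rule negligible_countable_Union)
    have "countable {(s,r). s \<in> \<rat> \<and> r \<in> \<rat> \<and> s < (r::real)}"
      by (rule countable_subset[of _ "\<rat> \<times> \<rat>"]) (auto intro: countable_rat)
    then show "countable ((\<lambda>(s,r). steep_points a b g r \<inter> steep_points a b (\<lambda>x. - g x) (- s)) ` {(s,r). s \<in> \<rat> \<and> r \<in> \<rat> \<and> s < r})"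
      by (rule countable_image)
    fix X assume "X \<in> (\<lambda>(s,r). steep_points a b g r \<inter> steep_points a b (\<lambda>x. - g x) (- s)) ` {(s,r). s \<in> \<rat> \<and> r \<in> \<rat> \<and> s < r}"
    then obtain s r where sr: "s < r" and X: "X = steep_points a b g r \<inter> steep_points a b (\<lambda>x. - g x) (- s)" by auto
    show "negligible X"
    proof (rule absolutely_continuous_crossing_slopes_negligible[OF ac sr])
      show "X \<in> sets lebesgue" unfolding X by (intro sets.Int steep_points_measurable)
      show "X \<subseteq> {a<..<b}" unfolding X using steep_points_subset by blast
      fix x d :: real assume x: "x \<in> X" "d > 0"
      show "\<exists>u v. u < x \<and> x < v \<and> v - u < d \<and> r * (v - u) < g v - g u"
        using steep_pointsD[of x a b g r d] x unfolding X by blast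
      obtain u v where "u < x" "x < v" "v - u < d" "- s * (v - u) < - g v - - g u"
        using steep_pointsD[of x a b "\<lambda>x. - g x" "- s" d] x unfolding X by blast
      then show "\<exists>u v. u < x \<and> x < v \<and> v - u < d \<and> g v - g u < s * (v - u)"
        by (intro exI[of _ u] exI[of _ v]) auto
    qed
  qed
  moreover have "negligible (\<Inter>r::nat. steep_points a b g (real r))" "negligible (\<Inter>r::nat. steep_points a b (\<lambda>x. - g x) (real r))"
    by (fact absolutely_continuous_vertical_negligible[OF ac] absolutely_continuous_vertical_negligible[OF acm])+
  ultimately have "negligible (Z1 \<union> (\<Inter>r::nat. steep_points a b g (real r)) \<union> (\<Inter>r::nat. steep_points a b (\<lambda>x. - g x) (real r)))"
    by (intro negligible_Un)
  moreover have "{x \<in> {a<..<b}. \<not> (\<exists>D. (g has_real_derivative D) (at x))} \<subseteq>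
    Z1 \<union> (\<Inter>r::nat. steep_points a b g (real r)) \<union> (\<Inter>r::nat. steep_points a b (\<lambda>x. - g x) (real r))"
  proof (rule subsetI, rule ccontr)
    fix x assume "x \<in> {x \<in> {a<..<b}. \<not> (\<exists>D. (g has_real_derivative D) (at x))}"
      and nx: "x \<notin> Z1 \<union> (\<Inter>r::nat. steep_points a b g (real r)) \<union> (\<Inter>r::nat. steep_points a b (\<lambda>x. - g x) (real r))"
    then have x: "x \<in> {a<..<b}" and nd: "\<And>D. \<not> (g has_real_derivative D) (at x)" by auto
    have nup: "\<exists>d>0. \<forall>y. \<bar>y - x\<bar> < d \<longrightarrow> y \<noteq> x \<longrightarrow> (g y - g x) / (y - x) \<le> r" if "x \<notin> steep_points a b g r" for r
      by (rule not_steep_slope_le[OF cont x that])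
    have ndn: "\<exists>d>0. \<forall>y. \<bar>y - x\<bar> < d \<longrightarrow> y \<noteq> x \<longrightarrow> s \<le> (g y - g x) / (y - x)" if "x \<notin> steep_points a b (\<lambda>x. - g x) (- s)" for s
    proof -
      have "(- g y - - g x) / (y - x) = - ((g y - g x) / (y - x))" for y
        by (simp add: field_simps minus_divide_left[symmetric] del: minus_divide_left) (metis diff_divide_distrib minus_diff_eq minus_divide_left)
      then show ?thesis using not_steep_slope_le[OF contm x that] by simp
    qed
    \<comment> \<open>\<open>R\<close> and \<open>Q\<close> consist of rationals that bound the
      difference quotients near \<open>x\<close> from above and from below, by \<open>nup\<close>
      and \<open>ndn\<close>. Both are nonempty because \<open>x\<close> is not a vertical point of
      \<open>g\<close> or of \<open>- g\<close>.\<close>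
    define R where "R = {r \<in> \<rat>. x \<notin> steep_points a b g r}"
    define Q where "Q = {s \<in> \<rat>. x \<notin> steep_points a b (\<lambda>x. - g x) (- s)}"
    obtain r0 :: nat where r0: "x \<notin> steep_points a b g (real r0)" using nx by auto
    obtain s0 :: nat where s0: "x \<notin> steep_points a b (\<lambda>x. - g x) (real s0)" using nx by auto
    have Rne: "real r0 \<in> R" using r0 by (auto simp: R_def)
    have Qne: "- real s0 \<in> Q" using s0 by (auto simp: Q_def)
    have le: "s \<le> r" if "s \<in> Q" "r \<in> R" for s r
    proof -
      have "x \<notin> steep_points a b g r" using that(2) by (simp add: R_def)
      from nup[OF this] obtain d1 where d1: "d1 > 0" "\<And>y. \<bar>y - x\<bar> < d1 \<Longrightarrow> y \<noteq> x \<Longrightarrow> (g y - g x) / (y - x) \<le> r" by blast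
      have "x \<notin> steep_points a b (\<lambda>x. - g x) (- s)" using that(1) by (simp add: Q_def)
      from ndn[OF this] obtain d2 where d2: "d2 > 0" "\<And>y. \<bar>y - x\<bar> < d2 \<Longrightarrow> y \<noteq> x \<Longrightarrow> s \<le> (g y - g x) / (y - x)" by blast
      define t where "t = min d1 d2 / 2"
      have "t > 0" "t < d1" "t < d2" using d1(1) d2(1) by (auto simp: t_def min_def)
      then show ?thesis using d1(2)[of "x + t"] d2(2)[of "x + t"] by simp
    qed
    have bdd: "bdd_below R" using le[OF Qne] by (auto simp: bdd_below_def)
    \<comment> \<open>The candidate for the derivative is the best upper bound among the
      rationals.\<close>
    define L where "L = Inf R"
    have "((\<lambda>y. (g y - g x) / (y - x)) \<longlongrightarrow> L) (at x)"
    proof (rule order_tendstoI)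
      fix t assume "L < t"
      then obtain r where r: "r \<in> R" "r < t" using cInf_lessD[of R t] Rne unfolding L_def by auto
      have "x \<notin> steep_points a b g r" using r(1) by (simp add: R_def)
      from nup[OF this] obtain d1 where d1: "d1 > 0" "\<And>y. \<bar>y - x\<bar> < d1 \<Longrightarrow> y \<noteq> x \<Longrightarrow> (g y - g x) / (y - x) \<le> r" by blast
      then show "eventually (\<lambda>y. (g y - g x) / (y - x) < t) (at x)"
        unfolding eventually_at dist_real_def using r(2) by (intro exI[of _ d1]) (auto intro: le_less_trans)
    next
      fix t assume "t < L"
      then obtain s where s: "s \<in> \<rat>" "t < s" "s < L" using Rats_dense_in_real by blast
      then obtain s' where s': "s' \<in> \<rat>" "s < s'" "s' < L" using Rats_dense_in_real by blast
      \<comment> \<open>Below \<open>L\<close> there is no member of \<open>R\<close>, so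
        arbitrarily short chords of slope above \<open>s'\<close> straddle \<open>x\<close>; being
        outside \<open>Z1\<close> then rules out the same for slopes below \<open>s\<close>.\<close>
      have "s' \<notin> R" using s'(3) cInf_lower[OF _ bdd, of s'] unfolding L_def by auto
      then have "x \<in> steep_points a b g s'" using s' by (auto simp: R_def)
      then have "x \<notin> steep_points a b (\<lambda>x. - g x) (- s)"
        using nx s(1) s'(1,2) unfolding Z1_def by auto
      from ndn[OF this] obtain d2 where d2: "d2 > 0" "\<And>y. \<bar>y - x\<bar> < d2 \<Longrightarrow> y \<noteq> x \<Longrightarrow> s \<le> (g y - g x) / (y - x)" by blast
      then show "eventually (\<lambda>y. t < (g y - g x) / (y - x)) (at x)"
        unfolding eventually_at dist_real_def using s(2) by (intro exI[of _ d2]) (auto intro: less_le_trans)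
    qed
    then have "(g has_real_derivative L) (at x)" by (simp add: has_field_derivative_iff)
    then show False using nd by blast
  qed
  ultimately show ?thesis by (rule negligible_subset)
qed

lemma absolutely_continuous_ae_differentiable:
  assumes ac: "absolutely_continuous_on_interval a b f"
  obtains Z where "negligible Z"
    "\<And>x. x \<in> {a..b} - Z \<Longrightarrow> (f has_vector_derivative vector_derivative f (at x within {a..b})) (at x within {a..b})"
proof -
  have weaker: "absolutely_continuous_on_interval a b (\<lambda>x. complex_of_real (h x))"
    if "\<And>x y. \<bar>h x - h y\<bar> \<le> dist (f x) (f y)" for h
    by (rule absolutely_continuous_combine[OF ac ac, of _ "1 / 2"])
      (use that in \<open>auto simp: dist_norm simp flip: of_real_diff intro: order_trans\<close>)
  let ?Z1 = "{x \<in> {a<..<b}. \<not> (\<exists>D. ((\<lambda>x. Re (f x)) has_real_derivative D) (at x))}"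
  let ?Z2 = "{x \<in> {a<..<b}. \<not> (\<exists>D. ((\<lambda>x. Im (f x)) has_real_derivative D) (at x))}"
  have "negligible ?Z1"
    by (intro absolutely_continuous_real_ae_differentiable weaker)
      (metis abs_Re_le_cmod dist_norm minus_complex.simps(1))
  moreover have "negligible ?Z2"
    by (intro absolutely_continuous_real_ae_differentiable weaker)
      (metis abs_Im_le_cmod dist_norm minus_complex.simps(2))
  \<comment> \<open>The end points join the exceptional set because differentiability was shown only
    in the open interval.\<close>
  ultimately have "negligible (?Z1 \<union> ?Z2 \<union> {a,b})" by (intro negligible_Un) auto
  then show thesis
  proof (rule that)
    fix x assume "x \<in> {a..b} - (?Z1 \<union> ?Z2 \<union> {a,b})"
    then obtain D1 D2 where D: "((\<lambda>x. Re (f x)) has_real_derivative D1) (at x)" "((\<lambda>x. Im (f x)) has_real_derivative D2) (at x)"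
      by auto
    have "((\<lambda>x. complex_of_real (Re (f x)) + \<i> * complex_of_real (Im (f x))) has_vector_derivative (of_real D1 + \<i> * of_real D2)) (at x)"
      by (intro has_vector_derivative_add has_vector_derivative_mult_right has_vector_derivative_of_real D)
    then have "(f has_vector_derivative (of_real D1 + \<i> * of_real D2)) (at x)"
      by (simp add: complex_eq[symmetric])
    then have "(f has_vector_derivative (of_real D1 + \<i> * of_real D2)) (at x within {a..b})"
      by (rule has_vector_derivative_at_within)
    then show "(f has_vector_derivative vector_derivative f (at x within {a..b})) (at x within {a..b})"
      by (metis differentiableI_vector vector_derivative_works)
  qed
qed

section \<open>The fundamental theorem of calculus for absolutely continuous functions\<close>

lemma absolutely_continuous_has_integral:
  fixes f :: "real \<Rightarrow> complex"
  assumes ac: "absolutely_continuous_on_interval a b f" and ab: "a \<le> b" and Z: "negligible Z"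
    and D: "\<And>x. x \<in> {a..b} - Z \<Longrightarrow> (f has_vector_derivative f' x) (at x within {a..b})"
  shows "(f' has_integral (f b - f a)) {a..b}"
proof -
  \<comment> \<open>The gauge integral yields integrability and value together. With value 0 on the
    null set, Riemann terms tagged there vanish and only the increments of \<open>f\<close> have to
    be estimated.\<close>
  define F where "F x = (if x \<in> Z then 0 else f' x)" for x
  have "(F has_integral (f b - f a)) (cbox a b)"
    unfolding has_integral
  proof (intro allI impI)
    fix e :: real assume e: "e > 0"
    \<comment> \<open>The added 1 admits \<open>a = b\<close> and makes the second inequality
      strict.\<close>
    define \<epsilon> where "\<epsilon> = e / (2 * (b - a + 1))"
    have \<epsilon>: "\<epsilon> > 0" "\<epsilon> * (b - a) < e / 2" using e ab by (auto simp: \<epsilon>_def field_simps)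
    have "e / 2 > 0" using e by simp
    from absolutely_continuousD[OF ac this]
    obtain \<delta> where \<delta>: "\<delta> > 0" and AC: "\<And>(T::(real \<times> real set) set) u v. interval_family a b T u v \<Longrightarrow>
        (\<Sum>i\<in>T. v i - u i) < \<delta> \<Longrightarrow> (\<Sum>i\<in>T. dist (f (u i)) (f (v i))) < e / 2"
      by blast
    obtain T where T: "open T" "Z \<subseteq> T" "T - Z \<in> lmeasurable" "emeasure lebesgue (T - Z) < ennreal \<delta>"
      using sets_lebesgue_outer_open[OF negligible_imp_sets[OF Z] \<delta>] by blast
    have Zm: "Z \<in> lmeasurable" "measure lebesgue Z = 0"
      using Z negligible_imp_measurable negligible_imp_measure0 by blast+
    have Tm: "T \<in> lmeasurable" using fmeasurable.Un[OF T(3) Zm(1)] T(2) by (simp add: Un_absorb2)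
    have "measure lebesgue (T - Z) < \<delta>"
      using T(3,4) \<delta> by (metis emeasure_eq_measure2 ennreal_less_iff measure_nonneg)
    then have Tlt: "measure lebesgue T < \<delta>"
      using measurable_measure_Diff[OF Tm fmeasurableD[OF Zm(1)] T(2)] Zm(2) by simp
    \<comment> \<open>The gauge: around a point of \<open>Z\<close> the ball stays in the open set
      \<open>T\<close> of measure below \<delta>; around any other point of the interval the linear
      approximation has relative error at most \<epsilon>.\<close>
    have "\<exists>r>0. (x \<in> Z \<longrightarrow> ball x r \<subseteq> T) \<and> (x \<in> {a..b} - Z \<longrightarrow>
      (\<forall>y\<in>{a..b}. \<bar>y - x\<bar> < r \<longrightarrow> norm (f y - f x - (y - x) *\<^sub>R f' x) \<le> \<epsilon> * \<bar>y - x\<bar>))" for x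
    proof (cases "x \<in> Z")
      case True
      then show ?thesis using T(1,2) by (metis DiffD2 openE subsetD)
    next
      case False
      show ?thesis
      proof (cases "x \<in> {a..b}")
        case True
        then have "(f has_derivative (\<lambda>h. h *\<^sub>R f' x)) (at x within {a..b})"
          using D False by (auto simp: has_vector_derivative_def)
        then obtain r where "r > 0" "\<And>y. y \<in> {a..b} \<Longrightarrow> norm (y - x) < r \<Longrightarrow> norm (f y - f x - (y - x) *\<^sub>R f' x) \<le> \<epsilon> * norm (y - x)"
          using \<epsilon>(1) unfolding has_derivative_within_alt by blast
        then show ?thesis using False by (intro exI[of _ r]) auto
      qed (use False in \<open>auto intro: exI[of _ 1]\<close>)
    qed
    then obtain r where r: "\<And>x. r x > 0" "\<And>x. x \<in> Z \<Longrightarrow> ball x (r x) \<subseteq> T"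
      "\<And>x y. x \<in> {a..b} - Z \<Longrightarrow> y \<in> {a..b} \<Longrightarrow> \<bar>y - x\<bar> < r x \<Longrightarrow> norm (f y - f x - (y - x) *\<^sub>R f' x) \<le> \<epsilon> * \<bar>y - x\<bar>"
      by metis
    show "\<exists>\<gamma>. gauge \<gamma> \<and> (\<forall>\<D>. \<D> tagged_division_of (cbox a b) \<and> \<gamma> fine \<D> \<longrightarrow>
        norm ((\<Sum>(x,k)\<in>\<D>. measure lborel k *\<^sub>R F x) - (f b - f a)) < e)"
    proof (intro exI[of _ "\<lambda>x. ball x (r x)"] conjI allI impI)
      show "gauge (\<lambda>x. ball x (r x))" using r(1) by (simp add: gauge_ball_dependent)
      fix p assume "p tagged_division_of (cbox a b) \<and> (\<lambda>x. ball x (r x)) fine p"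
      then have p: "p tagged_division_of {a..b}" and fine: "(\<lambda>x. ball x (r x)) fine p" by auto
      have fin: "finite p" using p by auto
      have K: "\<exists>u v. k = {u..v} \<and> u \<le> x \<and> x \<le> v \<and> a \<le> u \<and> v \<le> b \<and> {u..v} \<subseteq> ball x (r x)" if xk: "(x,k) \<in> p" for x k
      proof -
        obtain u v where uv: "k = cbox u v" using tagged_division_ofD(4)[OF p xk] by blast
        have "x \<in> k" "k \<subseteq> {a..b}" using tagged_division_ofD(2,3)[OF p that] by auto
        moreover have "k \<subseteq> ball x (r x)" using fine that by (auto simp: fine_def)
        ultimately show ?thesis using uv by (intro exI[of _ u] exI[of _ v]) auto
      qed
      define lo where "lo i = Inf (snd i)" for i :: "real \<times> real set"
      define hi where "hi i = Sup (snd i)" for i :: "real \<times> real set"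
      have K': "snd i = {lo i..hi i}" "lo i \<le> fst i" "fst i \<le> hi i" "a \<le> lo i" "hi i \<le> b" "{lo i..hi i} \<subseteq> ball (fst i) (r (fst i))"
        "measure lborel (snd i) = hi i - lo i"
        if i: "i \<in> p" for i
      proof -
        obtain u v where *: "snd i = {u..v}" "u \<le> fst i" "fst i \<le> v" "a \<le> u" "v \<le> b" "{u..v} \<subseteq> ball (fst i) (r (fst i))"
          using K[of "fst i" "snd i"] i by auto
        then have "lo i = u" "hi i = v" by (auto simp: lo_def hi_def)
        with * show "snd i = {lo i..hi i}" "lo i \<le> fst i" "fst i \<le> hi i" "a \<le> lo i" "hi i \<le> b" "{lo i..hi i} \<subseteq> ball (fst i) (r (fst i))"
           "measure lborel (snd i) = hi i - lo i"
          by auto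
      qed
      have tel: "(\<Sum>i\<in>p. f (hi i) - f (lo i)) = f b - f a"
        using additive_tagged_division_1[OF ab p, of f] by (simp add: lo_def hi_def case_prod_beta)
      have telx: "(\<Sum>i\<in>p. hi i - lo i) = b - a"
        using additive_tagged_division_1[OF ab p, of "\<lambda>x. x"] by (simp add: lo_def hi_def case_prod_beta)
      let ?B = "{i \<in> p. fst i \<in> Z}"
      let ?G = "{i \<in> p. fst i \<notin> Z}"
      have disj: "{lo i<..<hi i} \<inter> {lo j<..<hi j} = {}" if "i \<in> p" "j \<in> p" "i \<noteq> j" for i j
      proof -
        have "interior (snd i) \<inter> interior (snd j) = {}"
          using tagged_division_ofD(5)[OF p, of "fst i" "snd i" "fst j" "snd j"] that by (auto simp: prod_eq_iff)
        then show ?thesis using K'(1) that by (simp add: interior_atLeastAtMost_real)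
      qed
      \<comment> \<open>Pieces tagged in \<open>Z\<close> lie in \<open>T\<close>, so their total
        length is below \<delta> and absolute continuity bounds their increments.\<close>
      have bad: "(\<Sum>i\<in>?B. dist (f (lo i)) (f (hi i))) < e / 2"
      proof (rule AC)
        have "(\<Sum>i\<in>?B. hi i - lo i) = (\<Sum>i\<in>?B. measure lebesgue {lo i<..<hi i})"
        proof (rule sum.cong[OF refl])
          fix i assume "i \<in> ?B"
          then have "lo i \<le> hi i" using K'(2,3)[of i] by auto
          then show "hi i - lo i = measure lebesgue {lo i<..<hi i}" by simp
        qed
        also have "\<dots> = measure lebesgue (\<Union>i\<in>?B. {lo i<..<hi i})"
          using fin disj by (intro measure_UNION'[symmetric]) (auto simp: pairwise_def disjnt_def intro: lmeasurable_open)
        also have "\<dots> \<le> measure lebesgue T"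
        proof (rule measure_mono_fmeasurable[OF _ _ Tm])
          show "(\<Union>i\<in>?B. {lo i<..<hi i}) \<subseteq> T"
          proof (rule UN_least)
            fix i assume i: "i \<in> ?B"
            then have "{lo i..hi i} \<subseteq> T" using K'(6)[of i] r(2)[of "fst i"] by blast
            then show "{lo i<..<hi i} \<subseteq> T" by (meson greaterThanLessThan_subseteq_atLeastAtMost_iff order_refl order_trans)
          qed
        qed (use fin in \<open>auto intro!: sets.finite_UN\<close>)
        finally show "(\<Sum>i\<in>?B. hi i - lo i) < \<delta>" using Tlt by linarith
        have 1: "a \<le> lo i \<and> lo i \<le> hi i \<and> hi i \<le> b" if "i \<in> ?B" for i
          using K'(2-5)[of i] that by auto
        have 2: "{lo i<..<hi i} \<inter> {lo j<..<hi j} = {}" if "i \<in> ?B" "j \<in> ?B" "i \<noteq> j" for i j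
          by (rule disj) (use that in auto)
        have 3: "finite ?B" using fin by simp
        show "interval_family a b ?B lo hi" unfolding interval_family_def using 1 2 3 by blast
      qed
      \<comment> \<open>The straddle argument: the tag lies between the end points, so the errors of
        the approximations to both of them add up to \<epsilon> times the length.\<close>
      have good: "norm ((hi i - lo i) *\<^sub>R f' (fst i) - (f (hi i) - f (lo i))) \<le> \<epsilon> * (hi i - lo i)" if i: "i \<in> ?G" for i
      proof -
        let ?x = "fst i"
        have x: "?x \<in> {a..b} - Z" "lo i \<in> {a..b}" "hi i \<in> {a..b}" using K'[of i] i by auto
        have "lo i \<in> ball ?x (r ?x)" "hi i \<in> ball ?x (r ?x)" using K'[of i] i by (auto simp: subset_iff)
        then have *: "norm (f (hi i) - f ?x - (hi i - ?x) *\<^sub>R f' ?x) \<le> \<epsilon> * \<bar>hi i - ?x\<bar>"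
          "norm (f (lo i) - f ?x - (lo i - ?x) *\<^sub>R f' ?x) \<le> \<epsilon> * \<bar>lo i - ?x\<bar>"
          using r(3)[OF x(1,3)] r(3)[OF x(1,2)] by (auto simp: dist_real_def abs_minus_commute)
        have "(hi i - lo i) *\<^sub>R f' ?x - (f (hi i) - f (lo i)) =
          (f (lo i) - f ?x - (lo i - ?x) *\<^sub>R f' ?x) - (f (hi i) - f ?x - (hi i - ?x) *\<^sub>R f' ?x)"
          by (simp add: algebra_simps)
        then have "norm ((hi i - lo i) *\<^sub>R f' ?x - (f (hi i) - f (lo i))) \<le> \<epsilon> * \<bar>lo i - ?x\<bar> + \<epsilon> * \<bar>hi i - ?x\<bar>"
          using * norm_triangle_ineq4 by (smt (verit))
        also have "\<dots> = \<epsilon> * (hi i - lo i)" using K'(2,3)[of i] i by (simp add: algebra_simps)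
        finally show ?thesis .
      qed
      have "(\<Sum>(x,k)\<in>p. measure lborel k *\<^sub>R F x) - (f b - f a) = (\<Sum>i\<in>p. (hi i - lo i) *\<^sub>R F (fst i) - (f (hi i) - f (lo i)))"
        unfolding tel[symmetric] sum_subtractf[symmetric] by (intro sum.cong) (auto simp: K'(7) case_prod_beta)
      also have "norm \<dots> \<le> (\<Sum>i\<in>p. norm ((hi i - lo i) *\<^sub>R F (fst i) - (f (hi i) - f (lo i))))" by (rule norm_sum)
      also have "\<dots> = (\<Sum>i\<in>?B. norm ((hi i - lo i) *\<^sub>R F (fst i) - (f (hi i) - f (lo i)))) + (\<Sum>i\<in>?G. norm ((hi i - lo i) *\<^sub>R F (fst i) - (f (hi i) - f (lo i))))"
        by (subst sum.union_disjoint[symmetric]) (use fin in \<open>auto intro!: sum.cong\<close>)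
      also have "(\<Sum>i\<in>?B. norm ((hi i - lo i) *\<^sub>R F (fst i) - (f (hi i) - f (lo i)))) = (\<Sum>i\<in>?B. dist (f (lo i)) (f (hi i)))"
        by (intro sum.cong) (auto simp: F_def dist_norm norm_minus_commute)
      also have "(\<Sum>i\<in>?G. norm ((hi i - lo i) *\<^sub>R F (fst i) - (f (hi i) - f (lo i)))) \<le> (\<Sum>i\<in>?G. \<epsilon> * (hi i - lo i))"
        using good by (intro sum_mono) (auto simp: F_def)
      also have "(\<Sum>i\<in>?G. \<epsilon> * (hi i - lo i)) \<le> (\<Sum>i\<in>p. \<epsilon> * (hi i - lo i))"
      proof (rule sum_mono2[OF fin])
        fix i assume "i \<in> p - ?G"
        then have "lo i \<le> hi i" using K'(2,3)[of i] by auto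
        then show "0 \<le> \<epsilon> * (hi i - lo i)" using \<epsilon>(1) by simp
      qed auto
      also have "\<dots> = \<epsilon> * (b - a)" using telx by (simp add: sum_distrib_left[symmetric])
      finally show "norm ((\<Sum>(x,k)\<in>p. measure lborel k *\<^sub>R F x) - (f b - f a)) < e" using bad \<epsilon>(2) by linarith
    qed
  qed
  then have "(F has_integral (f b - f a)) {a..b}" by simp
  then show ?thesis
    by (rule has_integral_spike[OF Z, rotated]) (auto simp: F_def)
qed

section \<open>The Sobolev space\<close>

lemma vector_derivative_within_cong:
  assumes "\<And>x. x \<in> {a..b} \<Longrightarrow> f x = g x" and x: "x \<in> {a..b}"
    and D: "(g has_vector_derivative d) (at x within {a..b})"
  shows "(f has_vector_derivative d) (at x within {a..b})"
  by (rule has_vector_derivative_transform[OF x _ D]) (use assms in auto)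

lemma nth_deriv_on_eq:
  fixes D :: "nat \<Rightarrow> real \<Rightarrow> complex"
  assumes ab: "a < b"
    and D: "\<And>i x. i < n \<Longrightarrow> x \<in> {a..b} \<Longrightarrow> (D i has_vector_derivative D (Suc i) x) (at x within {a..b})"
  shows "i \<le> n \<Longrightarrow> x \<in> {a..b} \<Longrightarrow> nth_deriv_on a b i (D 0) x = D i x"
proof (induction i arbitrary: x)
  case (Suc i)
  have "(nth_deriv_on a b i (D 0) has_vector_derivative D (Suc i) x) (at x within {a..b})"
    by (rule vector_derivative_within_cong[OF _ Suc.prems(2) D]) (use Suc in auto)
  then show ?case
    using vector_derivative_within_cbox[of a b x] ab Suc.prems(2) by simp
qed simp

lemma absolutely_continuous_mult:
  assumes f: "absolutely_continuous_on_interval a b f" and g: "absolutely_continuous_on_interval a b g"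
  shows "absolutely_continuous_on_interval a b (\<lambda>x. f x * g x)"
proof -
  obtain B1 where B1: "\<And>x. x \<in> {a..b} \<Longrightarrow> norm (f x) \<le> B1"
    using compact_imp_bounded[OF compact_continuous_image[OF absolutely_continuous_imp_continuous[OF f] compact_Icc]]
    unfolding bounded_iff by blast
  obtain B2 where B2: "\<And>x. x \<in> {a..b} \<Longrightarrow> norm (g x) \<le> B2"
    using compact_imp_bounded[OF compact_continuous_image[OF absolutely_continuous_imp_continuous[OF g] compact_Icc]]
    unfolding bounded_iff by blast
  show ?thesis
  proof (rule absolutely_continuous_combine[OF f g, of _ "max B1 B2"])
    fix x y assume xy: "x \<in> {a..b}" "y \<in> {a..b}"
    have "f x * g x - f y * g y = (f x - f y) * g x + f y * (g x - g y)" by (simp add: algebra_simps)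
    then have "dist (f x * g x) (f y * g y) \<le> norm ((f x - f y) * g x) + norm (f y * (g x - g y))"
      unfolding dist_norm by (metis norm_triangle_ineq)
    also have "\<dots> = dist (f x) (f y) * norm (g x) + norm (f y) * dist (g x) (g y)"
      by (simp add: norm_mult dist_norm)
    also have "\<dots> \<le> dist (f x) (f y) * max B1 B2 + max B1 B2 * dist (g x) (g y)"
      using B1[OF xy(2)] B2[OF xy(1)] by (intro add_mono mult_left_mono mult_right_mono) auto
    finally show "dist (f x * g x) (f y * g y) \<le> max B1 B2 * (dist (f x) (f y) + dist (g x) (g y))"
      by (simp add: algebra_simps)
  qed
qed

lemma absolutely_continuous_sum:
  assumes "finite I" "\<And>i. i \<in> I \<Longrightarrow> absolutely_continuous_on_interval a b (f i)"
  shows "absolutely_continuous_on_interval a b (\<lambda>x. \<Sum>i\<in>I. f i x)"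
  using assms
proof (induction I rule: finite_induct)
  case empty
  show ?case by (rule absolutely_continuous_C1[of _ _ _ "\<lambda>_. 0"]) auto
next
  case (insert i I)
  have "absolutely_continuous_on_interval a b (\<lambda>x. f i x + (\<Sum>i\<in>I. f i x))"
    by (rule absolutely_continuous_combine[of _ _ "f i" "\<lambda>x. \<Sum>i\<in>I. f i x" _ 1]) (use insert in \<open>auto intro: dist_triangle_add\<close>)
  then show ?case using insert by simp
qed

text \<open>A chain of successive derivatives carried as data. This keeps the iterated
  \<open>vector_derivative\<close>, with its unspecified values, out of the work with smooth
  functions.\<close>

definition has_derivs_on :: "nat \<Rightarrow> real \<Rightarrow> real \<Rightarrow> (nat \<Rightarrow> real \<Rightarrow> complex) \<Rightarrow> bool" where
  "has_derivs_on m a b D \<longleftrightarrow>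
     (\<forall>i<m. \<forall>x\<in>{a..b}. (D i has_vector_derivative D (Suc i) x) (at x within {a..b})) \<and> continuous_on {a..b} (D m)"

lemma has_derivs_onD: "has_derivs_on m a b D \<Longrightarrow> i < m \<Longrightarrow> x \<in> {a..b} \<Longrightarrow> (D i has_vector_derivative D (Suc i) x) (at x within {a..b})"
  by (simp add: has_derivs_on_def)

lemma has_derivs_on_continuous: "has_derivs_on m a b D \<Longrightarrow> i \<le> m \<Longrightarrow> continuous_on {a..b} (D i)"
  unfolding has_derivs_on_def
  by (cases "i = m") (auto intro!: continuous_on_vector_derivative[of _ _ "D (Suc i)"])

lemma has_derivs_on_linear:
  assumes "has_derivs_on m a b D" "has_derivs_on m a b E"
  shows "has_derivs_on m a b (\<lambda>i x. c * D i x + d * E i x)"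
  using assms unfolding has_derivs_on_def
  by (auto intro!: has_vector_derivative_add has_vector_derivative_mult_right continuous_intros)

lemma has_derivs_on_cnj:
  assumes "has_derivs_on m a b D"
  shows "has_derivs_on m a b (\<lambda>i x. cnj (D i x))"
  using assms unfolding has_derivs_on_def by (auto intro!: has_vector_derivative_cnj continuous_intros)

lemma has_derivs_on_poly:
  "has_derivs_on m a b (\<lambda>i x. poly ((pderiv ^^ i) p) (of_real x))"
  unfolding has_derivs_on_def
  by (auto intro!: has_vector_derivative_real_field poly_DERIV continuous_intros)

lemma has_derivs_on_sobolev:
  assumes ab: "a < b" and m: "m \<ge> 1" and D: "has_derivs_on m a b D"
  shows "D 0 \<in> sobolev_space m a b" and "x \<in> {a..b} \<Longrightarrow> nth_deriv_on a b m (D 0) x = D m x"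
proof -
  have eq: "nth_deriv_on a b i (D 0) x = D i x" if "i \<le> m" "x \<in> {a..b}" for i x
    by (rule nth_deriv_on_eq[OF ab _ that]) (rule has_derivs_onD[OF D])
  then show "x \<in> {a..b} \<Longrightarrow> nth_deriv_on a b m (D 0) x = D m x" by simp
  have Dm: "continuous_on {a..b} (nth_deriv_on a b m (D 0))"
    using has_derivs_on_continuous[OF D, of m] by (subst continuous_on_cong[OF refl eq]) auto
  have dv: "(nth_deriv_on a b i (D 0) has_vector_derivative D (Suc i) x) (at x within {a..b})"
    if "i < m" "x \<in> {a..b}" for i x
    by (rule vector_derivative_within_cong[OF eq that(2) has_derivs_onD[OF D that]]) (use that in auto)
  show "D 0 \<in> sobolev_space m a b"
    unfolding sobolev_space_def
  proof (intro CollectI conjI allI impI ballI)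
    show "nth_deriv_on a b i (D 0) differentiable at x within {a..b}" if "i < m - 1" "x \<in> {a..b}" for i x
      by (rule differentiableI_vector[OF dv]) (use that m in auto)
    show "absolutely_continuous_on_interval a b (nth_deriv_on a b (m - 1) (D 0))"
      by (rule absolutely_continuous_C1[of _ _ _ "D m"])
        (use dv[of "m - 1"] has_derivs_on_continuous[OF D, of m] m in auto)
    show "set_borel_measurable lebesgue {a..b} (nth_deriv_on a b m (D 0))"
      unfolding set_borel_measurable_def
      by (subst borel_measurable_restrict_space_iff[symmetric]) (auto intro!: continuous_imp_measurable_on_sets_lebesgue Dm)
    show "set_integrable lebesgue {a..b} (\<lambda>x. (cmod (nth_deriv_on a b m (D 0) x))\<^sup>2)"
      by (intro absolutely_integrable_continuous_real continuous_intros Dm)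
  qed
qed

lemma sobolev_space_deriv:
  assumes f: "f \<in> sobolev_space m a b" and ab: "a < b" and i: "i < m - 1" and x: "x \<in> {a..b}"
  shows "(nth_deriv_on a b i f has_vector_derivative nth_deriv_on a b (Suc i) f x) (at x within {a..b})"
  using f i x by (auto simp: sobolev_space_def vector_derivative_works)

lemma sobolev_space_continuous:
  assumes f: "f \<in> sobolev_space m a b" and ab: "a < b" and i: "i < m"
  shows "continuous_on {a..b} (nth_deriv_on a b i f)"
proof (cases "i = m - 1")
  case True
  then show ?thesis using f by (auto simp: sobolev_space_def intro: absolutely_continuous_imp_continuous)
next
  case False
  show ?thesis
    by (rule continuous_on_vector_derivative[OF sobolev_space_deriv[OF f ab]]) (use i False in auto)
qed

lemma sobolev_space_absolutely_continuous:
  assumes f: "f \<in> sobolev_space m a b" and ab: "a < b" and i: "i < m"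
  shows "absolutely_continuous_on_interval a b (nth_deriv_on a b i f)"
proof (cases "i = m - 1")
  case True
  then show ?thesis using f by (auto simp: sobolev_space_def)
next
  case False
  show ?thesis
    by (rule absolutely_continuous_C1[OF sobolev_space_deriv[OF f ab] sobolev_space_continuous[OF f ab]])
      (use i False in auto)
qed

text \<open>The alternating boundary form \<open>H\<close> is absolutely continuous, and its
  derivative telescopes to the integrand wherever the (m-1)-th derivative of \<open>f\<close> is
  differentiable, which is almost everywhere. The left end \<open>c\<close> may lie inside [a, b]
  because a truncated power is smooth only from its knot on.\<close>

lemma sobolev_by_parts:
  fixes G :: "nat \<Rightarrow> real \<Rightarrow> complex"
  assumes f: "f \<in> sobolev_space m a b" and ab: "a < b" and m: "m \<ge> 1" and c: "a \<le> c" "c \<le> b"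
    and G: "has_derivs_on m c b G"
  shows "((\<lambda>x. G 0 x * nth_deriv_on a b m f x - (-1) ^ m * (G m x * f x)) has_integral
     (\<Sum>i<m. (-1) ^ i * (G i b * nth_deriv_on a b (m - 1 - i) f b - G i c * nth_deriv_on a b (m - 1 - i) f c))) {c..b}"
proof -
  let ?f = "\<lambda>i. nth_deriv_on a b i f"
  define H where "H x = (\<Sum>i<m. (-1) ^ i * (G i x * ?f (m - 1 - i) x))" for x
  obtain Z where Z: "negligible Z" "\<And>x. x \<in> {a..b} - Z \<Longrightarrow> (?f (m - 1) has_vector_derivative ?f m x) (at x within {a..b})"
  proof -
    obtain Z where "negligible Z" "\<And>x. x \<in> {a..b} - Z \<Longrightarrow>
        (?f (m - 1) has_vector_derivative vector_derivative (?f (m - 1)) (at x within {a..b})) (at x within {a..b})"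
      using absolutely_continuous_ae_differentiable[OF sobolev_space_absolutely_continuous[OF f ab, of "m - 1"]] m by auto
    moreover have "?f m = (\<lambda>x. vector_derivative (?f (m - 1)) (at x within {a..b}))"
      using m by (cases m) auto
    ultimately show thesis by (intro that[of Z]) auto
  qed
  have dG: "(G i has_vector_derivative G (Suc i) x) (at x within {c..b})" if "i < m" "x \<in> {c..b}" for i x
    using has_derivs_onD[OF G] that by blast
  have df: "(?f i has_vector_derivative ?f (Suc i) x) (at x within {c..b})" if "i < m" "x \<in> {c..b} - Z" for i x
  proof (rule has_vector_derivative_within_subset)
    show "(?f i has_vector_derivative ?f (Suc i) x) (at x within {a..b})"
    proof (cases "i = m - 1")
      case True then show ?thesis using Z(2)[of x] that c m by auto
    next
      case False then show ?thesis using sobolev_space_deriv[OF f ab, of i x] that c by auto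
    qed
  qed (use c in auto)
  have "((\<lambda>x. G 0 x * ?f m x - (-1) ^ m * (G m x * f x)) has_integral (H b - H c)) {c..b}"
  proof (rule absolutely_continuous_has_integral[OF _ c(2) Z(1)])
    show "absolutely_continuous_on_interval c b H"
      unfolding H_def
    proof (intro absolutely_continuous_sum absolutely_continuous_mult)
      fix i assume "i \<in> {..<m}"
      then show "absolutely_continuous_on_interval c b (G i)"
        using dG has_derivs_on_continuous[OF G, of "Suc i"] by (intro absolutely_continuous_C1) auto
      show "absolutely_continuous_on_interval c b (?f (m - 1 - i))"
        using m by (intro absolutely_continuous_subinterval[OF sobolev_space_absolutely_continuous[OF f ab]] c) auto
      show "absolutely_continuous_on_interval c b (\<lambda>x. (-1) ^ i)"
        by (rule absolutely_continuous_C1[of _ _ _ "\<lambda>_. 0"]) auto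
    qed auto
    fix x assume x: "x \<in> {c..b} - Z"
    have "(H has_vector_derivative (\<Sum>i<m. (-1) ^ i * (G i x * ?f (Suc (m - 1 - i)) x + G (Suc i) x * ?f (m - 1 - i) x))) (at x within {c..b})"
      unfolding H_def
      by (intro has_vector_derivative_sum has_vector_derivative_mult_right has_vector_derivative_mult dG df)
        (use x m in auto)
    \<comment> \<open>In the product rule the terms of neighbouring indices cancel; only the two
      extreme ones survive.\<close>
    moreover have "(\<Sum>i<n. (-1) ^ i * (G i x * F (n - i) + G (Suc i) x * F (n - 1 - i))) = G 0 x * F n - (-1) ^ n * (G n x * F 0)"
      for n and F :: "nat \<Rightarrow> complex"
    proof -
      have "(\<Sum>i<n. (-1) ^ i * (G i x * F (n - i) + G (Suc i) x * F (n - 1 - i)))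
        = (\<Sum>i<n. (-1) ^ i * (G i x * F (n - i)) - (-1) ^ Suc i * (G (Suc i) x * F (n - Suc i)))"
        by (intro sum.cong) (auto simp: algebra_simps)
      also have "\<dots> = G 0 x * F n - (-1) ^ n * (G n x * F 0)"
        by (subst sum_lessThan_telescope') simp
      finally show ?thesis .
    qed
    from this[where n = m and F = "\<lambda>i. ?f i x"] have "(\<Sum>i<m. (-1) ^ i * (G i x * ?f (Suc (m - 1 - i)) x + G (Suc i) x * ?f (m - 1 - i) x))
        = G 0 x * ?f m x - (-1) ^ m * (G m x * f x)"
      by (subst sum.cong[OF refl, of _ _ "\<lambda>i. (-1) ^ i * (G i x * ?f (m - i) x + G (Suc i) x * ?f (m - 1 - i) x)"])
        (auto simp: Suc_diff_Suc simp del: nth_deriv_on.simps(2))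
    ultimately show "(H has_vector_derivative G 0 x * ?f m x - (-1) ^ m * (G m x * f x)) (at x within {c..b})" by simp
  qed
  moreover have "H b - H c = (\<Sum>i<m. (-1) ^ i * (G i b * ?f (m - 1 - i) b - G i c * ?f (m - 1 - i) c))"
    unfolding H_def sum_subtractf[symmetric] by (intro sum.cong) (auto simp: algebra_simps)
  ultimately show ?thesis by simp
qed

lemma sobolev_sq_integrable:
  assumes "f \<in> sobolev_space m a b"
  shows "set_integrable lebesgue {a..b} (\<lambda>x. (cmod (nth_deriv_on a b m f x))\<^sup>2)"
    and "set_borel_measurable lebesgue {a..b} (nth_deriv_on a b m f)"
  using assms by (auto simp: sobolev_space_def)

lemma sobolev_mult_integrable:
  assumes f: "f \<in> sobolev_space m a b" and K: "continuous_on {a..b} K"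
  shows "set_integrable lebesgue {a..b} (\<lambda>x. K x * nth_deriv_on a b m f x)"
proof -
  let ?f = "nth_deriv_on a b m f"
  have "set_integrable lebesgue {a..b} (\<lambda>x. (cmod (K x))\<^sup>2)"
    by (intro absolutely_integrable_continuous_real continuous_intros K)
  then have "set_integrable lebesgue {a..b} (\<lambda>x. (cmod (K x))\<^sup>2 + (cmod (?f x))\<^sup>2)"
    using sobolev_sq_integrable(1)[OF f] by (rule set_integral_add)
  then show ?thesis
  proof (rule set_integrable_bound)
    have "set_borel_measurable lebesgue {a..b} K"
      unfolding set_borel_measurable_def
      by (subst borel_measurable_restrict_space_iff[symmetric]) (auto intro!: continuous_imp_measurable_on_sets_lebesgue K)
    then have "(\<lambda>x. (indicat_real {a..b} x *\<^sub>R K x) * (indicat_real {a..b} x *\<^sub>R ?f x)) \<in> borel_measurable lebesgue"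
      using sobolev_sq_integrable(2)[OF f] unfolding set_borel_measurable_def by (rule borel_measurable_times)
    moreover have "(\<lambda>x. (indicat_real {a..b} x *\<^sub>R K x) * (indicat_real {a..b} x *\<^sub>R ?f x)) = (\<lambda>x. indicat_real {a..b} x *\<^sub>R (K x * ?f x))"
      by (auto simp: indicator_def)
    ultimately show "set_borel_measurable lebesgue {a..b} (\<lambda>x. K x * ?f x)"
      unfolding set_borel_measurable_def by simp
    have "norm (K x * ?f x) \<le> norm ((cmod (K x))\<^sup>2 + (cmod (?f x))\<^sup>2)" for x
    proof -
      have "2 * (cmod (K x) * cmod (?f x)) \<le> (cmod (K x))\<^sup>2 + (cmod (?f x))\<^sup>2"
        using sum_squares_bound[of "cmod (K x)" "cmod (?f x)"] by (simp add: mult.assoc)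
      moreover have "0 \<le> cmod (K x) * cmod (?f x)" by simp
      ultimately show ?thesis unfolding norm_mult real_norm_def by linarith
    qed
    then show "AE x in lebesgue. x \<in> {a..b} \<longrightarrow> norm (K x * ?f x) \<le> norm ((cmod (K x))\<^sup>2 + (cmod (?f x))\<^sup>2)"
      by simp
  qed
qed

lemma sobolev_norm_eq:
  "sobolev_norm m a b f = sqrt (LINT x:{a..b}|lebesgue. (cmod (nth_deriv_on a b m f x))\<^sup>2)"
proof -
  have "sobolev_inner m a b f f = (LINT x:{a..b}|lebesgue. complex_of_real ((cmod (nth_deriv_on a b m f x))\<^sup>2))"
    unfolding sobolev_inner_def by (simp only: complex_norm_square)
  also have "\<dots> = complex_of_real (LINT x:{a..b}|lebesgue. (cmod (nth_deriv_on a b m f x))\<^sup>2)"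
    by (rule set_integral_complex_of_real)
  finally show ?thesis by (simp add: sobolev_norm_def)
qed

lemma sobolev_norm_nonneg: "0 \<le> sobolev_norm m a b f"
  unfolding sobolev_norm_eq set_lebesgue_integral_def by (auto intro!: integral_nonneg_AE)

lemma sobolev_norm_sq: "(sobolev_norm m a b f)\<^sup>2 = (LINT x:{a..b}|lebesgue. (cmod (nth_deriv_on a b m f x))\<^sup>2)"
  unfolding sobolev_norm_eq set_lebesgue_integral_def by (auto intro!: integral_nonneg_AE)

section \<open>Optimality in the sense of Sard\<close>

text \<open>Supplies smooth test functions with prescribed values at the nodes.\<close>

lemma poly_interpolation:
  fixes d :: "'a::field \<Rightarrow> 'a"
  assumes "finite S"
  shows "\<exists>p. \<forall>x\<in>S. poly p x = d x"
  using assms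
proof (induction S rule: finite_induct)
  case (insert x S)
  then obtain p where p: "\<forall>y\<in>S. poly p y = d y" by blast
  define r where "r = (\<Prod>y\<in>S. [:- y, 1:])"
  have rx: "poly r x \<noteq> 0" using insert by (auto simp: r_def poly_prod)
  have rS: "poly r y = 0" if "y \<in> S" for y
    using insert that by (auto simp: r_def poly_prod intro!: prod_zero)
  show ?case
    by (rule exI[of _ "p + smult ((d x - poly p x) / poly r x) r"]) (use p rx rS in auto)
qed simp

lemma set_integral_has_integral:
  fixes f :: "real \<Rightarrow> complex"
  assumes "set_integrable lebesgue {a..b} f"
  shows "(f has_integral (LINT x:{a..b}|lebesgue. f x)) {a..b}"
  using set_lebesgue_integral_eq_integral[OF assms] by (simp add: has_integral_integral)

lemma continuous_wave [continuous_intros]: "continuous_on S (wave \<omega>)"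
  unfolding wave_def by (intro continuous_intros)

lemma error_functional_linear:
  assumes f: "continuous_on {a..b} f" and g: "continuous_on {a..b} g"
  shows "error_functional \<omega> a b h N C (\<lambda>x. c * f x + d * g x)
    = c * error_functional \<omega> a b h N C f + d * error_functional \<omega> a b h N C g"
proof -
  have i: "set_integrable lebesgue {a..b} (\<lambda>x. wave \<omega> x * f x)" "set_integrable lebesgue {a..b} (\<lambda>x. wave \<omega> x * g x)"
    by (intro absolutely_integrable_continuous_real continuous_intros f g)+
  have "(LINT x:{a..b}|lebesgue. wave \<omega> x * (c * f x + d * g x)) =
     (LINT x:{a..b}|lebesgue. c * (wave \<omega> x * f x) + d * (wave \<omega> x * g x))"
    by (simp add: algebra_simps)
  also have "\<dots> = c * (LINT x:{a..b}|lebesgue. wave \<omega> x * f x) + d * (LINT x:{a..b}|lebesgue. wave \<omega> x * g x)"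
    using i by (subst set_integral_add(2)) auto
  finally show ?thesis
    by (simp add: error_functional_def sum.distrib sum_distrib_left algebra_simps)
qed

lemma higher_pderiv_degree_less:
  fixes p :: "'a::field_char_0 poly"
  shows "degree p < n \<Longrightarrow> (pderiv ^^ n) p = 0"
proof (induction n arbitrary: p)
  case (Suc n)
  show ?case
  proof (cases "degree p = 0")
    case True
    then have "pderiv p = 0" by (simp add: pderiv_eq_0_iff)
    moreover have "(pderiv ^^ n) (0::'a poly) = 0" by (induction n) auto
    ultimately show ?thesis by (simp only: funpow_Suc_right o_apply)
  next
    case False
    then have "degree (pderiv p) < n" using Suc.prems by (simp add: degree_pderiv)
    then show ?thesis using Suc.IH[of "pderiv p"] by (simp only: funpow_Suc_right o_apply)
  qed
qed simp

lemma smooth_sobolev_norm: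
  assumes "a < b" "m \<ge> 1" "has_derivs_on m a b E"
  shows "(sobolev_norm m a b (E 0))\<^sup>2 = (LINT x:{a..b}|lebesgue. (cmod (E m x))\<^sup>2)"
  unfolding sobolev_norm_sq
  by (rule set_lebesgue_integral_cong) (auto simp: has_derivs_on_sobolev(2)[OF assms])

lemma smooth_sq_integrable:
  assumes "has_derivs_on m a b E"
  shows "set_integrable lebesgue {a..b} (\<lambda>x. (cmod (E m x))\<^sup>2)"
  by (intro absolutely_integrable_continuous_real continuous_intros has_derivs_on_continuous[OF assms order_refl])

text \<open>\<open>D 0\<close> is the extremal function. Its seminorm is \<kappa>, the L2 norm of
  \<open>K\<close>, and every exact formula takes the value \<kappa>^2 on it, because exactness on
  constants makes the node sums of two exact formulas agree there. So \<kappa> is a lower bound for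
  all error norms, while Cauchy-Schwarz makes it an upper bound for that of \<open>C0\<close>. A
  first variation at \<open>D 0\<close> gives uniqueness.\<close>

lemma sard_optimal_characterization:
  fixes K :: "real \<Rightarrow> complex"
  assumes ab: "a < b" and m: "m \<ge> 1" and h: "h \<noteq> 0"
    and K: "continuous_on {a..b} K"
    and rep: "\<And>f. f \<in> sobolev_space m a b \<Longrightarrow>
      error_functional \<omega> a b h N C0 f = (LINT x:{a..b}|lebesgue. K x * nth_deriv_on a b m f x)"
    and D: "has_derivs_on m a b D" "\<And>x. x \<in> {a..b} \<Longrightarrow> D m x = cnj (K x)"
      "\<And>\<beta>. \<beta> \<le> N \<Longrightarrow> D 0 (h * real \<beta> + a) = \<gamma>"
  shows "sard_optimal m \<omega> a b h N C \<longleftrightarrow> (\<forall>\<beta>\<in>{0..N}. C \<beta> = C0 \<beta>)"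
proof -
  let ?E = "error_functional \<omega> a b h N"
  define \<kappa> where "\<kappa> = sqrt (LINT x:{a..b}|lebesgue. (cmod (K x))\<^sup>2)"
  have K2int: "set_integrable lebesgue {a..b} (\<lambda>x. (cmod (K x))\<^sup>2)"
    by (intro absolutely_integrable_continuous_real continuous_intros K)
  have \<kappa>0: "\<kappa> \<ge> 0" unfolding \<kappa>_def set_lebesgue_integral_def by (auto intro!: integral_nonneg_AE)
  have \<kappa>2: "\<kappa>\<^sup>2 = (LINT x:{a..b}|lebesgue. (cmod (K x))\<^sup>2)"
    unfolding \<kappa>_def set_lebesgue_integral_def by (auto intro!: integral_nonneg_AE)
  have rep_smooth: "?E C0 (G 0) = (LINT x:{a..b}|lebesgue. K x * G m x)" if G: "has_derivs_on m a b G" for G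
    unfolding rep[OF has_derivs_on_sobolev(1)[OF ab m G]]
    by (rule set_lebesgue_integral_cong) (auto simp: has_derivs_on_sobolev(2)[OF ab m G])
  \<comment> \<open>A functional that sees only the m-th derivative annihilates polynomials of
    degree less than m.\<close>
  have exact0: "exact_on_polynomials m \<omega> a b h N C0"
    unfolding exact_on_polynomials_def
  proof (intro allI impI)
    fix \<alpha> assume \<alpha>: "\<alpha> < m"
    have "degree (monom (1::complex) \<alpha>) < m" using \<alpha> by (simp add: degree_monom_eq)
    then have z: "(pderiv ^^ m) (monom (1::complex) \<alpha>) = 0" by (rule higher_pderiv_degree_less)
    have "?E C0 (\<lambda>x. poly ((pderiv ^^ 0) (monom 1 \<alpha>)) (of_real x)) = 0"
      using rep_smooth[OF has_derivs_on_poly[of m a b "monom 1 \<alpha>"]] by (simp add: z)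
    then show "?E C0 (\<lambda>x. of_real x ^ \<alpha>) = 0" by (simp add: poly_monom)
  qed
  have upper: "cmod (?E C0 f) \<le> \<kappa>" if f: "f \<in> sobolev_space m a b" "sobolev_norm m a b f \<le> 1" for f
  proof -
    let ?f = "nth_deriv_on a b m f"
    note f2 = sobolev_sq_integrable(1)[OF f(1)]
    \<comment> \<open>Cauchy-Schwarz as a weighted inequality of arithmetic and geometric means. The
      best weight is t = \<kappa>; for \<kappa> = 0 arbitrarily small t are taken.\<close>
    have bound: "cmod (?E C0 f) \<le> (\<kappa>\<^sup>2 / t + t) / 2" if t: "t > 0" for t
    proof -
      have i: "set_integrable lebesgue {a..b} (\<lambda>x. ((cmod (K x))\<^sup>2 / t + t * (cmod (?f x))\<^sup>2) / 2)"
        using K2int f2 by (intro set_integral_add set_integrable_divide set_integrable_mult_right) auto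
      have "cmod (?E C0 f) \<le> (LINT x:{a..b}|lebesgue. cmod (K x * ?f x))"
        unfolding rep[OF f(1)] by (rule set_integral_norm_bound[OF sobolev_mult_integrable[OF f(1) K]])
      also have "\<dots> \<le> (LINT x:{a..b}|lebesgue. ((cmod (K x))\<^sup>2 / t + t * (cmod (?f x))\<^sup>2) / 2)"
      proof (rule set_integral_mono[OF set_integrable_norm[OF sobolev_mult_integrable[OF f(1) K]] i])
        fix x
        have "0 \<le> (cmod (K x) - t * cmod (?f x))\<^sup>2 / t" using t by simp
        also have "\<dots> = (cmod (K x))\<^sup>2 / t + t * (cmod (?f x))\<^sup>2 - 2 * (cmod (K x) * cmod (?f x))"
          using t by (simp add: power2_diff field_simps power2_eq_square)
        finally show "cmod (K x * ?f x) \<le> ((cmod (K x))\<^sup>2 / t + t * (cmod (?f x))\<^sup>2) / 2"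
          by (simp add: norm_mult)
      qed
      also have "\<dots> = (\<kappa>\<^sup>2 / t + t * (sobolev_norm m a b f)\<^sup>2) / 2"
        unfolding \<kappa>2 sobolev_norm_sq using K2int f2
        by (simp add: set_integral_add)
      also have "\<dots> \<le> (\<kappa>\<^sup>2 / t + t * 1) / 2"
        using f(2) sobolev_norm_nonneg t by (intro divide_right_mono add_left_mono mult_left_mono) (auto intro: power_le_one)
      finally show ?thesis by simp
    qed
    show ?thesis
    proof (cases "\<kappa> = 0")
      case True
      show ?thesis
      proof (rule field_le_epsilon)
        fix e :: real assume "e > 0"
        then show "cmod (?E C0 f) \<le> \<kappa> + e" using bound[of "2 * e"] True by simp
      qed
    next
      case False
      then show ?thesis using bound[of \<kappa>] \<kappa>0 by (simp add: power2_eq_square)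
    qed
  qed
  then have norm0: "error_norm m \<omega> a b h N C0 \<le> ereal \<kappa>"
    unfolding error_norm_def by (intro SUP_least) auto
  \<comment> \<open>The error norm is a supremum over the unit ball only. Scaling by an upper bound
    \<open>s\<close> avoids division by a seminorm that may be zero.\<close>
  have scaled: "cmod (?E C' (G 0)) \<le> c * s"
    if le: "error_norm m \<omega> a b h N C' \<le> ereal c" and G: "has_derivs_on m a b G" and s: "s > 0" "sobolev_norm m a b (G 0) \<le> s" for C' c G s
  proof -
    define H where "H i x = of_real (1/s) * G i x + 0 * G i x" for i x
    have H: "has_derivs_on m a b H"
      unfolding H_def by (rule has_derivs_on_linear[OF G G])
    have "(sobolev_norm m a b (H 0))\<^sup>2 = (LINT x:{a..b}|lebesgue. (1/s)\<^sup>2 * (cmod (G m x))\<^sup>2)"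
      unfolding smooth_sobolev_norm[OF ab m H] by (simp add: H_def norm_mult power_mult_distrib norm_divide power_divide)
    also have "\<dots> = (1/s)\<^sup>2 * (sobolev_norm m a b (G 0))\<^sup>2"
      unfolding smooth_sobolev_norm[OF ab m G] by (rule set_integral_mult_right)
    also have "\<dots> = (sobolev_norm m a b (G 0) / s)\<^sup>2" by (simp add: power_divide)
    also have "\<dots> \<le> 1"
      using s sobolev_norm_nonneg[of m a b "G 0"] by (intro power_le_one) auto
    finally have "sobolev_norm m a b (H 0) \<le> 1"
      using sobolev_norm_nonneg[of m a b "H 0"] by (simp add: power2_le_iff_abs_le abs_le_square_iff[symmetric] power_le_one_iff)
    then have "ereal (cmod (?E C' (H 0))) \<le> error_norm m \<omega> a b h N C'"
      unfolding error_norm_def using has_derivs_on_sobolev(1)[OF ab m H] by (intro SUP_upper) auto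
    then have "cmod (?E C' (H 0)) \<le> c" using le by (meson ereal_less_eq(3) order_trans)
    moreover have "?E C' (H 0) = of_real (1/s) * ?E C' (G 0)"
      unfolding H_def using error_functional_linear[of a b "G 0" "G 0" \<omega> h N C' "of_real (1/s)" 0]
        has_derivs_on_continuous[OF G, of 0] by simp
    ultimately show ?thesis using s(1) by (simp add: norm_mult norm_divide field_simps)
  qed
  have normD: "(sobolev_norm m a b (D 0))\<^sup>2 = \<kappa>\<^sup>2"
    unfolding smooth_sobolev_norm[OF ab m D(1)] \<kappa>2 by (rule set_lebesgue_integral_cong) (auto simp: D(2))
  then have normD': "sobolev_norm m a b (D 0) = \<kappa>" using \<kappa>0 sobolev_norm_nonneg by simp
  have E0D: "?E C0 (D 0) = of_real (\<kappa>\<^sup>2)"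
  proof -
    have "?E C0 (D 0) = (LINT x:{a..b}|lebesgue. complex_of_real ((cmod (K x))\<^sup>2))"
      unfolding rep_smooth[OF D(1)]
      by (rule set_lebesgue_integral_cong) (auto simp: D(2) complex_norm_square simp del: of_real_power)
    then show ?thesis unfolding \<kappa>2 by (simp only: set_integral_complex_of_real)
  qed
  have diff: "?E C' f = ?E C0 f - (\<Sum>\<beta>=0..N. (C' \<beta> - C0 \<beta>) * f (h * real \<beta> + a))" for C' f
    by (simp add: error_functional_def sum_subtractf algebra_simps)
  have ED: "?E C' (D 0) = of_real (\<kappa>\<^sup>2)" if ex: "exact_on_polynomials m \<omega> a b h N C'" for C'
  proof -
    have "?E C' (\<lambda>x. of_real x ^ 0) = 0" "?E C0 (\<lambda>x. of_real x ^ 0) = 0"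
      using ex exact0 m unfolding exact_on_polynomials_def by auto
    then have "(\<Sum>\<beta>=0..N. (C' \<beta> - C0 \<beta>)) = 0" using diff[of C' "\<lambda>x. of_real x ^ 0"] by simp
    moreover have "(\<Sum>\<beta>=0..N. (C' \<beta> - C0 \<beta>) * D 0 (h * real \<beta> + a)) = (\<Sum>\<beta>=0..N. (C' \<beta> - C0 \<beta>)) * \<gamma>"
      unfolding sum_distrib_right by (intro sum.cong) (auto simp: D(3))
    ultimately show ?thesis using diff[of C' "D 0"] E0D by simp
  qed
  have lower: "ereal \<kappa> \<le> error_norm m \<omega> a b h N C'" if ex: "exact_on_polynomials m \<omega> a b h N C'" for C'
  proof (rule ccontr)
    assume n: "\<not> ereal \<kappa> \<le> error_norm m \<omega> a b h N C'"
    \<comment> \<open>The zero function lies in the unit ball, so the extended-real supremum is at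
      least 0 and, if it is below \<kappa>, a real number.\<close>
    have "(\<lambda>x. poly ((pderiv ^^ 0) 0) (of_real x)) \<in> sobolev_space m a b \<and> sobolev_norm m a b (\<lambda>x. poly ((pderiv ^^ 0) 0) (of_real x)) = 0"
    proof
      show "(\<lambda>x. poly ((pderiv ^^ 0) 0) (of_real x)) \<in> sobolev_space m a b"
        by (rule has_derivs_on_sobolev(1)[OF ab m has_derivs_on_poly])
      have "(pderiv ^^ m) (0::complex poly) = 0" by (induction m) auto
      then have "(sobolev_norm m a b (\<lambda>x. poly ((pderiv ^^ 0) 0) (of_real x)))\<^sup>2 = 0"
        using smooth_sobolev_norm[OF ab m has_derivs_on_poly[of m a b 0]] by simp
      then show "sobolev_norm m a b (\<lambda>x. poly ((pderiv ^^ 0) 0) (of_real x)) = 0" by simp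
    qed
    then have "ereal (cmod (?E C' (\<lambda>x. poly ((pderiv ^^ 0) 0) (of_real x)))) \<le> error_norm m \<omega> a b h N C'"
      unfolding error_norm_def by (intro SUP_upper) auto
    then have nn: "0 \<le> error_norm m \<omega> a b h N C'" by (simp add: error_functional_def zero_ereal_def)
    then obtain c where c: "error_norm m \<omega> a b h N C' = ereal c" "c \<ge> 0" "c < \<kappa>"
      using n by (cases "error_norm m \<omega> a b h N C'") auto
    then have "\<kappa>\<^sup>2 \<le> c * \<kappa>"
      using scaled[of C' c D \<kappa>] ED[OF ex] D(1) normD' by (simp add: norm_power)
    moreover have "c * \<kappa> < \<kappa>\<^sup>2" using c by (simp add: power2_eq_square)
    ultimately show False by simp
  qed
  show ?thesis
  proof
    assume eq: "\<forall>\<beta>\<in>{0..N}. C \<beta> = C0 \<beta>"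
    then have "?E C = ?E C0" unfolding error_functional_def by (intro ext) simp
    then have "exact_on_polynomials m \<omega> a b h N C" "error_norm m \<omega> a b h N C = error_norm m \<omega> a b h N C0"
      using exact0 unfolding exact_on_polynomials_def error_norm_def by auto
    then show "sard_optimal m \<omega> a b h N C"
      by (auto simp: sard_optimal_def intro: order_trans[OF norm0 lower])
  next
    assume opt: "sard_optimal m \<omega> a b h N C"
    then have ex: "exact_on_polynomials m \<omega> a b h N C" by (simp add: sard_optimal_def)
    have normC: "error_norm m \<omega> a b h N C \<le> ereal \<kappa>"
      using opt exact0 norm0 unfolding sard_optimal_def by (meson order_trans)
    define d where "d \<beta> = C \<beta> - C0 \<beta>" for \<beta>
    define node where "node \<beta> = complex_of_real (h * real \<beta> + a)" for \<beta>
    have inj: "inj_on node {0..N}"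
      using h by (auto simp: node_def inj_on_def simp flip: of_real_mult of_real_add)
    \<comment> \<open>With the conjugate differences as node values, the difference of the two
      formulas applied to this polynomial is the sum of squares \<sigma>.\<close>
    obtain p where "\<forall>z\<in>node ` {0..N}. poly p z = cnj (d (the_inv_into {0..N} node z))"
      using poly_interpolation[of "node ` {0..N}" "\<lambda>z. cnj (d (the_inv_into {0..N} node z))"] by auto
    then have p: "poly p (of_real (h * real \<beta> + a)) = cnj (d \<beta>)" if "\<beta> \<le> N" for \<beta>
      using that the_inv_into_f_f[OF inj, of \<beta>] by (simp add: node_def)
    define G where "G i x = poly ((pderiv ^^ i) p) (complex_of_real x)" for i x
    have G: "has_derivs_on m a b G" unfolding G_def by (rule has_derivs_on_poly)
    define \<sigma> where "\<sigma> = (\<Sum>\<beta>=0..N. (cmod (d \<beta>))\<^sup>2)"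
    define z where "z = ?E C0 (G 0)"
    define \<nu> where "\<nu> = (sobolev_norm m a b (G 0))\<^sup>2"
    have EG: "?E C (G 0) = z - of_real \<sigma>"
    proof -
      have "(\<Sum>\<beta>=0..N. (C \<beta> - C0 \<beta>) * G 0 (h * real \<beta> + a)) = of_real \<sigma>"
        unfolding \<sigma>_def of_real_sum by (intro sum.cong) (use p in \<open>auto simp: G_def d_def[symmetric] complex_norm_square simp del: of_real_power\<close>)
      then show ?thesis using diff[of C "G 0"] by (simp add: z_def)
    qed
    \<comment> \<open>Moving from \<open>D 0\<close> by - \<epsilon> times the polynomial changes
      the functional and half of the squared seminorm by the same first-order term - \<epsilon> Re
      z. It cancels in Re E(H) \<le> (\<kappa>^2 + |H|^2) / 2, and \<epsilon> \<sigma> remains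
      against a term of order \<epsilon>^2.\<close>
    have key: "\<epsilon> * \<sigma> \<le> \<epsilon>\<^sup>2 * \<nu> / 2" if \<epsilon>: "\<epsilon> > 0" for \<epsilon> :: real
    proof -
      define H where "H i x = 1 * D i x + (- of_real \<epsilon>) * G i x" for i x
      have H: "has_derivs_on m a b H" unfolding H_def by (rule has_derivs_on_linear[OF D(1) G])
      have "?E C (H 0) = ?E C (D 0) + (- of_real \<epsilon>) * ?E C (G 0)"
        unfolding H_def using error_functional_linear[of a b "D 0" "G 0" \<omega> h N C 1 "- of_real \<epsilon>"]
          has_derivs_on_continuous[OF G, of 0] has_derivs_on_continuous[OF D(1), of 0] by simp
      also have "\<dots> = of_real (\<kappa>\<^sup>2 + \<epsilon> * \<sigma>) - of_real \<epsilon> * z"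
        unfolding ED[OF ex] EG by (simp add: algebra_simps)
      finally have EH: "Re (?E C (H 0)) = \<kappa>\<^sup>2 - \<epsilon> * Re z + \<epsilon> * \<sigma>"
        by simp
      have nH: "(sobolev_norm m a b (H 0))\<^sup>2 = \<kappa>\<^sup>2 - 2 * \<epsilon> * Re z + \<epsilon>\<^sup>2 * \<nu>"
      proof -
        have KG: "set_integrable lebesgue {a..b} (\<lambda>x. K x * G m x)"
          by (intro absolutely_integrable_continuous_real continuous_intros K has_derivs_on_continuous[OF G order_refl])
        have KGr: "set_integrable lebesgue {a..b} (\<lambda>x. Re (K x * G m x))"
          using KG by (intro absolutely_integrable_continuous_real continuous_intros K has_derivs_on_continuous[OF G order_refl])
        have rez: "Re z = (LINT x:{a..b}|lebesgue. Re (K x * G m x))"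
        proof -
          have "((\<lambda>x. K x * G m x) has_integral z) {a..b}"
            unfolding z_def rep_smooth[OF G] by (rule set_integral_has_integral[OF KG])
          then have "((\<lambda>x. Re (K x * G m x)) has_integral Re z) {a..b}"
            by (rule has_integral_Re)
          then show ?thesis using set_lebesgue_integral_eq_integral(2)[OF KGr] by (simp add: integral_unique)
        qed
        have pt: "(cmod (cnj u - of_real \<epsilon> * v))\<^sup>2 = (cmod u)\<^sup>2 + (- 2 * \<epsilon>) * Re (u * v) + \<epsilon>\<^sup>2 * (cmod v)\<^sup>2" for u v
          unfolding cmod_power2 by (simp add: power2_eq_square algebra_simps)
        have "(sobolev_norm m a b (H 0))\<^sup>2 = (LINT x:{a..b}|lebesgue. (cmod (K x))\<^sup>2 + (- 2 * \<epsilon>) * Re (K x * G m x) + \<epsilon>\<^sup>2 * (cmod (G m x))\<^sup>2)"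
          unfolding smooth_sobolev_norm[OF ab m H]
        proof (intro set_lebesgue_integral_cong allI impI)
          fix x assume "x \<in> {a..b}"
          then have "H m x = cnj (K x) - of_real \<epsilon> * G m x" by (simp add: H_def D(2))
          then show "(cmod (H m x))\<^sup>2 = (cmod (K x))\<^sup>2 + (- 2 * \<epsilon>) * Re (K x * G m x) + \<epsilon>\<^sup>2 * (cmod (G m x))\<^sup>2"
            by (simp only: pt)
        qed auto
        also have "\<dots> = (LINT x:{a..b}|lebesgue. (cmod (K x))\<^sup>2) + (- 2 * \<epsilon>) * (LINT x:{a..b}|lebesgue. Re (K x * G m x))
            + \<epsilon>\<^sup>2 * (LINT x:{a..b}|lebesgue. (cmod (G m x))\<^sup>2)"
          using K2int KGr smooth_sq_integrable[OF G] set_integrable_mult_right[OF KGr, of "- 2 * \<epsilon>"] set_integrable_mult_right[OF smooth_sq_integrable[OF G], of "\<epsilon>\<^sup>2"]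
            set_integral_add(1)[OF K2int set_integrable_mult_right[OF KGr, of "- 2 * \<epsilon>"]]
          by (simp only: set_integral_add(2) set_integral_mult_right)
        finally show ?thesis
          unfolding \<kappa>2 \<nu>_def smooth_sobolev_norm[OF ab m G] rez by simp
      qed
      let ?s = "sobolev_norm m a b (H 0)"
      have "Re (?E C (H 0)) \<le> \<kappa> * ?s"
      proof (rule field_le_epsilon)
        fix e :: real assume e: "e > 0"
        \<comment> \<open>The perturbed function may have seminorm 0 and \<kappa> may be 0, hence
          the slack and the added 1.\<close>
        define e' where "e' = e / (\<kappa> + 1)"
        have e': "e' > 0" "\<kappa> * e' \<le> e" using e \<kappa>0 by (auto simp: e'_def field_simps)
        have "cmod (?E C (H 0)) \<le> \<kappa> * (?s + e')"
          by (rule scaled[OF normC H]) (use e' sobolev_norm_nonneg[of m a b "H 0"] in auto)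
        then have "cmod (?E C (H 0)) \<le> \<kappa> * ?s + e" using e' by (simp add: algebra_simps)
        then show "Re (?E C (H 0)) \<le> \<kappa> * ?s + e" using complex_Re_le_cmod order_trans by blast
      qed
      also have "\<dots> \<le> (\<kappa>\<^sup>2 + ?s\<^sup>2) / 2"
        using sum_squares_bound[of \<kappa> ?s] by simp
      finally show ?thesis unfolding EH nH by (simp add: field_simps)
    qed
    have "\<sigma> \<le> 0"
    proof (rule field_le_epsilon)
      fix e :: real assume e: "e > 0"
      have \<nu>0: "\<nu> \<ge> 0" by (simp add: \<nu>_def)
      define \<epsilon> where "\<epsilon> = e / (\<nu> + 1)"
      have \<epsilon>: "\<epsilon> > 0" "\<epsilon> * \<nu> \<le> e" using e \<nu>0 by (auto simp: \<epsilon>_def field_simps)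
      have "\<epsilon> * \<sigma> \<le> \<epsilon> * (\<epsilon> * \<nu> / 2)" using key[OF \<epsilon>(1)] by (simp add: power2_eq_square)
      then have "\<sigma> \<le> \<epsilon> * \<nu> / 2" using \<epsilon>(1) by (simp only: mult_le_cancel_left_pos)
      then show "\<sigma> \<le> 0 + e" using \<epsilon> e by linarith
    qed
    then have "\<sigma> = 0" unfolding \<sigma>_def by (meson antisym sum_nonneg zero_le_power2)
    then have "\<forall>\<beta>\<in>{0..N}. (cmod (d \<beta>))\<^sup>2 = 0"
      unfolding \<sigma>_def by (subst (asm) sum_nonneg_eq_0_iff) auto
    then show "\<forall>\<beta>\<in>{0..N}. C \<beta> = C0 \<beta>" by (simp add: d_def)
  qed
qed

section \<open>Linear algebra and the Euler-Frobenius polynomials\<close>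

text \<open>Gaussian elimination, by induction on the unknowns: in an injective system every column
  contains a nonzero pivot, and eliminating \<open>i0\<close> with it leaves a smaller injective
  system \<open>M'\<close>.\<close>

lemma square_system_solvable:
  fixes M :: "'j \<Rightarrow> 'i \<Rightarrow> 'a::field"
  assumes "finite I" "finite J" "card I = card J"
    and "\<And>x. (\<And>j. j \<in> J \<Longrightarrow> (\<Sum>i\<in>I. M j i * x i) = 0) \<Longrightarrow> (\<And>i. i \<in> I \<Longrightarrow> x i = 0)"
  shows "\<exists>x. \<forall>j\<in>J. (\<Sum>i\<in>I. M j i * x i) = r j"
  using assms
proof (induction I arbitrary: J M r rule: finite_induct)
  case empty
  then show ?case by auto
next
  case (insert i0 I)
  have "\<exists>j0\<in>J. M j0 i0 \<noteq> 0"
  proof (rule ccontr)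
    assume "\<not> (\<exists>j0\<in>J. M j0 i0 \<noteq> 0)"
    then have z: "M j i0 = 0" if "j \<in> J" for j using that by auto
    have "(if i0 = i0 then 1 else 0 :: 'a) = 0"
    proof (rule insert.prems(3)[of "\<lambda>i. if i = i0 then 1 else 0"])
      fix j assume "j \<in> J"
      then show "(\<Sum>i\<in>insert i0 I. M j i * (if i = i0 then 1 else 0)) = 0"
        using insert.hyps z by (auto intro!: sum.neutral)
    qed auto
    then show False by simp
  qed
  then obtain j0 where j0: "j0 \<in> J" "M j0 i0 \<noteq> 0" by blast
  define J' where "J' = J - {j0}"
  define M' where "M' j i = M j i - M j i0 * M j0 i / M j0 i0" for j i
  \<comment> \<open>\<open>x\<close> is completed by the value of the unknown \<open>i0\<close> that
    solves the pivot equation with right-hand side \<open>t\<close>.\<close>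
  have lift: "(\<Sum>i\<in>insert i0 I. M j i * (x(i0 := (t - (\<Sum>i\<in>I. M j0 i * x i)) / M j0 i0)) i)
      = (\<Sum>i\<in>I. M' j i * x i) + M j i0 * t / M j0 i0" for j t x
  proof -
    have "(\<Sum>i\<in>insert i0 I. M j i * (x(i0 := (t - (\<Sum>i\<in>I. M j0 i * x i)) / M j0 i0)) i)
      = M j i0 * ((t - (\<Sum>i\<in>I. M j0 i * x i)) / M j0 i0) + (\<Sum>i\<in>I. M j i * x i)"
      using insert.hyps by (auto intro!: sum.cong)
    also have "\<dots> = (\<Sum>i\<in>I. M j i * x i) - (\<Sum>i\<in>I. M j i0 * M j0 i / M j0 i0 * x i) + M j i0 * t / M j0 i0"
      by (simp add: diff_divide_distrib right_diff_distrib sum_distrib_left sum_divide_distrib mult.assoc)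
    also have "\<dots> = (\<Sum>i\<in>I. M' j i * x i) + M j i0 * t / M j0 i0"
      by (simp add: M'_def left_diff_distrib sum_subtractf)
    finally show ?thesis .
  qed
  have M'0: "M' j0 i = 0" for i using j0 by (simp add: M'_def)
  have "\<exists>x. \<forall>j\<in>J'. (\<Sum>i\<in>I. M' j i * x i) = r j - M j i0 * r j0 / M j0 i0"
  proof (rule insert.IH)
    show "finite J'" "card I = card J'"
      using insert.prems insert.hyps j0 by (auto simp: J'_def)
    fix x i assume x: "\<And>j. j \<in> J' \<Longrightarrow> (\<Sum>i\<in>I. M' j i * x i) = 0" and i: "i \<in> I"
    have "(x(i0 := (0 - (\<Sum>i\<in>I. M j0 i * x i)) / M j0 i0)) i = 0"
    proof (rule insert.prems(3))
      fix j assume "j \<in> J"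
      then show "(\<Sum>i\<in>insert i0 I. M j i * (x(i0 := (0 - (\<Sum>i\<in>I. M j0 i * x i)) / M j0 i0)) i) = 0"
        unfolding lift using x[of j] by (cases "j = j0") (auto simp: J'_def M'0)
    qed (use i in auto)
    then show "x i = 0" using i insert.hyps by (auto split: if_splits)
  qed
  then obtain x where x: "\<And>j. j \<in> J' \<Longrightarrow> (\<Sum>i\<in>I. M' j i * x i) = r j - M j i0 * r j0 / M j0 i0" by blast
  show ?case
  proof (intro exI ballI)
    fix j assume "j \<in> J"
    then show "(\<Sum>i\<in>insert i0 I. M j i * (x(i0 := (r j0 - (\<Sum>i\<in>I. M j0 i * x i)) / M j0 i0)) i) = r j"
      unfolding lift using x[of j] j0 by (cases "j = j0") (auto simp: J'_def M'0)
  qed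
qed

text \<open>A Vandermonde argument: combining the equations with the coefficients of a polynomial
  that vanishes at every other \<open>z j\<close> isolates one term. As the equations start at n =
  1, the polynomial carries an extra factor, which is harmless because \<open>z i\<close> is
  nonzero.\<close>

lemma exponentials_independent:
  fixes z \<xi> :: "'i \<Rightarrow> 'a::field"
  assumes I: "finite I" "inj_on z I" "\<And>i. i \<in> I \<Longrightarrow> z i \<noteq> 0"
    and zero: "\<And>n. n \<ge> 1 \<Longrightarrow> (\<Sum>i\<in>I. \<xi> i * z i ^ n) = 0"
    and i: "i \<in> I"
  shows "\<xi> i = 0"
proof -
  define p where "p = (\<Prod>j\<in>I - {i}. [:- z j, 1:])"
  have "(\<Sum>j\<in>I. \<xi> j * (z j * poly p (z j))) = (\<Sum>j\<in>I. \<Sum>n\<le>degree p. coeff p n * (\<xi> j * z j ^ Suc n))"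
    unfolding poly_altdef by (intro sum.cong) (auto simp: sum_distrib_left intro!: sum.cong)
  also have "\<dots> = (\<Sum>n\<le>degree p. coeff p n * (\<Sum>j\<in>I. \<xi> j * z j ^ Suc n))"
    by (subst sum.swap) (simp add: sum_distrib_left)
  also have "\<dots> = 0" using zero by (intro sum.neutral ballI) (simp del: power_Suc)
  finally have "(\<Sum>j\<in>I. \<xi> j * (z j * poly p (z j))) = 0" .
  moreover have "\<xi> j * (z j * poly p (z j)) = 0" if "j \<in> I - {i}" for j
    using I that by (auto simp: p_def poly_prod)
  ultimately have "\<xi> i * (z i * poly p (z i)) = 0"
    using I i by (simp add: sum.remove[OF I(1) i])
  moreover have "poly p (z i) \<noteq> 0"
    using I i by (auto simp: p_def poly_prod inj_on_def)
  ultimately show ?thesis using I(3)[OF i] by simp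
qed

section \<open>Differences of powers at zero and polylogarithms of negative order\<close>

lemma diff0_Suc: "t \<ge> 1 \<Longrightarrow> diff0 t (Suc j) = of_nat t * (diff0 t j + diff0 (t - 1) j)"
proof -
  assume "t \<ge> 1"
  then obtain s where t: "t = Suc s" by (cases t) auto
  have "diff0 t (Suc j) = (\<Sum>l=1..t. of_nat t * ((-1) ^ (t - l) * of_nat (s choose (l - 1)) * of_nat l ^ j))"
    unfolding diff0_def
  proof (intro sum.cong refl)
    fix l assume l: "l \<in> {1..t}"
    then obtain k where k: "l = Suc k" by (cases l) auto
    have "of_nat l * of_nat (t choose l) = (of_nat t * of_nat (s choose k) :: complex)"
      unfolding t k of_nat_mult[symmetric] by (simp only: Suc_times_binomial_eq mult.commute)
    then show "(-1) ^ (t - l) * of_nat (t choose l) * of_nat l ^ Suc j = of_nat t * ((-1) ^ (t - l) * of_nat (s choose (l - 1)) * (of_nat l ^ j :: complex))"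
      by (simp add: k mult_ac)
  qed
  also have "\<dots> = of_nat t * (\<Sum>l=1..t. (-1) ^ (t - l) * of_nat (t choose l) * of_nat l ^ j - (-1) ^ (t - l) * of_nat (s choose l) * of_nat l ^ j)"
    unfolding sum_distrib_left
  proof (intro sum.cong refl)
    fix l assume l: "l \<in> {1..t}"
    then obtain k where k: "l = Suc k" by (cases l) auto
    have "of_nat (t choose l) = (of_nat (s choose k) + of_nat (s choose l) :: complex)"
      unfolding t k by simp
    then show "of_nat t * ((-1) ^ (t - l) * of_nat (s choose (l - 1)) * of_nat l ^ j) =
      of_nat t * ((-1) ^ (t - l) * of_nat (t choose l) * of_nat l ^ j - (-1) ^ (t - l) * of_nat (s choose l) * (of_nat l ^ j :: complex))"
      by (simp add: k algebra_simps)
  qed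
  also have "(\<Sum>l=1..t. (-1) ^ (t - l) * of_nat (t choose l) * of_nat l ^ j - (-1) ^ (t - l) * of_nat (s choose l) * of_nat l ^ j)
     = diff0 t j - (\<Sum>l=1..t. (-1) ^ (t - l) * of_nat (s choose l) * (of_nat l ^ j :: complex))"
    by (simp add: diff0_def sum_subtractf)
  also have "(\<Sum>l=1..t. (-1) ^ (t - l) * of_nat (s choose l) * (of_nat l ^ j :: complex)) = (\<Sum>l=1..s. - ((-1) ^ (s - l) * of_nat (s choose l) * of_nat l ^ j))"
    unfolding t by (simp add: Suc_diff_le cong: sum.cong_simp)
  also have "\<dots> = - diff0 s j" by (simp add: diff0_def sum_negf)
  finally show ?thesis by (simp add: t)
qed

lemma diff0_0_left [simp]: "diff0 0 j = 0"
  by (simp add: diff0_def)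

text \<open>For t, j \<ge> 1 the number \<open>diff0 t j\<close> is t! times a Stirling number of
  the second kind. At j = 0 the summation from l = 1 omits the term (-1)^t, whose negative remains;
  this value starts the recurrence.\<close>

lemma diff0_0_right: "t \<ge> 1 \<Longrightarrow> diff0 t 0 = - ((-1) ^ t)"
proof -
  assume t: "t \<ge> 1"
  have "(0::complex) = (1 + (-1)) ^ t" using t by simp
  also have "\<dots> = (\<Sum>l\<le>t. of_nat (t choose l) * 1 ^ l * (-1) ^ (t - l))" by (rule binomial_ring)
  also have "{..t} = insert 0 {1..t}" by auto
  also have "(\<Sum>l\<in>insert 0 {1..t}. of_nat (t choose l) * 1 ^ l * (-1) ^ (t - l)) = (-1) ^ t + diff0 t 0"
    by (subst sum.insert) (auto simp: diff0_def mult.commute)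
  finally show ?thesis by (simp add: eq_neg_iff_add_eq_0 add.commute)
qed

lemma diff0_1: "diff0 t (Suc 0) = (if t = 1 then 1 else 0)"
proof (cases t)
  case (Suc s)
  then show ?thesis
    using diff0_Suc[of t 0] diff0_0_right[of t] diff0_0_right[of s] by (cases s) auto
qed simp

lemma diff0_eq_0: "1 \<le> j \<Longrightarrow> j < t \<Longrightarrow> diff0 t j = 0"
proof (induction j arbitrary: t rule: dec_induct)
  case base
  then show ?case by (simp add: diff0_1)
next
  case (step j)
  then show ?case by (simp add: diff0_Suc)
qed

text \<open>Newton's forward difference formula. It is proved for complex x because it is applied to
  natural numbers and to their negatives, which produces the two shapes of inner sums in the linear
  system.\<close>

lemma power_eq_sum_gbinomial:
  fixes x :: complex
  assumes "1 \<le> j"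
  shows "x ^ j = (\<Sum>t=1..j. (x gchoose t) * diff0 t j)"
  using assms
proof (induction j rule: dec_induct)
  case base
  show ?case by (simp add: diff0_1)
next
  case (step j)
  have g: "x * (x gchoose t) = of_nat t * (x gchoose t) + of_nat (Suc t) * (x gchoose Suc t)" for t
    using gbinomial_mult_1[of x t] by (simp add: algebra_simps)
  have "x ^ Suc j = x * x ^ j" by simp
  also have "\<dots> = (\<Sum>t=1..j. x * (x gchoose t) * diff0 t j)"
    unfolding step.IH by (simp add: sum_distrib_left mult.assoc)
  also have "\<dots> = (\<Sum>t=1..j. of_nat t * (x gchoose t) * diff0 t j) + (\<Sum>t=1..j. of_nat (Suc t) * (x gchoose Suc t) * diff0 t j)"
    unfolding g by (simp only: distrib_right sum.distrib)
  also have "(\<Sum>t=1..j. of_nat t * (x gchoose t) * diff0 t j) = (\<Sum>t=1..Suc j. of_nat t * (x gchoose t) * diff0 t j)"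
    using step.hyps by (simp add: diff0_eq_0)
  also have "(\<Sum>t=1..j. of_nat (Suc t) * (x gchoose Suc t) * diff0 t j) = (\<Sum>t=1..Suc j. of_nat t * (x gchoose t) * diff0 (t - 1) j)"
  proof -
    have "(\<Sum>t=1..j. of_nat (Suc t) * (x gchoose Suc t) * diff0 t j) = (\<Sum>t=0..j. of_nat (Suc t) * (x gchoose Suc t) * diff0 t j)"
      by (simp add: sum.atLeast_Suc_atMost)
    also have "\<dots> = (\<Sum>t=Suc 0..Suc j. of_nat t * (x gchoose t) * diff0 (t - 1) j)"
      by (subst sum.shift_bounds_cl_Suc_ivl) simp
    finally show ?thesis by simp
  qed
  also have "(\<Sum>t=1..Suc j. of_nat t * (x gchoose t) * diff0 t j) + (\<Sum>t=1..Suc j. of_nat t * (x gchoose t) * diff0 (t - 1) j)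
     = (\<Sum>t=1..Suc j. (x gchoose t) * diff0 t (Suc j))"
    unfolding sum.distrib[symmetric] by (intro sum.cong) (auto simp: diff0_Suc algebra_simps)
  finally show ?case .
qed

lemma negative_binomial_sums:
  fixes q :: complex
  assumes "cmod q < 1"
  shows "(\<lambda>n. of_nat ((n + t) choose t) * q ^ n) sums (1 / (1 - q) ^ (t + 1))"
proof -
  have "(\<lambda>n. ((- of_nat (t + 1)) gchoose n) * (- q) ^ n) sums (1 + (- q)) powr (- of_nat (t + 1))"
    by (rule gen_binomial_complex) (use assms in simp)
  moreover have "((- of_nat (t + 1)) gchoose n) * (- q) ^ n = of_nat ((n + t) choose t) * q ^ n" for n
  proof -
    have "((- of_nat (t + 1) :: complex) gchoose n) = (-1) ^ n * ((of_nat n - (- of_nat (t + 1)) - 1) gchoose n)"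
      by (rule gbinomial_negated_upper)
    also have "(of_nat n - (- of_nat (t + 1)) - 1 :: complex) = of_nat (n + t)" by simp
    also have "(of_nat (n + t) gchoose n :: complex) = of_nat ((n + t) choose t)"
      by (metis add_diff_cancel_left' binomial_gbinomial binomial_symmetric le_add1)
    finally show ?thesis by (simp add: power_minus[of q])
  qed
  moreover have "(1 + (- q)) powr (- of_nat (t + 1)) = 1 / (1 - q) ^ (t + 1)"
  proof -
    have "1 - q \<noteq> 0" using assms by auto
    then have "(1 - q) powr of_nat (t + 1) = (1 - q) ^ (t + 1)" by (intro powr_nat') simp
    then show ?thesis by (simp add: powr_minus inverse_eq_divide del: of_nat_Suc of_nat_add)
  qed
  ultimately show ?thesis by simp
qed

text \<open>This is \<open>Li\<close> of order \<open>-i\<close>, except that for \<open>i = 0\<close> the sum has the additional term \<open>1\<close> at \<open>r = 0\<close>.\<close>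
definition polylog :: "nat \<Rightarrow> complex \<Rightarrow> complex" where
  "polylog i q = (\<Sum>r. of_nat r ^ i * q ^ r)"

lemma polylog_sums_diff0:
  assumes "cmod q < 1" "1 \<le> j"
  shows "(\<lambda>r. of_nat r ^ j * q ^ r) sums (\<Sum>t=1..j. q ^ t * diff0 t j / (1 - q) ^ (t + 1))"
proof -
  have "(\<lambda>r. of_nat (r choose t) * q ^ r) sums (q ^ t / (1 - q) ^ (t + 1))" for t
  proof -
    have "(\<lambda>r. q ^ t * (of_nat ((r + t) choose t) * q ^ r)) sums (q ^ t * (1 / (1 - q) ^ (t + 1)))"
      by (intro sums_mult negative_binomial_sums assms)
    then have "(\<lambda>r. of_nat ((r + t) choose t) * q ^ (r + t)) sums (q ^ t / (1 - q) ^ (t + 1))"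
      by (simp add: power_add mult_ac)
    then show ?thesis
      by (subst (asm) sums_zero_iff_shift) (auto simp: binomial_eq_0)
  qed
  then have "(\<lambda>r. \<Sum>t=1..j. diff0 t j * (of_nat (r choose t) * q ^ r)) sums (\<Sum>t=1..j. diff0 t j * (q ^ t / (1 - q) ^ (t + 1)))"
    by (intro sums_sum sums_mult)
  moreover have "(\<Sum>t=1..j. diff0 t j * (of_nat (r choose t) * q ^ r)) = of_nat r ^ j * q ^ r" for r
    unfolding power_eq_sum_gbinomial[OF assms(2)] binomial_gbinomial
    by (simp add: sum_distrib_right sum_distrib_left mult_ac)
  ultimately show ?thesis by (simp add: mult_ac)
qed

text \<open>Expanding (-r)^j instead of r^j in binomial coefficients gives a second closed form of
  the same series, the one with powers of q - 1.\<close>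

lemma polylog_sums_diff0_reflected:
  assumes "cmod q < 1" "1 \<le> j"
  shows "(\<lambda>r. of_nat r ^ j * q ^ r) sums ((-1) ^ (j + 1) * (\<Sum>t=1..j. q * diff0 t j / (q - 1) ^ (t + 1)))"
proof -
  have gb: "(- of_nat r gchoose t :: complex) = (-1) ^ t * (of_nat r + of_nat t - 1 gchoose t)" for r t :: nat
    by (subst gbinomial_negated_upper) (simp add: algebra_simps)
  have base: "(\<lambda>r. (- of_nat r gchoose t) * q ^ r) sums (- (q / (q - 1) ^ (t + 1)))" if t: "t \<ge> 1" for t
  proof -
    have "(\<lambda>r. (-1) ^ t * q * (of_nat ((r + t) choose t) * q ^ r)) sums ((-1) ^ t * q * (1 / (1 - q) ^ (t + 1)))"
      by (intro sums_mult negative_binomial_sums assms)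
    moreover have "(-1) ^ t * q * (of_nat ((r + t) choose t) * q ^ r) = (- of_nat (Suc r) gchoose t) * q ^ Suc r" for r
      unfolding gb binomial_gbinomial by (simp add: mult_ac add_ac)
    ultimately have "(\<lambda>r. (- of_nat (Suc r) gchoose t) * q ^ Suc r) sums ((-1) ^ t * q * (1 / (1 - q) ^ (t + 1)))"
      by simp
    moreover have "(- of_nat 0 gchoose t) * q ^ 0 = (0::complex)" using t by (simp add: gbinomial_0_left)
    ultimately have "(\<lambda>r. (- of_nat r gchoose t) * q ^ r) sums ((-1) ^ t * q * (1 / (1 - q) ^ (t + 1)))"
      using sums_Suc_iff[of "\<lambda>r. (- of_nat r gchoose t) * q ^ r" "(-1) ^ t * q * (1 / (1 - q) ^ (t + 1))"] by simp
    moreover have "(-1) ^ t * q * (1 / (1 - q) ^ (t + 1)) = - (q / (q - 1) ^ (t + 1))"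
    proof -
      have "(q - 1) ^ (t + 1) = (-1) ^ (t + 1) * (1 - q) ^ (t + 1)"
        unfolding power_mult_distrib[symmetric] by simp
      then show ?thesis by (cases "even t") (simp_all del: power_Suc)
    qed
    ultimately show ?thesis by simp
  qed
  then have "(\<lambda>r. (-1) ^ j * (\<Sum>t=1..j. diff0 t j * ((- of_nat r gchoose t) * q ^ r))) sums
     ((-1) ^ j * (\<Sum>t=1..j. diff0 t j * (- (q / (q - 1) ^ (t + 1)))))"
    by (intro sums_sum sums_mult) auto
  moreover have "(-1) ^ j * (\<Sum>t=1..j. diff0 t j * ((- of_nat r gchoose t) * q ^ r)) = of_nat r ^ j * q ^ r" for r
  proof -
    have "(\<Sum>t=1..j. diff0 t j * ((- of_nat r gchoose t) * q ^ r)) = (- of_nat r) ^ j * q ^ r"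
      unfolding power_eq_sum_gbinomial[OF assms(2), of "- of_nat r"]
      by (simp add: sum_distrib_right sum_distrib_left mult_ac)
    then show ?thesis by (simp add: power_minus[of "of_nat r"] flip: mult.assoc)
  qed
  moreover have "(-1) ^ j * (\<Sum>t=1..j. diff0 t j * (- (q / (q - 1) ^ (t + 1)))) = (-1) ^ (j + 1) * (\<Sum>t=1..j. q * diff0 t j / (q - 1) ^ (t + 1))"
    by (simp add: sum_negf sum_distrib_left mult_ac)
  ultimately show ?thesis by simp
qed

lemma polylog_0: "cmod q < 1 \<Longrightarrow> polylog 0 q = 1 / (1 - q)"
  using sums_unique[OF geometric_sums[of q]] by (simp add: polylog_def)

lemma polylog_sums: "cmod q < 1 \<Longrightarrow> (\<lambda>r. of_nat r ^ i * q ^ r) sums polylog i q"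
proof (cases "i = 0")
  case True
  assume "cmod q < 1"
  then show ?thesis using True geometric_sums[of q] by (simp add: polylog_0)
next
  case False
  assume "cmod q < 1"
  then show ?thesis
    unfolding polylog_def using polylog_sums_diff0[of q i] False by (intro summable_sums sums_summable) auto
qed

text \<open>These identities turn the sums over t in the linear system into polylogarithms; the two
  shapes differ only by a sign.\<close>

lemma polylog_eq_diff0:
  assumes "cmod q < 1" "1 \<le> j"
  shows "(\<Sum>t=1..j. q ^ t * diff0 t j / (1 - q) ^ (t + 1)) = polylog j q"
    and "(\<Sum>t=1..j. q * diff0 t j / (q - 1) ^ (t + 1)) = (-1) ^ (j + 1) * polylog j q"
proof -
  show "(\<Sum>t=1..j. q ^ t * diff0 t j / (1 - q) ^ (t + 1)) = polylog j q"
    using sums_unique2[OF polylog_sums_diff0[OF assms] polylog_sums[OF assms(1)]] .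
  have "(-1) ^ (j + 1) * (\<Sum>t=1..j. q * diff0 t j / (q - 1) ^ (t + 1)) = polylog j q"
    using sums_unique2[OF polylog_sums_diff0_reflected[OF assms] polylog_sums[OF assms(1)]] .
  then have "(-1) ^ (j + 1) * ((-1) ^ (j + 1) * (\<Sum>t=1..j. q * diff0 t j / (q - 1) ^ (t + 1))) = (-1) ^ (j + 1) * polylog j q"
    by simp
  then show "(\<Sum>t=1..j. q * diff0 t j / (q - 1) ^ (t + 1)) = (-1) ^ (j + 1) * polylog j q"
    by (simp add: mult.assoc[symmetric] power_mult_distrib[symmetric] del: power_Suc)
qed

text \<open>Stated without division by \<open>q\<close>, so that \<open>q = 0\<close> is included.
  The derivative there will give the constant term of the Euler-Frobenius polynomials.\<close>

lemma polylog_has_field_derivative: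
  assumes "cmod q < 1"
  shows "\<exists>d. (polylog i has_field_derivative d) (at q) \<and> q * d = polylog (Suc i) q \<and> (q = 0 \<longrightarrow> d = 1)"
proof -
  define c where "c n = (of_nat n ^ i :: complex)" for n :: nat
  have sm: "summable (\<lambda>n. c n * z ^ n)" if "cmod z < 1" for z
    unfolding c_def using polylog_sums[OF that] by (rule sums_summable)
  have "((\<lambda>z. \<Sum>n. c n * z ^ n) has_field_derivative (\<Sum>n. diffs c n * q ^ n)) (at q)"
    by (rule termdiffs_strong'[OF sm assms])
  moreover have "(\<lambda>z. \<Sum>n. c n * z ^ n) = polylog i" by (auto simp: c_def polylog_def)
  moreover have "q * (\<Sum>n. diffs c n * q ^ n) = polylog (Suc i) q"
  proof -
    have "summable (\<lambda>n. diffs c n * q ^ n)" by (rule termdiff_converges[OF assms sm])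
    then have "(\<lambda>n. q * (diffs c n * q ^ n)) sums (q * (\<Sum>n. diffs c n * q ^ n))"
      by (intro sums_mult summable_sums)
    moreover have "q * (diffs c n * q ^ n) = of_nat (Suc n) ^ Suc i * q ^ Suc n" for n
      by (simp add: diffs_def c_def mult_ac)
    ultimately have "(\<lambda>n. of_nat (Suc n) ^ Suc i * q ^ Suc n) sums (q * (\<Sum>n. diffs c n * q ^ n))" by simp
    then have "(\<lambda>n. of_nat n ^ Suc i * q ^ n) sums (q * (\<Sum>n. diffs c n * q ^ n))"
      using sums_Suc_iff[of "\<lambda>n. of_nat n ^ Suc i * q ^ n" "q * (\<Sum>n. diffs c n * q ^ n)"] by simp
    then show ?thesis using polylog_sums[OF assms, of "Suc i"] sums_unique2 by blast
  qed
  moreover have "q = 0 \<longrightarrow> (\<Sum>n. diffs c n * q ^ n) = 1"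
    using powser_zero[of "diffs c"] by (auto simp: diffs_def c_def)
  ultimately show ?thesis by metis
qed

section \<open>Euler-Frobenius polynomials and zeros of polylogarithms\<close>

lemma euler_operator_eq_polylog:
  "cmod z < 1 \<Longrightarrow> (((\<lambda>f z. z * deriv f z) ^^ k) (\<lambda>z. z / (1 - z)\<^sup>2)) z = polylog (Suc k) z"
proof (induction k arbitrary: z)
  case 0
  show ?case using polylog_eq_diff0(1)[OF 0, of 1] by (simp add: diff0_1 power2_eq_square)
next
  case (Suc k)
  let ?F = "((\<lambda>f z. z * deriv f z) ^^ k) (\<lambda>z::complex. z / (1 - z)\<^sup>2)"
  obtain d where d: "(polylog (Suc k) has_field_derivative d) (at z)" "z * d = polylog (Suc (Suc k)) z"
    using polylog_has_field_derivative[OF Suc.prems] by blast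
  have "eventually (\<lambda>y. y \<in> ball 0 1) (nhds z)"
    using Suc.prems by (intro eventually_nhds_in_open) auto
  then have "eventually (\<lambda>y. ?F y = polylog (Suc k) y) (nhds z)"
    by eventually_elim (use Suc.IH in auto)
  then have "deriv ?F z = deriv (polylog (Suc k)) z" by (intro deriv_cong_ev) auto
  then show ?case using d by (simp add: DERIV_imp_deriv)
qed

lemma euler_frobenius_polylog:
  assumes "cmod z < 1"
  shows "z * poly (euler_frobenius k) z = (1 - z) ^ (k + 2) * polylog (Suc k) z"
proof (cases "z = 0")
  case True
  have "polylog (Suc k) 0 = 0" unfolding polylog_def using powser_zero[of "\<lambda>r. of_nat r ^ Suc k"] by simp
  then show ?thesis using True by simp
next
  case False
  have "euler_frobenius_spec k (euler_frobenius k)"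
    unfolding euler_frobenius_def by (rule theI'[OF euler_frobenius_ex1])
  then show ?thesis
    using False assms euler_operator_eq_polylog[OF assms, of k] by (auto simp: euler_frobenius_spec_def)
qed

lemma euler_frobenius_root:
  assumes "cmod q < 1" "poly (euler_frobenius k) q = 0"
  shows "polylog (Suc k) q = 0" and "q \<noteq> 0"
proof -
  have "1 - q \<noteq> 0" using assms(1) by auto
  then show "polylog (Suc k) q = 0" using euler_frobenius_polylog[OF assms(1), of k] assms(2) by simp
  \<comment> \<open>The defining identity excludes 0. Differentiating both sides of
    \<open>euler_frobenius_polylog\<close> at 0 yields the constant term.\<close>
  have p0: "poly (euler_frobenius k) 0 = 1"
  proof -
    let ?p = "euler_frobenius k"
    obtain d where d: "(polylog (Suc k) has_field_derivative d) (at 0)" "d = 1"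
      using polylog_has_field_derivative[of 0 "Suc k"] by auto
    have l0: "polylog (Suc k) 0 = 0" unfolding polylog_def using powser_zero[of "\<lambda>r. of_nat r ^ Suc k"] by simp
    have "((\<lambda>z. (1 - z) ^ (k + 2) * polylog (Suc k) z) has_field_derivative 1) (at 0)"
      by (rule derivative_eq_intros d(1) refl)+ (simp add: l0 d(2))
    moreover have "eventually (\<lambda>y. y \<in> ball 0 1) (nhds (0::complex))"
      by (intro eventually_nhds_in_open) auto
    then have "eventually (\<lambda>z. z * poly ?p z = (1 - z) ^ (k + 2) * polylog (Suc k) z) (nhds 0)"
      by eventually_elim (use euler_frobenius_polylog in auto)
    ultimately have "((\<lambda>z. z * poly ?p z) has_field_derivative 1) (at 0)"
      by (subst DERIV_cong_ev[OF refl _ refl]) auto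
    moreover have "((\<lambda>z. z * poly ?p z) has_field_derivative (1 * poly ?p 0 + poly (pderiv ?p) 0 * 0)) (at 0)"
      by (intro DERIV_mult poly_DERIV DERIV_ident)
    ultimately show ?thesis using DERIV_unique by fastforce
  qed
  then show "q \<noteq> 0" using assms(2) by auto
qed

section \<open>Splines\<close>

text \<open>Coefficients are indexed from the leading one downwards, so that the derivatives of
  \<open>taylor_poly \<pi> n\<close> and \<open>spline \<pi> c N n\<close> have the same coefficients with \<open>n - 1\<close> in place of \<open>n\<close>.\<close>
definition taylor_poly :: "(nat \<Rightarrow> complex) \<Rightarrow> nat \<Rightarrow> real \<Rightarrow> complex" where
  "taylor_poly \<pi> n y = (\<Sum>l\<le>n. \<pi> l * of_real (y ^ (n - l) / fact (n - l)))"

text \<open>Normalized by the factorial, so that differentiation just lowers \<open>n\<close>. At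
  the knot the value is 0 also for n = 0.\<close>

definition trunc_pow :: "nat \<Rightarrow> real \<Rightarrow> real" where
  "trunc_pow n t = (if t > 0 then t ^ n / fact n else 0)"

definition spline :: "(nat \<Rightarrow> complex) \<Rightarrow> (nat \<Rightarrow> complex) \<Rightarrow> nat \<Rightarrow> nat \<Rightarrow> real \<Rightarrow> complex" where
  "spline \<pi> c N n y = taylor_poly \<pi> n y + (\<Sum>\<beta>\<in>{1..<N}. c \<beta> * of_real (trunc_pow n (y - real \<beta>)))"

lemma taylor_poly_0: "taylor_poly \<pi> n 0 = \<pi> n"
proof -
  have "taylor_poly \<pi> n 0 = (\<Sum>l\<le>n. if l = n then \<pi> n else 0)"
    unfolding taylor_poly_def by (intro sum.cong) (auto simp: power_0_left)
  then show ?thesis by simp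
qed

lemma spline_0: "spline \<pi> c N n 0 = \<pi> n"
  by (simp add: spline_def taylor_poly_0 trunc_pow_def)

lemma power_fact_has_derivative:
  "((\<lambda>y::real. y ^ Suc n / fact (Suc n)) has_real_derivative y ^ n / fact n) (at y within S)"
proof -
  have "((\<lambda>y::real. y ^ Suc n / fact (Suc n)) has_real_derivative (real (Suc n) * y ^ n * 1) / fact (Suc n)) (at y within S)"
    using DERIV_pow[of "Suc n" y S] by (intro DERIV_cdivide) simp
  moreover have "(real (Suc n) * y ^ n * 1) / fact (Suc n) = y ^ n / fact n"
    by (simp add: fact_Suc del: of_nat_Suc)
  ultimately show ?thesis by simp
qed

lemma taylor_poly_has_derivative:
  "(taylor_poly \<pi> (Suc n) has_vector_derivative taylor_poly \<pi> n y) (at y within S)"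
proof -
  have "((\<lambda>y. \<Sum>l\<le>Suc n. \<pi> l * of_real (y ^ (Suc n - l) / fact (Suc n - l))) has_vector_derivative
     (\<Sum>l\<le>Suc n. \<pi> l * of_real (if l = Suc n then 0 else y ^ (n - l) / fact (n - l)))) (at y within S)"
  proof (intro has_vector_derivative_sum has_vector_derivative_mult_right has_vector_derivative_of_real)
    fix l assume "l \<in> {..Suc n}"
    then consider "l = Suc n" | r where "Suc n - l = Suc r" "n - l = r" "l \<noteq> Suc n"
      by (auto simp: Suc_diff_le le_Suc_eq)
    then show "((\<lambda>y. y ^ (Suc n - l) / fact (Suc n - l)) has_real_derivative (if l = Suc n then 0 else y ^ (n - l) / fact (n - l))) (at y within S)"
      by cases (simp, simp only: if_False power_fact_has_derivative)
  qed
  moreover have "(\<Sum>l\<le>Suc n. \<pi> l * of_real (if l = Suc n then 0 else y ^ (n - l) / fact (n - l))) = taylor_poly \<pi> n y"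
  proof -
    have "(\<Sum>l\<le>Suc n. \<pi> l * of_real (if l = Suc n then 0 else y ^ (n - l) / fact (n - l)))
      = (\<Sum>l\<le>n. \<pi> l * of_real (if l = Suc n then 0 else y ^ (n - l) / fact (n - l)))" by simp
    also have "\<dots> = taylor_poly \<pi> n y" unfolding taylor_poly_def by (intro sum.cong) auto
    finally show ?thesis .
  qed
  ultimately show ?thesis unfolding taylor_poly_def by simp
qed

lemma trunc_pow_has_derivative:
  assumes n: "n \<ge> 1"
  shows "(trunc_pow (Suc n) has_real_derivative trunc_pow n y) (at y)"
proof -
  consider "y > 0" | "y < 0" | "y = 0" by linarith
  then show ?thesis
  proof cases
    case 1
    have "eventually (\<lambda>t. t \<in> {0<..}) (nhds y)" using 1 by (intro eventually_nhds_in_open) auto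
    then have "eventually (\<lambda>t. trunc_pow (Suc n) t = t ^ Suc n / fact (Suc n)) (nhds y)"
      by eventually_elim (auto simp: trunc_pow_def)
    moreover have "((\<lambda>y. y ^ Suc n / fact (Suc n)) has_real_derivative trunc_pow n y) (at y)"
      using power_fact_has_derivative[of n y UNIV] 1 by (simp add: trunc_pow_def)
    ultimately show ?thesis by (subst DERIV_cong_ev[OF refl _ refl]) auto
  next
    case 2
    have "eventually (\<lambda>t. t \<in> {..<0}) (nhds y)" using 2 by (intro eventually_nhds_in_open) auto
    then have "eventually (\<lambda>t. trunc_pow (Suc n) t = 0) (nhds y)"
      by eventually_elim (auto simp: trunc_pow_def)
    moreover have "((\<lambda>y. 0) has_real_derivative trunc_pow n y) (at y)"
      using 2 by (simp add: trunc_pow_def)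
    ultimately show ?thesis by (subst DERIV_cong_ev[OF refl _ refl]) auto
  next
    case 3
    have "((\<lambda>t. (trunc_pow (Suc n) t - trunc_pow (Suc n) 0) / (t - 0)) \<longlongrightarrow> 0) (at 0)"
    proof (rule Lim_null_comparison)
      show "((\<lambda>t. \<bar>t\<bar> ^ n) \<longlongrightarrow> 0) (at (0::real))"
        using n by (auto intro!: tendsto_eq_intros)
      have "norm ((trunc_pow (Suc n) t - trunc_pow (Suc n) 0) / (t - 0)) \<le> \<bar>t\<bar> ^ n" for t
      proof (cases "t > 0")
        case True
        have "t ^ n / fact (Suc n) \<le> t ^ n / 1" using True by (intro divide_left_mono) (auto simp del: fact_Suc)
        then show ?thesis using True by (simp add: trunc_pow_def abs_of_pos del: fact_Suc)
      qed (simp add: trunc_pow_def)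
      then show "eventually (\<lambda>t. norm ((trunc_pow (Suc n) t - trunc_pow (Suc n) 0) / (t - 0)) \<le> \<bar>t\<bar> ^ n) (at 0)"
        by simp
    qed
    then show ?thesis using 3 by (simp add: has_field_derivative_iff trunc_pow_def)
  qed
qed

text \<open>A spline of degree 1 has corners at its knots. The alternative in the hypothesis covers
  m = 1, where there are no roots, the knot coefficients are empty sums and the spline is a
  polynomial.\<close>

lemma spline_has_derivative:
  assumes "n \<ge> 1 \<or> (\<forall>\<beta>\<in>{1..<N}. c \<beta> = 0)"
  shows "(spline \<pi> c N (Suc n) has_vector_derivative spline \<pi> c N n y) (at y)"
proof -
  have "((\<lambda>y. c \<beta> * of_real (trunc_pow (Suc n) (y - real \<beta>))) has_vector_derivative c \<beta> * of_real (trunc_pow n (y - real \<beta>))) (at y)"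
    if \<beta>: "\<beta> \<in> {1..<N}" for \<beta>
  proof (cases "c \<beta> = 0")
    case False
    then have n: "n \<ge> 1" using assms \<beta> by auto
    have "(trunc_pow (Suc n) has_real_derivative trunc_pow n (y - real \<beta>)) (at (y - real \<beta>))"
      by (rule trunc_pow_has_derivative[OF n])
    then have "((\<lambda>y. trunc_pow (Suc n) (y + (- real \<beta>))) has_real_derivative trunc_pow n (y - real \<beta>)) (at y)"
      by (subst DERIV_shift[symmetric]) simp
    then show ?thesis
      by (intro has_vector_derivative_mult_right has_vector_derivative_of_real) simp
  qed simp
  then show ?thesis
    unfolding spline_def by (intro has_vector_derivative_add taylor_poly_has_derivative has_vector_derivative_sum)
qed

section \<open>Integration by parts against the exponential and a spline\<close>

lemma has_vector_derivative_rescale: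
  fixes V :: "real \<Rightarrow> complex"
  assumes "(V has_vector_derivative d) (at ((x - a) / h))"
  shows "((\<lambda>x. V ((x - a) / h)) has_vector_derivative (of_real (1 / h) * d)) (at x within S)"
proof -
  have "((\<lambda>x. (x - a) / h) has_real_derivative (1 - 0) / h) (at x within S)"
    by (intro DERIV_cdivide DERIV_diff DERIV_ident DERIV_const)
  then have "((\<lambda>x. (x - a) / h) has_vector_derivative 1 / h) (at x within S)"
    by (simp add: has_real_derivative_iff_has_vector_derivative)
  from vector_diff_chain_within[OF this, of V d] show ?thesis
    using has_vector_derivative_at_within[OF assms] by (simp add: o_def scaleR_conv_of_real)
qed

lemma wave_has_derivative:
  "(wave \<omega> has_vector_derivative (2 * of_real pi * \<i> * of_real \<omega>) * wave \<omega> x) (at x within S)"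
proof -
  have "((\<lambda>z. exp (2 * of_real pi * \<i> * of_real \<omega> * z)) has_field_derivative
     (2 * of_real pi * \<i> * of_real \<omega>) * exp (2 * of_real pi * \<i> * of_real \<omega> * of_real x)) (at (of_real x))"
    by (auto intro!: derivative_eq_intros)
  from has_vector_derivative_real_field[OF this] show ?thesis by (simp add: wave_def[abs_def])
qed

lemma wave_mult_period:
  assumes "\<omega> * h \<in> \<int>"
  shows "wave \<omega> (h * real n + a) = wave \<omega> a"
proof -
  obtain k where k: "\<omega> * h = of_int k" using assms by (elim Ints_cases)
  have "2 * of_real pi * \<i> * of_real \<omega> * of_real (h * real n + a)
    = 2 * of_real pi * \<i> * of_real \<omega> * of_real a + 2 * of_real pi * \<i> * of_real ((\<omega> * h) * real n)"
    by (simp add: algebra_simps)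
  also have "of_real ((\<omega> * h) * real n) = of_int (k * int n)" unfolding k by simp
  finally have eq: "2 * of_real pi * \<i> * of_real \<omega> * of_real (h * real n + a)
    = 2 * of_real pi * \<i> * of_real \<omega> * of_real a + 2 * of_real pi * \<i> * of_int (k * int n)" by simp
  have "exp (2 * of_real pi * \<i> * of_int (k * int n)) = (1::complex)"
    using exp_integer_2pi[of "of_int (k * int n)"] by (simp add: mult_ac)
  then show ?thesis
    unfolding wave_def eq exp_add by simp
qed

text \<open>The powers of h absorb the inner derivative of (x - c) / h. The polynomial has degree m
  - 1, so the m-th entry of the chain is 0 and integration by parts leaves boundary terms
  only.\<close>

lemma taylor_poly_has_derivs_on:
  assumes h: "h \<noteq> 0"
  shows "has_derivs_on m c b (\<lambda>i x. if i < m then of_real (h ^ (m - i)) * taylor_poly \<pi> (m - 1 - i) ((x - c) / h) else 0)"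
  unfolding has_derivs_on_def
proof (intro conjI allI impI ballI)
  fix i x assume i: "i < m" and "x \<in> {c..b}"
  have d: "((\<lambda>x. of_real (h ^ (m - i)) * taylor_poly \<pi> (m - 1 - i) ((x - c) / h)) has_vector_derivative
      of_real (h ^ (m - i)) * (of_real (1 / h) * (if Suc i < m then taylor_poly \<pi> (m - 1 - Suc i) ((x - c) / h) else 0))) (at x within {c..b})"
  proof (intro has_vector_derivative_mult_right has_vector_derivative_rescale)
    show "(taylor_poly \<pi> (m - 1 - i) has_vector_derivative (if Suc i < m then taylor_poly \<pi> (m - 1 - Suc i) ((x - c) / h) else 0)) (at ((x - c) / h))"
    proof (cases "Suc i < m")
      case True
      then have "m - 1 - i = Suc (m - 1 - Suc i)" by simp
      then show ?thesis using taylor_poly_has_derivative[of \<pi> "m - 1 - Suc i"] True by simp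
    next
      case False
      then have "m - 1 - i = 0" by simp
      then show ?thesis using False by (simp add: taylor_poly_def[abs_def])
    qed
  qed
  have "of_real (h ^ (m - i)) * (of_real (1 / h) * (if Suc i < m then taylor_poly \<pi> (m - 1 - Suc i) ((x - c) / h) else 0))
     = (if Suc i < m then of_real (h ^ (m - Suc i)) * taylor_poly \<pi> (m - 1 - Suc i) ((x - c) / h) else 0)"
  proof -
    have "m - i = Suc (m - Suc i)" using i by simp
    then have "h ^ (m - i) * (1 / h) = h ^ (m - Suc i)" using h by simp
    then have "of_real (h ^ (m - i)) * of_real (1 / h) = (of_real (h ^ (m - Suc i)) :: complex)"
      by (simp only: of_real_mult[symmetric])
    then show ?thesis unfolding mult.assoc[symmetric] by simp
  qed
  then show "((\<lambda>x. if i < m then of_real (h ^ (m - i)) * taylor_poly \<pi> (m - 1 - i) ((x - c) / h) else 0) has_vector_derivative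
        (if Suc i < m then of_real (h ^ (m - Suc i)) * taylor_poly \<pi> (m - 1 - Suc i) ((x - c) / h) else 0)) (at x within {c..b})"
    using d i by simp
qed simp

text \<open>Exponential, polynomial and truncated powers are integrated by parts separately, each
  truncated power from its own knot on, where it leaves the value of \<open>f\<close> at that knot.
  At the ends, the terms with derivatives of \<open>f\<close> cancel by \<open>left\<close> and
  \<open>right\<close>, and the terms with \<open>f\<close> itself are collected in
  \<open>C 0\<close> and \<open>C N\<close>.\<close>

lemma spline_by_parts:
  fixes a b h \<omega> :: real and e w p :: complex
  assumes m: "m \<ge> 1" and N: "N \<ge> 1" and ab: "a < b" and h: "h = (b - a) / real N" and \<omega>: "\<omega> \<noteq> 0"
    and p: "p = 2 * of_real pi * \<i> * of_real \<omega> * of_real h"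
    and w: "wave \<omega> a = w" "wave \<omega> b = w"
    and left: "\<And>i. i \<in> {1..m - 1} \<Longrightarrow> spline \<pi> c N i 0 = e * w / p ^ (i + 1)"
    and right: "\<And>i. i \<in> {1..m - 1} \<Longrightarrow> spline \<pi> c N i (real N) = e * w / p ^ (i + 1)"
    and C: "C 0 = of_real h * (- (e * w / p) + spline \<pi> c N 0 0)"
      "C N = of_real h * (e * w / p - spline \<pi> c N 0 (real N))"
      "\<And>\<beta>. \<beta> \<in> {1..<N} \<Longrightarrow> C \<beta> = of_real h * c \<beta>"
    and f: "f \<in> sobolev_space m a b"
  shows "((\<lambda>x. ((-1) ^ m * of_real (h ^ m) * (e * wave \<omega> x / p ^ m - spline \<pi> c N (m - 1) ((x - a) / h))) * nth_deriv_on a b m f x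
       - e * (wave \<omega> x * f x)) has_integral - (\<Sum>\<beta>=0..N. C \<beta> * f (h * real \<beta> + a))) {a..b}"
proof -
  let ?f = "\<lambda>i. nth_deriv_on a b i f"
  let ?V = "spline \<pi> c N"
  have h0: "h > 0" using ab N h by simp
  have p0: "p \<noteq> 0" using h0 \<omega> p by simp
  have bN: "(b - a) / h = real N" using h h0 N ab by (simp add: field_simps)
  define X where "X \<beta> = h * real \<beta> + a" for \<beta>
  have X: "a \<le> X \<beta>" "X \<beta> \<le> b" if "\<beta> \<le> N" for \<beta>
  proof -
    have "h * real \<beta> \<le> h * real N" using that h0 by simp
    also have "h * real N = b - a" using h N by simp
    finally show "X \<beta> \<le> b" "a \<le> X \<beta>" using h0 by (auto simp: X_def)
  qed
  have bX: "(b - X \<beta>) / h = real N - real \<beta>" for \<beta>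
  proof -
    have "(b - X \<beta>) / h = (b - a) / h - real \<beta>" using h0 by (simp add: X_def field_simps)
    then show ?thesis using bN by simp
  qed
  \<comment> \<open>The index i counts integrations by parts: it goes with the derivative of order m
    - 1 - i of \<open>f\<close> and with the spline of degree m - 1 - i. \<open>V1\<close>,
    \<open>V2\<close> and \<open>V3\<close> are the contributions of exponential, polynomial and one
    truncated power at \<open>a\<close> and \<open>b\<close>.\<close>
  define s where "s i = (-1) ^ i * complex_of_real (h ^ (m - i))" for i
  define fa where "fa i = ?f (m - 1 - i) a" for i
  define fb where "fb i = ?f (m - 1 - i) b" for i
  define V1 where "V1 = (\<Sum>i<m. s i * (w / p ^ (m - i) * fb i - w / p ^ (m - i) * fa i))"
  define V2 where "V2 = (\<Sum>i<m. s i * (taylor_poly \<pi> (m - 1 - i) (real N) * fb i - \<pi> (m - 1 - i) * fa i))"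
  define V3 where "V3 \<beta> = (\<Sum>i<m. s i * (of_real (trunc_pow (m - 1 - i) (real N - real \<beta>)) * fb i))" for \<beta>
  have T1: "((\<lambda>x. (of_real h / p) ^ m * wave \<omega> x * ?f m x - (-1) ^ m * (wave \<omega> x * f x)) has_integral V1) {a..b}"
  proof -
    define \<Omega> where "\<Omega> = 2 * of_real pi * \<i> * complex_of_real \<omega>"
    define r where "r = of_real h / p"
    have r\<Omega>: "r * \<Omega> = 1" using p0 p by (simp add: r_def \<Omega>_def field_simps)
    have "has_derivs_on m a b (\<lambda>i x. r ^ (m - i) * wave \<omega> x)"
      unfolding has_derivs_on_def
    proof (intro conjI allI impI ballI)
      fix i x assume i: "i < m"
      have "((\<lambda>x. r ^ (m - i) * wave \<omega> x) has_vector_derivative r ^ (m - i) * (\<Omega> * wave \<omega> x)) (at x within {a..b})"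
        unfolding \<Omega>_def by (intro has_vector_derivative_mult_right wave_has_derivative)
      moreover have "r ^ (m - i) * (\<Omega> * wave \<omega> x) = (r * \<Omega>) * (r ^ (m - Suc i) * wave \<omega> x)"
      proof -
        have "m - i = Suc (m - Suc i)" using i by simp
        then show ?thesis by simp
      qed
      ultimately show "((\<lambda>x. r ^ (m - i) * wave \<omega> x) has_vector_derivative r ^ (m - Suc i) * wave \<omega> x) (at x within {a..b})"
        by (simp add: r\<Omega>)
    qed (auto intro!: continuous_intros)
    from sobolev_by_parts[OF f ab m order_refl less_imp_le[OF ab] this] show ?thesis
      by (simp add: w r_def V1_def s_def fa_def fb_def power_divide algebra_simps)
  qed
  have T2: "((\<lambda>x. of_real (h ^ m) * taylor_poly \<pi> (m - 1) ((x - a) / h) * ?f m x) has_integral V2) {a..b}"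
  proof -
    have "h \<noteq> 0" using h0 by simp
    from sobolev_by_parts[OF f ab m order_refl less_imp_le[OF ab] taylor_poly_has_derivs_on[OF this]]
    show ?thesis using m by (simp add: bN taylor_poly_0 V2_def s_def fa_def fb_def algebra_simps cong: sum.cong_simp)
  qed
  have T3: "((\<lambda>x. of_real (h ^ m) * of_real (trunc_pow (m - 1) ((x - a) / h - real \<beta>)) * ?f m x) has_integral
     V3 \<beta> - (-1) ^ (m - 1) * of_real h * f (X \<beta>)) {a..b}" (is "(?t has_integral ?v) _") if \<beta>: "\<beta> \<in> {1..<N}" for \<beta>
  proof -
    \<comment> \<open>The single power y^n / n! as a Taylor polynomial: leading coefficient 1, all
      others 0.\<close>
    define \<pi>1 where "\<pi>1 l = (if l = 0 then 1 else 0 :: complex)" for l :: nat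
    have tp: "taylor_poly \<pi>1 n y = of_real (y ^ n / fact n)" for n y
    proof -
      have "taylor_poly \<pi>1 n y = (\<Sum>l\<le>n. if l = 0 then of_real (y ^ n / fact n) else 0)"
        unfolding taylor_poly_def \<pi>1_def by (intro sum.cong) auto
      then show ?thesis by simp
    qed
    have Xb: "a \<le> X \<beta>" "X \<beta> \<le> b" using X[of \<beta>] \<beta> by auto
    have "h \<noteq> 0" using h0 by simp
    have "((\<lambda>x. of_real (h ^ m) * taylor_poly \<pi>1 (m - 1) ((x - X \<beta>) / h) * ?f m x) has_integral
     (\<Sum>i<m. (-1) ^ i * (of_real (h ^ (m - i)) * taylor_poly \<pi>1 (m - 1 - i) (real N - real \<beta>) * fb i
        - of_real (h ^ (m - i)) * \<pi>1 (m - 1 - i) * ?f (m - 1 - i) (X \<beta>)))) {X \<beta>..b}"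
      using sobolev_by_parts[OF f ab m Xb taylor_poly_has_derivs_on[OF \<open>h \<noteq> 0\<close>], of \<pi>1] m
      by (simp add: bX taylor_poly_0 fb_def cong: sum.cong_simp)
    \<comment> \<open>At the knot all positive powers vanish; only the constant one, i = m - 1,
      leaves a term, and it multiplies \<open>f\<close> itself.\<close>
    also have "(\<Sum>i<m. (-1) ^ i * (of_real (h ^ (m - i)) * taylor_poly \<pi>1 (m - 1 - i) (real N - real \<beta>) * fb i
        - of_real (h ^ (m - i)) * \<pi>1 (m - 1 - i) * ?f (m - 1 - i) (X \<beta>)))
      = V3 \<beta> - (\<Sum>i<m. if i = m - 1 then (-1) ^ (m - 1) * of_real h * f (X \<beta>) else 0)"
      unfolding V3_def sum_subtractf[symmetric]
      using \<beta> by (intro sum.cong) (auto simp: tp trunc_pow_def \<pi>1_def s_def algebra_simps)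
    also have "(\<Sum>i<m. if i = m - 1 then (-1) ^ (m - 1) * of_real h * f (X \<beta>) else 0) = (-1) ^ (m - 1) * of_real h * f (X \<beta>)"
      using m by simp
    finally have "((\<lambda>x. of_real (h ^ m) * taylor_poly \<pi>1 (m - 1) ((x - X \<beta>) / h) * ?f m x) has_integral ?v) {X \<beta>..b}" .
    moreover have pos: "(x - a) / h - real \<beta> = (x - X \<beta>) / h" for x
      using h0 by (simp add: X_def field_simps)
    \<comment> \<open>For m = 1 truncated and full power differ at the knot, where the former is 0
      and the latter is 1; a single point does not affect the integral.\<close>
    ultimately have I1: "(?t has_integral ?v) {X \<beta>..b}"
      by (rule_tac has_integral_spike_finite[of "{X \<beta>}", rotated 2]) (use h0 in \<open>auto simp: trunc_pow_def tp\<close>)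
    have I2: "(?t has_integral 0) {a..X \<beta>}"
    proof (rule has_integral_is_0)
      fix x assume "x \<in> {a..X \<beta>}"
      then have "\<not> (x - X \<beta>) / h > 0" using h0 by (simp add: zero_less_divide_iff)
      then show "?t x = 0" unfolding pos trunc_pow_def by simp
    qed
    show ?thesis using has_integral_combine[OF Xb I2 I1] by (simp only: add_0_left)
  qed
  let ?g = "\<lambda>x. (-1) ^ m * (e * ((of_real h / p) ^ m * wave \<omega> x * ?f m x - (-1) ^ m * (wave \<omega> x * f x))
      - of_real (h ^ m) * taylor_poly \<pi> (m - 1) ((x - a) / h) * ?f m x
      - (\<Sum>\<beta>\<in>{1..<N}. c \<beta> * (of_real (h ^ m) * of_real (trunc_pow (m - 1) ((x - a) / h - real \<beta>)) * ?f m x)))"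
  let ?S = "\<Sum>\<beta>\<in>{1..<N}. of_real h * c \<beta> * f (X \<beta>)"
  have total: "(?g has_integral (-1) ^ m * (e * V1 - V2
      - (\<Sum>\<beta>\<in>{1..<N}. c \<beta> * (V3 \<beta> - (-1) ^ (m - 1) * of_real h * f (X \<beta>))))) {a..b}"
    by (intro has_integral_mult_right has_integral_diff has_integral_sum T1 T2 T3) auto
  have fun_eq: "?g x = ((-1) ^ m * of_real (h ^ m) * (e * wave \<omega> x / p ^ m - ?V (m - 1) ((x - a) / h))) * ?f m x - e * (wave \<omega> x * f x)" for x
  proof -
    have "(\<Sum>\<beta>\<in>{1..<N}. c \<beta> * (of_real (h ^ m) * of_real (trunc_pow (m - 1) ((x - a) / h - real \<beta>)) * ?f m x))
      = of_real (h ^ m) * (\<Sum>\<beta>\<in>{1..<N}. c \<beta> * of_real (trunc_pow (m - 1) ((x - a) / h - real \<beta>))) * ?f m x"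
      by (simp add: sum_distrib_left sum_distrib_right mult_ac)
    moreover have "(-1) ^ m * ((-1) ^ m * z) = z" for z :: complex
      by (simp add: mult.assoc[symmetric] power_mult_distrib[symmetric])
    ultimately show ?thesis
      unfolding spline_def by (simp add: power_divide algebra_simps)
  qed
  let ?B = "\<lambda>i. (e * w / p ^ (m - i) - ?V (m - 1 - i) (real N)) * fb i - (e * w / p ^ (m - i) - ?V (m - 1 - i) 0) * fa i"
  have "(\<Sum>\<beta>\<in>{1..<N}. c \<beta> * (V3 \<beta> - (-1) ^ (m - 1) * of_real h * f (X \<beta>)))
      = (\<Sum>\<beta>\<in>{1..<N}. c \<beta> * V3 \<beta>) - (-1) ^ (m - 1) * ?S"
    by (simp add: right_diff_distrib sum_subtractf sum_distrib_left mult_ac)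
  moreover have "(\<Sum>\<beta>\<in>{1..<N}. c \<beta> * V3 \<beta>)
      = (\<Sum>i<m. s i * ((\<Sum>\<beta>\<in>{1..<N}. c \<beta> * of_real (trunc_pow (m - 1 - i) (real N - real \<beta>))) * fb i))"
    unfolding V3_def sum_distrib_left sum_distrib_right by (subst sum.swap) (simp add: mult_ac)
  moreover have "e * V1 - V2 - (\<Sum>i<m. s i * ((\<Sum>\<beta>\<in>{1..<N}. c \<beta> * of_real (trunc_pow (m - 1 - i) (real N - real \<beta>))) * fb i))
      = (\<Sum>i<m. s i * ?B i)"
    unfolding V1_def V2_def sum_distrib_left[of e] sum_subtractf[symmetric] spline_0
    unfolding spline_def by (intro sum.cong refl) (simp add: algebra_simps)
  ultimately have "e * V1 - V2 - (\<Sum>\<beta>\<in>{1..<N}. c \<beta> * (V3 \<beta> - (-1) ^ (m - 1) * of_real h * f (X \<beta>)))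
      = (\<Sum>i<m. s i * ?B i) + (-1) ^ (m - 1) * ?S"
    by (simp add: algebra_simps)
  also have "(\<Sum>i<m. s i * ?B i) = (\<Sum>i<m. if i = m - 1 then (-1) ^ (m - 1) * (C N * f b + C 0 * f a) else 0)"
  proof (intro sum.cong refl)
    fix i assume i: "i \<in> {..<m}"
    show "s i * ?B i = (if i = m - 1 then (-1) ^ (m - 1) * (C N * f b + C 0 * f a) else 0)"
    proof (cases "i = m - 1")
      case True
      then have "m - i = 1" "m - 1 - i = 0" using m by auto
      then show ?thesis using True unfolding C(1,2) by (simp add: s_def fa_def fb_def algebra_simps)
    next
      case False
      then have "m - 1 - i \<in> {1..m - 1}" "m - 1 - i + 1 = m - i" using i by auto
      then show ?thesis using False left[of "m - 1 - i"] right[of "m - 1 - i"] by simp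
    qed
  qed
  also have "\<dots> = (-1) ^ (m - 1) * (C N * f b + C 0 * f a)" using m by simp
  also have "\<dots> + (-1) ^ (m - 1) * ?S = (-1) ^ (m - 1) * (\<Sum>\<beta>=0..N. C \<beta> * f (X \<beta>))"
  proof -
    have "{0..N} = insert 0 (insert N {1..<N})" using N by auto
    then have "(\<Sum>\<beta>=0..N. C \<beta> * f (X \<beta>)) = C 0 * f (X 0) + (C N * f (X N) + (\<Sum>\<beta>\<in>{1..<N}. C \<beta> * f (X \<beta>)))"
      using N by simp
    moreover have "X 0 = a" "X N = b" using h N by (auto simp: X_def)
    moreover have "(\<Sum>\<beta>\<in>{1..<N}. C \<beta> * f (X \<beta>)) = ?S"
      by (intro sum.cong) (auto simp: C(3))
    ultimately show ?thesis by (simp add: algebra_simps)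
  qed
  finally have "(?g has_integral (-1) ^ m * ((-1) ^ (m - 1) * (\<Sum>\<beta>=0..N. C \<beta> * f (X \<beta>)))) {a..b}"
    using total by (simp only:)
  moreover have "(-1) ^ m * (-1) ^ (m - 1) = (-1 :: complex)" using m by (cases m) (auto simp: power_mult_distrib[symmetric])
  then have "(-1) ^ m * ((-1) ^ (m - 1) * (\<Sum>\<beta>=0..N. C \<beta> * f (X \<beta>))) = - (\<Sum>\<beta>=0..N. C \<beta> * f (X \<beta>))"
    by (metis mult.assoc mult_minus1)
  ultimately show ?thesis unfolding fun_eq X_def by simp
qed

lemma spline_continuous:
  assumes "n \<ge> 1 \<or> (\<forall>\<beta>\<in>{1..<N}. c \<beta> = 0)"
  shows "continuous_on S (\<lambda>x. spline \<pi> c N n ((x - a) / h))"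
proof -
  have "continuous_on S (\<lambda>x. c \<beta> * complex_of_real (trunc_pow n ((x - a) / h - real \<beta>)))" if \<beta>: "\<beta> \<in> {1..<N}" for \<beta>
  proof (cases "c \<beta> = 0")
    case False
    then have n: "n \<ge> 1" using assms \<beta> by auto
    then have "trunc_pow n = (\<lambda>t. max t 0 ^ n / fact n)"
      by (intro ext) (auto simp: trunc_pow_def max_def)
    then show ?thesis by (auto intro!: continuous_intros simp: divide_inverse)
  qed simp
  moreover have "continuous_on S (\<lambda>x. taylor_poly \<pi> n ((x - a) / h))"
    unfolding taylor_poly_def by (auto intro!: continuous_intros simp: divide_inverse)
  ultimately show ?thesis
    unfolding spline_def by (intro continuous_on_add continuous_on_sum)
qed

text \<open>Each differentiation in x lowers the exponents of h and p and the degree of the spline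
  by one, so the m-th entry of the chain is exactly the kernel of \<open>spline_by_parts\<close>.
  This exhibits the kernel as an m-th derivative.\<close>

lemma spline_has_derivs_on:
  assumes h: "h \<noteq> 0" and p: "p = 2 * of_real pi * \<i> * of_real \<omega> * of_real h" "p \<noteq> 0" and m: "m \<ge> 1"
    and c: "m \<ge> 2 \<or> (\<forall>\<beta>\<in>{1..<N}. c \<beta> = 0)"
  shows "has_derivs_on m a b (\<lambda>i x. (-1) ^ m * of_real (h ^ (2 * m - i)) *
      (e * wave \<omega> x / p ^ (2 * m - i) - spline \<pi> c N (2 * m - 1 - i) ((x - a) / h)))" (is "has_derivs_on m a b ?D")
proof -
  have d: "(?D i has_vector_derivative ?D (Suc i) x) (at x within S)" if i: "i < m" for i x S
  proof -
    define \<Omega> where "\<Omega> = 2 * of_real pi * \<i> * complex_of_real \<omega>"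
    define k where "k = 2 * m - Suc i"
    have k: "2 * m - i = Suc k" "2 * m - 1 - i = Suc (k - 1)" "2 * m - 1 - Suc i = k - 1" "2 * m - Suc i = k"
      using i by (auto simp: k_def)
    have kc: "k - 1 \<ge> 1 \<or> (\<forall>\<beta>\<in>{1..<N}. c \<beta> = 0)" using c i by (auto simp: k_def)
    have "((\<lambda>x. (-1) ^ m * of_real (h ^ Suc k) * (e / p ^ Suc k * wave \<omega> x - spline \<pi> c N (Suc (k - 1)) ((x - a) / h)))
       has_vector_derivative (-1) ^ m * of_real (h ^ Suc k) * (e / p ^ Suc k * (\<Omega> * wave \<omega> x) - of_real (1 / h) * spline \<pi> c N (k - 1) ((x - a) / h))) (at x within S)"
      unfolding \<Omega>_def
      by (intro has_vector_derivative_mult_right has_vector_derivative_diff wave_has_derivative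
          has_vector_derivative_rescale spline_has_derivative kc)
    moreover have "(-1) ^ m * of_real (h ^ Suc k) * (e / p ^ Suc k * (\<Omega> * wave \<omega> x) - of_real (1 / h) * spline \<pi> c N (k - 1) ((x - a) / h))
      = (-1) ^ m * of_real (h ^ k) * (e * wave \<omega> x / p ^ k - spline \<pi> c N (k - 1) ((x - a) / h))"
    proof -
      have "of_real h * \<Omega> = p" using p by (simp add: \<Omega>_def mult_ac)
      then have "of_real h * (e / p ^ Suc k * (\<Omega> * wave \<omega> x)) = e * wave \<omega> x / p ^ k"
        using p(2) by (simp add: field_simps)
      moreover have "of_real h * (of_real (1 / h) * z) = z" for z :: complex using h by simp
      ultimately have "of_real h * (e / p ^ Suc k * (\<Omega> * wave \<omega> x) - of_real (1 / h) * spline \<pi> c N (k - 1) ((x - a) / h))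
        = e * wave \<omega> x / p ^ k - spline \<pi> c N (k - 1) ((x - a) / h)"
        by (simp only: right_diff_distrib)
      moreover have "(-1) ^ m * of_real (h ^ Suc k) * z = (-1) ^ m * of_real (h ^ k) * (of_real h * z)" for z :: complex
        by (simp add: mult_ac)
      ultimately show ?thesis by (simp only:)
    qed
    ultimately show ?thesis unfolding k by (simp only: times_divide_eq_left)
  qed
  show ?thesis
    unfolding has_derivs_on_def
  proof (intro conjI allI impI ballI d)
    have "m - 1 \<ge> 1 \<or> (\<forall>\<beta>\<in>{1..<N}. c \<beta> = 0)" using c by auto
    then show "continuous_on {a..b} (?D m)"
      using p(2) m by (auto intro!: continuous_intros spline_continuous simp: mult_2)
  qed
qed

section \<open>Natural splines that vanish at all nodes\<close>

lemma taylor_poly_eq_0: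
  assumes S: "finite S" "card S > n" and z: "\<And>y. y \<in> S \<Longrightarrow> taylor_poly \<pi> n y = 0"
  shows "l \<le> n \<Longrightarrow> \<pi> l = 0"
proof -
  assume l: "l \<le> n"
  define Q where "Q = (\<Sum>l\<le>n. monom (\<pi> l / fact (n - l)) (n - l))"
  have Qv: "poly Q (of_real y) = taylor_poly \<pi> n y" for y
    unfolding Q_def taylor_poly_def by (simp add: poly_sum poly_monom)
  have "degree Q \<le> n"
    unfolding Q_def by (intro degree_sum_le) (auto intro: order_trans[OF degree_monom_le])
  have "Q = 0"
  proof (rule ccontr)
    assume Q: "Q \<noteq> 0"
    have "card S = card (complex_of_real ` S)" by (rule card_image[symmetric]) (simp add: inj_on_def)
    also have "\<dots> \<le> card {x. poly Q x = 0}"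
      using poly_roots_finite[OF Q] z by (intro card_mono) (auto simp: Qv)
    also have "\<dots> \<le> degree Q" by (rule card_poly_roots_bound[OF Q])
    finally show False using S(2) \<open>degree Q \<le> n\<close> by linarith
  qed
  have "coeff Q (n - l) = (\<Sum>k\<le>n. if k = l then \<pi> k / fact (n - k) else 0)"
    unfolding Q_def coeff_sum using l by (intro sum.cong) (auto simp: coeff_monom)
  then show "\<pi> l = 0" using \<open>Q = 0\<close> l by simp
qed

lemma spline_node:
  assumes "n \<le> N"
  shows "spline \<pi> c N i (real n) = taylor_poly \<pi> i (real n) + (\<Sum>\<beta>\<in>{1..<n}. c \<beta> * of_real ((real n - real \<beta>) ^ i / fact i))"
proof -
  have "(\<Sum>\<beta>\<in>{1..<N}. c \<beta> * of_real (trunc_pow i (real n - real \<beta>))) = (\<Sum>\<beta>\<in>{1..<n}. c \<beta> * of_real ((real n - real \<beta>) ^ i / fact i))"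
    using assms by (intro sum.mono_neutral_cong_right) (auto simp: trunc_pow_def)
  then show ?thesis by (simp add: spline_def)
qed

text \<open>The conditions are triangular: at node \<beta> + 1 the knot \<beta> enters with the
  factor 1 / i!, and no later knot is active.\<close>

lemma sum_power_nodes_eq_0:
  fixes c :: "nat \<Rightarrow> complex"
  assumes z: "\<And>n. 1 \<le> n \<Longrightarrow> n \<le> N \<Longrightarrow> (\<Sum>\<beta>\<in>{1..<n}. c \<beta> * of_real ((real n - real \<beta>) ^ i / fact i)) = 0"
  shows "\<beta> \<in> {1..<N} \<Longrightarrow> c \<beta> = 0"
proof (induction \<beta> rule: less_induct)
  case (less \<beta>)
  have "{1..<Suc \<beta>} = insert \<beta> {1..<\<beta>}" using less.prems by auto
  then have "0 = c \<beta> * of_real ((real (Suc \<beta>) - real \<beta>) ^ i / fact i) + (\<Sum>\<gamma>\<in>{1..<\<beta>}. c \<gamma> * of_real ((real (Suc \<beta>) - real \<gamma>) ^ i / fact i))"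
    using z[of "Suc \<beta>"] less.prems by simp
  moreover have "(\<Sum>\<gamma>\<in>{1..<\<beta>}. c \<gamma> * of_real ((real (Suc \<beta>) - real \<gamma>) ^ i / fact i)) = 0"
    using less by (intro sum.neutral) auto
  ultimately show ?case by simp
qed

text \<open>By integration by parts the \<open>m\<close>-th derivative of such a spline is orthogonal to itself.\<close>
lemma natural_null_spline_eq_0:
  assumes m: "m \<ge> 2" and N: "N \<ge> 1" "N + 1 \<ge> m"
    and left: "\<And>i. i \<in> {1..m - 1} \<Longrightarrow> \<pi> i = 0"
    and right: "\<And>i. i \<in> {1..m - 1} \<Longrightarrow> spline \<pi> c N i (real N) = 0"
    and null: "\<And>\<beta>. \<beta> \<le> N \<Longrightarrow> spline \<pi> c N (2 * m - 1) (real \<beta>) = 0"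
  shows "i \<le> 2 * m - 1 \<Longrightarrow> \<pi> i = 0" and "\<beta> \<in> {1..<N} \<Longrightarrow> c \<beta> = 0"
proof -
  let ?V = "spline \<pi> c N"
  \<comment> \<open>The exponential is switched off by e = 0, so \<omega> = h = 1 is just an
    admissible choice.\<close>
  define p where "p = 2 * of_real pi * \<i> * of_real 1 * complex_of_real 1"
  have p0: "p \<noteq> 0" by (simp add: p_def)
  define D where "D i x = (-1) ^ m * of_real (1 ^ (2 * m - i)) *
      (0 * wave 1 x / p ^ (2 * m - i) - ?V (2 * m - 1 - i) ((x - 0) / 1))" for i x
  have D: "has_derivs_on m 0 (real N) D"
    unfolding D_def using m by (intro spline_has_derivs_on[where p = p]) (auto simp: p0, simp add: p_def)
  have Deq: "D i x = - ((-1) ^ m * ?V (2 * m - 1 - i) x)" for i x by (simp add: D_def)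
  have cD: "has_derivs_on m 0 (real N) (\<lambda>i x. cnj (D i x))" by (rule has_derivs_on_cnj[OF D])
  have N0: "0 < real N" and m1: "m \<ge> 1" using N m by auto
  \<comment> \<open>The coefficients that integration by parts prescribes. Their sum against the
    node values will vanish because \<open>D 0\<close> is zero at every node.\<close>
  define C where "C \<beta> = (if \<beta> = 0 then of_real 1 * (- (0 * 1 / p) + ?V 0 0)
     else if \<beta> = N then of_real 1 * (0 * 1 / p - ?V 0 (real N)) else of_real 1 * c \<beta>)" for \<beta>
  have "((\<lambda>x. ((-1) ^ m * of_real (1 ^ m) * (0 * wave 1 x / p ^ m - ?V (m - 1) ((x - 0) / 1))) * nth_deriv_on 0 (real N) m (\<lambda>x. cnj (D 0 x)) x
       - 0 * (wave 1 x * cnj (D 0 x))) has_integral - (\<Sum>\<beta>=0..N. C \<beta> * cnj (D 0 (1 * real \<beta> + 0)))) {0..real N}"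
  proof (rule spline_by_parts[where w = 1 and c = c and \<pi> = \<pi> and C = C])
    show "wave 1 0 = 1" by (simp add: wave_def)
    then show "wave 1 (real N) = 1" using wave_mult_period[of 1 1 N 0] by simp
    show "(\<lambda>x. cnj (D 0 x)) \<in> sobolev_space m 0 (real N)"
      by (rule has_derivs_on_sobolev(1)[OF N0 m1 cD])
    show "spline \<pi> c N i 0 = 0 * 1 / p ^ (i + 1)" if "i \<in> {1..m - 1}" for i
      using left[OF that] by (simp add: spline_0)
    show "spline \<pi> c N i (real N) = 0 * 1 / p ^ (i + 1)" if "i \<in> {1..m - 1}" for i
      using right[OF that] by simp
  qed (use N m in \<open>auto simp: C_def p_def\<close>)
  moreover have "- (\<Sum>\<beta>=0..N. C \<beta> * cnj (D 0 (1 * real \<beta> + 0))) = 0"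
    using null by (simp add: Deq)
  ultimately have "((\<lambda>x. ((-1) ^ m * of_real (1 ^ m) * (0 * wave 1 x / p ^ m - ?V (m - 1) ((x - 0) / 1))) * nth_deriv_on 0 (real N) m (\<lambda>x. cnj (D 0 x)) x
       - 0 * (wave 1 x * cnj (D 0 x))) has_integral 0) {0..real N}" by (simp only:)
  then have "((\<lambda>x. complex_of_real ((cmod (?V (m - 1) x))\<^sup>2)) has_integral 0) {0..real N}"
  proof (rule has_integral_eq[rotated])
    fix x assume "x \<in> {0..real N}"
    then have "nth_deriv_on 0 (real N) m (\<lambda>x. cnj (D 0 x)) x = cnj (D m x)"
      by (rule has_derivs_on_sobolev(2)[OF N0 m1 cD])
    then have "nth_deriv_on 0 (real N) m (\<lambda>x. cnj (D 0 x)) x = - ((-1) ^ m * cnj (?V (m - 1) x))"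
      using m by (simp add: Deq mult_2)
    moreover have "(-1) ^ m * v * ((-1) ^ m * u) = v * u" for u v :: complex
      by (cases "even m") auto
    ultimately show "((-1) ^ m * of_real (1 ^ m) * (0 * wave 1 x / p ^ m - ?V (m - 1) ((x - 0) / 1))) * nth_deriv_on 0 (real N) m (\<lambda>x. cnj (D 0 x)) x
       - 0 * (wave 1 x * cnj (D 0 x)) = complex_of_real ((cmod (?V (m - 1) x))\<^sup>2)"
      unfolding complex_norm_square by simp
  qed
  then have "((\<lambda>x. Re (complex_of_real ((cmod (?V (m - 1) x))\<^sup>2))) has_integral Re 0) {0..real N}"
    by (rule has_integral_Re)
  then have int0: "((\<lambda>x. (cmod (?V (m - 1) x))\<^sup>2) has_integral 0) {0..real N}" by simp
  have "continuous_on {0..real N} (\<lambda>x. ?V (m - 1) ((x - 0) / 1))"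
    using m by (intro spline_continuous) auto
  then have cont: "continuous_on {0..real N} (\<lambda>x. (cmod (?V (m - 1) x))\<^sup>2)"
    by (intro continuous_intros) simp
  have V0: "?V (m - 1) x = 0" if "x \<in> {0..real N}" for x
  proof -
    have "(cmod (?V (m - 1) x))\<^sup>2 = 0"
      using int0 cont that N0 by (intro has_integral_0_cbox_imp_0[of 0 "real N" "\<lambda>x. (cmod (?V (m - 1) x))\<^sup>2"]) auto
    then show ?thesis by simp
  qed
  \<comment> \<open>At the m points k/m of [0, 1) no truncated power is active, so the polynomial
    part, of degree at most m - 1, has m zeros.\<close>
  have low: "\<pi> l = 0" if l: "l \<le> m - 1" for l
  proof (rule taylor_poly_eq_0[OF _ _ _ l])
    let ?S = "(\<lambda>k. real k / real m) ` {..<m}"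
    have "inj_on (\<lambda>k. real k / real m) {..<m}" using m by (auto simp: inj_on_def)
    then show "card ?S > m - 1" using m by (simp add: card_image)
    fix y assume "y \<in> ?S"
    then obtain k where k: "y = real k / real m" "k < m" by auto
    then have y: "0 \<le> y" "y \<le> 1" using m by auto
    have "trunc_pow (m - 1) (y - real \<beta>) = 0" if "\<beta> \<in> {1..<N}" for \<beta>
      using y that by (auto simp: trunc_pow_def)
    then have "?V (m - 1) y = taylor_poly \<pi> (m - 1) y" by (simp add: spline_def)
    then show "taylor_poly \<pi> (m - 1) y = 0" using V0[of y] y N by auto
  qed auto
  have tp0: "taylor_poly \<pi> (m - 1) y = 0" for y
    unfolding taylor_poly_def using low by (intro sum.neutral) auto
  have c0: "c \<beta> = 0" if \<beta>: "\<beta> \<in> {1..<N}" for \<beta>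
  proof (rule sum_power_nodes_eq_0[OF _ \<beta>, where i = "m - 1"])
    fix n assume n: "1 \<le> n" "n \<le> N"
    then show "(\<Sum>\<beta>\<in>{1..<n}. c \<beta> * of_real ((real n - real \<beta>) ^ (m - 1) / fact (m - 1))) = 0"
      using spline_node[OF n(2), of \<pi> c "m - 1"] V0[of "real n"] tp0 by simp
  qed
  then show "\<beta> \<in> {1..<N} \<Longrightarrow> c \<beta> = 0" .
  \<comment> \<open>Of the spline of degree 2m - 1 only a polynomial of degree at most m - 1 is
    left. It vanishes at N + 1 \<ge> m nodes, which is where the lower bound on N enters.\<close>
  have high: "\<pi> (l + m) = 0" if l: "l \<le> m - 1" for l
  proof (rule taylor_poly_eq_0[of "real ` {0..N}" "m - 1" "\<lambda>l. \<pi> (l + m)", OF _ _ _ l])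
    show "card (real ` {0..N}) > m - 1" using N by (simp add: card_image)
    fix y assume "y \<in> real ` {0..N}"
    then obtain n where n: "y = real n" "n \<le> N" by auto
    have "taylor_poly \<pi> (2 * m - 1) y = 0"
      using null[OF n(2)] spline_node[OF n(2), of \<pi> c "2 * m - 1"] c0 n by simp
    moreover have "taylor_poly \<pi> (2 * m - 1) y = taylor_poly (\<lambda>l. \<pi> (l + m)) (m - 1) y"
    proof -
      have "{..2 * m - 1} = {..m - 1} \<union> (\<lambda>l. l + m) ` {..m - 1}"
      proof (intro set_eqI iffI)
        fix x assume "x \<in> {..2 * m - 1}"
        then show "x \<in> {..m - 1} \<union> (\<lambda>l. l + m) ` {..m - 1}"
          by (cases "x \<le> m - 1") (auto intro!: image_eqI[of _ _ "x - m"])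
      qed (use m in auto)
      moreover have "{..m - 1} \<inter> (\<lambda>l. l + m) ` {..m - 1} = {}" using m by auto
      ultimately have "taylor_poly \<pi> (2 * m - 1) y = (\<Sum>l\<le>m - 1. \<pi> l * of_real (y ^ (2 * m - 1 - l) / fact (2 * m - 1 - l)))
         + (\<Sum>l\<in>(\<lambda>l. l + m) ` {..m - 1}. \<pi> l * of_real (y ^ (2 * m - 1 - l) / fact (2 * m - 1 - l)))"
        unfolding taylor_poly_def by (simp add: sum.union_disjoint)
      also have "(\<Sum>l\<le>m - 1. \<pi> l * of_real (y ^ (2 * m - 1 - l) / fact (2 * m - 1 - l))) = 0"
        using low by (intro sum.neutral) auto
      also have "(\<Sum>l\<in>(\<lambda>l. l + m) ` {..m - 1}. \<pi> l * of_real (y ^ (2 * m - 1 - l) / fact (2 * m - 1 - l)))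
        = taylor_poly (\<lambda>l. \<pi> (l + m)) (m - 1) y"
      proof -
        have "2 * m - 1 - (l + m) = m - 1 - l" for l using m by simp
        then show ?thesis unfolding taylor_poly_def by (subst sum.reindex) (auto simp: inj_on_def)
      qed
      finally show ?thesis by simp
    qed
    ultimately show "taylor_poly (\<lambda>l. \<pi> (l + m)) (m - 1) y = 0" by simp
  qed auto
  show "\<pi> i = 0" if "i \<le> 2 * m - 1" for i
    using low[of i] high[of "i - m"] that by (cases "i \<le> m - 1") auto
qed

section \<open>Splines with geometric knot coefficients\<close>

definition polylog1 :: "nat \<Rightarrow> complex \<Rightarrow> complex" where
  "polylog1 i q = polylog i q - (if i = 0 then 1 else 0)"

lemma binomial_polylog_sums:
  assumes "cmod q < 1"
  shows "(\<lambda>r. q ^ r * (x + s * of_nat r) ^ i) sums (\<Sum>l\<le>i. of_nat (i choose l) * x ^ (i - l) * (s ^ l * polylog l q))"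
proof -
  have "(\<lambda>r. \<Sum>l\<le>i. of_nat (i choose l) * x ^ (i - l) * (s ^ l * (of_nat r ^ l * q ^ r))) sums
     (\<Sum>l\<le>i. of_nat (i choose l) * x ^ (i - l) * (s ^ l * polylog l q))"
    by (intro sums_sum sums_mult polylog_sums assms)
  moreover have "(\<Sum>l\<le>i. of_nat (i choose l) * x ^ (i - l) * (s ^ l * (of_nat r ^ l * q ^ r))) = q ^ r * (x + s * of_nat r) ^ i" for r
    unfolding add.commute[of x] binomial_ring by (simp add: sum_distrib_left power_mult_distrib mult_ac)
  ultimately show ?thesis by simp
qed

text \<open>The finite sum is a convergent series minus its tail from \<beta> = n. The whole series
  is a polynomial in n by the binomial theorem, the shifted tail is q^n times a polylogarithm.
  Leaving out \<beta> = 0 turns \<open>polylog\<close> into \<open>polylog1\<close>, the series from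
  r = 1 on.\<close>

lemma sum_power_shift_increasing:
  assumes q: "cmod q < 1" and n: "n \<ge> 1"
  shows "(\<Sum>\<beta>\<in>{1..<n}. q ^ \<beta> * (of_nat n - of_nat \<beta>) ^ i)
    = (\<Sum>l\<le>i. of_nat (i choose l) * of_nat n ^ (i - l) * ((-1) ^ l * polylog1 l q)) - q ^ n * ((-1) ^ i * polylog i q)"
proof -
  let ?f = "\<lambda>\<beta>. q ^ \<beta> * (of_nat n + (-1) * of_nat \<beta>) ^ i"
  let ?S = "\<Sum>l\<le>i. of_nat (i choose l) * of_nat n ^ (i - l) * ((-1) ^ l * polylog l q)"
  have "(\<lambda>\<beta>. ?f (\<beta> + n)) sums (?S - (\<Sum>\<beta><n. ?f \<beta>))"
    by (rule sums_split_initial_segment[OF binomial_polylog_sums[OF q]])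
  moreover have "(\<lambda>\<beta>. q ^ n * ((-1) ^ i * (of_nat \<beta> ^ i * q ^ \<beta>))) sums (q ^ n * ((-1) ^ i * polylog i q))"
    by (intro sums_mult polylog_sums q)
  moreover have "?f (\<beta> + n) = q ^ n * ((-1) ^ i * (of_nat \<beta> ^ i * q ^ \<beta>))" for \<beta>
    by (simp add: power_add power_minus[of "of_nat \<beta>"] mult_ac)
  ultimately have "?S - (\<Sum>\<beta><n. ?f \<beta>) = q ^ n * ((-1) ^ i * polylog i q)"
    using sums_unique2 by (simp only:) blast
  moreover have "{..<n} = insert 0 {1..<n}" using n by auto
  then have "(\<Sum>\<beta><n. ?f \<beta>) = of_nat n ^ i + (\<Sum>\<beta>\<in>{1..<n}. ?f \<beta>)" by simp
  moreover have "(\<Sum>l\<le>i. of_nat (i choose l) * of_nat n ^ (i - l) * ((-1) ^ l * polylog1 l q)) = ?S - of_nat n ^ i"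
  proof -
    have "(\<Sum>l\<le>i. of_nat (i choose l) * of_nat n ^ (i - l) * ((-1) ^ l * polylog1 l q))
      = ?S - (\<Sum>l\<le>i. if l = 0 then of_nat n ^ i else 0)"
      unfolding sum_subtractf[symmetric] by (intro sum.cong) (auto simp: polylog1_def right_diff_distrib)
    then show ?thesis by simp
  qed
  ultimately show ?thesis by (simp add: algebra_simps)
qed

text \<open>The same splitting after the reflection j = n - \<beta>, with the roles exchanged: the
  whole series is independent of n, and the tail is q^n times a polynomial in n.\<close>

lemma sum_power_shift_decreasing:
  assumes q: "cmod q < 1" and n: "n \<ge> 1"
  shows "(\<Sum>\<beta>\<in>{1..<n}. q ^ (n - \<beta>) * (of_nat n - of_nat \<beta>) ^ i)
    = polylog1 i q - q ^ n * (\<Sum>l\<le>i. of_nat (i choose l) * of_nat n ^ (i - l) * polylog l q)"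
proof -
  let ?f = "\<lambda>j. of_nat j ^ i * q ^ j"
  have "(\<lambda>j. ?f (j + n)) sums (polylog i q - (\<Sum>j<n. ?f j))"
    by (rule sums_split_initial_segment[OF polylog_sums[OF q]])
  moreover have "(\<lambda>j. q ^ n * (q ^ j * (of_nat n + 1 * of_nat j) ^ i)) sums
      (q ^ n * (\<Sum>l\<le>i. of_nat (i choose l) * of_nat n ^ (i - l) * (1 ^ l * polylog l q)))"
    by (intro sums_mult binomial_polylog_sums q)
  moreover have "?f (j + n) = q ^ n * (q ^ j * (of_nat n + 1 * of_nat j) ^ i)" for j
    by (simp add: power_add add.commute mult_ac)
  ultimately have "polylog i q - (\<Sum>j<n. ?f j) = q ^ n * (\<Sum>l\<le>i. of_nat (i choose l) * of_nat n ^ (i - l) * (1 ^ l * polylog l q))"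
    using sums_unique2 by (simp only:) blast
  moreover have "{..<n} = insert 0 {1..<n}" using n by auto
  then have "(\<Sum>j<n. ?f j) = (if i = 0 then 1 else 0) + (\<Sum>j\<in>{1..<n}. ?f j)" by simp
  moreover have "(\<Sum>\<beta>\<in>{1..<n}. q ^ (n - \<beta>) * (of_nat n - of_nat \<beta>) ^ i) = (\<Sum>j\<in>{1..<n}. ?f j)"
    by (rule sum.reindex_bij_witness[of _ "\<lambda>j. n - j" "\<lambda>j. n - j"]) (auto simp: of_nat_diff mult.commute)
  ultimately show ?thesis by (simp add: polylog1_def algebra_simps)
qed

text \<open>The power of exponent N - \<beta> is written with an inverse so that the sequence
  continues geometrically beyond \<beta> = N, where subtraction of naturals would stop at 0.\<close>

definition knot_coeff :: "nat \<Rightarrow> nat \<Rightarrow> (nat \<Rightarrow> complex) \<Rightarrow> (nat \<Rightarrow> complex) \<Rightarrow> (nat \<Rightarrow> complex) \<Rightarrow> nat \<Rightarrow> complex" where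
  "knot_coeff m N q A B \<beta> = (\<Sum>k=1..m - 1. A k * q k ^ \<beta> + B k * (q k ^ N * inverse (q k) ^ \<beta>))"

text \<open>Chosen to cancel the polynomials in n that the truncated powers with these knot
  coefficients contribute at the node n.\<close>

definition taylor_coeff :: "nat \<Rightarrow> nat \<Rightarrow> (nat \<Rightarrow> complex) \<Rightarrow> (nat \<Rightarrow> complex) \<Rightarrow> (nat \<Rightarrow> complex) \<Rightarrow> nat \<Rightarrow> complex" where
  "taylor_coeff m N q A B i = - (1 / fact i) * (\<Sum>k=1..m - 1. A k * ((-1) ^ i * polylog1 i (q k)) - B k * (q k ^ N * polylog i (q k)))"

text \<open>After this cancellation only multiples of \<open>polylog i (q k)\<close> and
  \<open>polylog1 i (q k)\<close> remain. They vanish for i = 2m - 1, which gives the zeros at the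
  nodes; for smaller i the case n = N gives the data at the right end.\<close>

lemma node_value:
  assumes q: "\<And>k. k \<in> {1..m - 1} \<Longrightarrow> cmod (q k) < 1 \<and> q k \<noteq> 0" and n: "n \<ge> 1"
  shows "taylor_poly (taylor_coeff m N q A B) i (real n) + (\<Sum>\<beta>\<in>{1..<n}. knot_coeff m N q A B \<beta> * of_real ((real n - real \<beta>) ^ i / fact i))
    = (1 / fact i) * (\<Sum>k=1..m - 1. B k * (q k ^ N * inverse (q k) ^ n * polylog1 i (q k)) - A k * (q k ^ n * ((-1) ^ i * polylog i (q k))))"
proof -
  define TA where "TA k = (\<Sum>l\<le>i. of_nat (i choose l) * of_nat n ^ (i - l) * ((-1) ^ l * polylog1 l (q k)))" for k
  define TB where "TB k = (\<Sum>l\<le>i. of_nat (i choose l) * of_nat n ^ (i - l) * polylog l (q k))" for k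
  have "taylor_poly (taylor_coeff m N q A B) i (real n)
    = (\<Sum>l\<le>i. \<Sum>k=1..m - 1. - (1 / fact i) * (A k * (of_nat (i choose l) * of_nat n ^ (i - l) * ((-1) ^ l * polylog1 l (q k)))
        - B k * q k ^ N * (of_nat (i choose l) * of_nat n ^ (i - l) * polylog l (q k))))"
    unfolding taylor_poly_def
  proof (intro sum.cong refl)
    fix l assume "l \<in> {..i}"
    then have bin: "(of_nat (i choose l) :: complex) = fact i / (fact l * fact (i - l))"
      by (simp add: binomial_fact)
    show "taylor_coeff m N q A B l * of_real (real n ^ (i - l) / fact (i - l)) =
      (\<Sum>k=1..m - 1. - (1 / fact i) * (A k * (of_nat (i choose l) * of_nat n ^ (i - l) * ((-1) ^ l * polylog1 l (q k)))
        - B k * q k ^ N * (of_nat (i choose l) * of_nat n ^ (i - l) * polylog l (q k))))"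
      unfolding taylor_coeff_def bin sum_distrib_left sum_distrib_right
      by (intro sum.cong refl) (simp add: field_simps)
  qed
  also have "\<dots> = - (1 / fact i) * (\<Sum>k=1..m - 1. A k * TA k - B k * q k ^ N * TB k)"
    by (subst sum.swap) (simp only: TA_def TB_def sum_distrib_left right_diff_distrib sum_subtractf)
  finally have t: "taylor_poly (taylor_coeff m N q A B) i (real n) = - (1 / fact i) * (\<Sum>k=1..m - 1. A k * TA k - B k * q k ^ N * TB k)" .
  have "(\<Sum>\<beta>\<in>{1..<n}. knot_coeff m N q A B \<beta> * of_real ((real n - real \<beta>) ^ i / fact i))
    = (\<Sum>\<beta>\<in>{1..<n}. \<Sum>k=1..m - 1. (1 / fact i) * (A k * (q k ^ \<beta> * (of_nat n - of_nat \<beta>) ^ i)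
        + B k * (q k ^ N * inverse (q k) ^ n) * (q k ^ (n - \<beta>) * (of_nat n - of_nat \<beta>) ^ i)))"
    unfolding knot_coeff_def sum_distrib_right
  proof (intro sum.cong refl)
    fix \<beta> k assume \<beta>: "\<beta> \<in> {1..<n}" and k: "k \<in> {1..m - 1}"
    have "inverse (q k) ^ n * q k ^ (n - \<beta>) = inverse (q k) ^ \<beta>"
    proof -
      have "inverse (q k) ^ n = inverse (q k) ^ \<beta> * inverse (q k) ^ (n - \<beta>)"
        using \<beta> by (simp add: power_add[symmetric])
      moreover have "inverse (q k) ^ (n - \<beta>) * q k ^ (n - \<beta>) = 1"
        using q[OF k] by (simp add: power_mult_distrib[symmetric])
      ultimately show ?thesis by (simp add: mult.assoc)
    qed
    then have "B k * (q k ^ N * inverse (q k) ^ n) * (q k ^ (n - \<beta>) * (of_nat n - of_nat \<beta>) ^ i)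
      = B k * (q k ^ N * inverse (q k) ^ \<beta>) * (of_nat n - of_nat \<beta>) ^ i"
      by (metis (no_types, lifting) mult.assoc)
    then show "(A k * q k ^ \<beta> + B k * (q k ^ N * inverse (q k) ^ \<beta>)) * of_real ((real n - real \<beta>) ^ i / fact i)
      = (1 / fact i) * (A k * (q k ^ \<beta> * (of_nat n - of_nat \<beta>) ^ i)
        + B k * (q k ^ N * inverse (q k) ^ n) * (q k ^ (n - \<beta>) * (of_nat n - of_nat \<beta>) ^ i))"
      by (simp add: field_simps)
  qed
  also have "\<dots> = (1 / fact i) * (\<Sum>k=1..m - 1. A k * (\<Sum>\<beta>\<in>{1..<n}. q k ^ \<beta> * (of_nat n - of_nat \<beta>) ^ i)
        + B k * (q k ^ N * inverse (q k) ^ n) * (\<Sum>\<beta>\<in>{1..<n}. q k ^ (n - \<beta>) * (of_nat n - of_nat \<beta>) ^ i))"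
    by (subst sum.swap) (simp add: sum_distrib_left sum.distrib distrib_left)
  also have "\<dots> = (1 / fact i) * (\<Sum>k=1..m - 1. A k * (TA k - q k ^ n * ((-1) ^ i * polylog i (q k)))
        + (B k * (q k ^ N * inverse (q k) ^ n * polylog1 i (q k)) - B k * q k ^ N * TB k))"
  proof (intro arg_cong[of _ _ "\<lambda>x. (1 / fact i) * x"] sum.cong refl)
    fix k assume k: "k \<in> {1..m - 1}"
    have "inverse (q k) ^ n * q k ^ n = 1" using q[OF k] by (simp add: power_mult_distrib[symmetric])
    then have "B k * (q k ^ N * inverse (q k) ^ n) * (polylog1 i (q k) - q k ^ n * TB k)
       = B k * (q k ^ N * inverse (q k) ^ n * polylog1 i (q k)) - B k * q k ^ N * TB k"
      by (simp add: right_diff_distrib mult.assoc)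
    then show "A k * (\<Sum>\<beta>\<in>{1..<n}. q k ^ \<beta> * (of_nat n - of_nat \<beta>) ^ i)
        + B k * (q k ^ N * inverse (q k) ^ n) * (\<Sum>\<beta>\<in>{1..<n}. q k ^ (n - \<beta>) * (of_nat n - of_nat \<beta>) ^ i)
      = A k * (TA k - q k ^ n * ((-1) ^ i * polylog i (q k)))
        + (B k * (q k ^ N * inverse (q k) ^ n * polylog1 i (q k)) - B k * q k ^ N * TB k)"
      using sum_power_shift_increasing[of "q k" n i] sum_power_shift_decreasing[of "q k" n i] q[OF k] n
      by (simp add: TA_def TB_def)
  qed
  finally show ?thesis
    unfolding t by (simp add: algebra_simps sum.distrib sum_subtractf sum_negf)
qed

section \<open>The linear system for the coefficients\<close>

abbreviation right_coeff :: "nat \<Rightarrow> nat \<Rightarrow> (nat \<Rightarrow> complex) \<Rightarrow> (nat \<Rightarrow> complex) \<Rightarrow> (nat \<Rightarrow> complex) \<Rightarrow> nat \<Rightarrow> complex" where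
  "right_coeff m N q A B i \<equiv> spline (taylor_coeff m N q A B) (knot_coeff m N q A B) N i (real N)"

lemma spline_right_end:
  assumes q: "\<And>k. k \<in> {1..m - 1} \<Longrightarrow> cmod (q k) < 1 \<and> q k \<noteq> 0" and N: "N \<ge> 1"
  shows "right_coeff m N q A B i
    = (1 / fact i) * (\<Sum>k=1..m - 1. B k * polylog1 i (q k) - A k * (q k ^ N * ((-1) ^ i * polylog i (q k))))"
proof -
  have "q k ^ N * inverse (q k) ^ N = 1" if "k \<in> {1..m - 1}" for k
    using q[OF that] by (simp add: power_mult_distrib[symmetric])
  then have "(\<Sum>k=1..m - 1. B k * (q k ^ N * inverse (q k) ^ N * polylog1 i (q k)) - A k * (q k ^ N * ((-1) ^ i * polylog i (q k))))
    = (\<Sum>k=1..m - 1. B k * polylog1 i (q k) - A k * (q k ^ N * ((-1) ^ i * polylog i (q k))))"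
    by (intro sum.cong) auto
  then show ?thesis
    using spline_node[of N N] node_value[where q = q and m = m and n = N and N = N, OF q N] by simp
qed

lemma knot_coeff_eq:
  assumes q: "\<And>k. k \<in> {1..m - 1} \<Longrightarrow> q k \<noteq> 0" and "\<beta> \<le> N"
  shows "knot_coeff m N q A B \<beta> = (\<Sum>k=1..m - 1. A k * q k ^ \<beta> + B k * q k ^ (N - \<beta>))"
  unfolding knot_coeff_def
proof (intro sum.cong refl)
  fix k assume "k \<in> {1..m - 1}"
  then have "q k ^ N * inverse (q k) ^ \<beta> = q k ^ (N - \<beta>)"
    using q assms(2) by (simp add: power_diff power_inverse divide_inverse)
  then show "A k * q k ^ \<beta> + B k * (q k ^ N * inverse (q k) ^ \<beta>) = A k * q k ^ \<beta> + B k * q k ^ (N - \<beta>)" by simp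
qed

lemma triangular_sum_zero:
  fixes u :: "nat \<Rightarrow> nat \<Rightarrow> complex"
  assumes "\<And>j. j \<in> {1..n} \<Longrightarrow> u j j \<noteq> 0"
  shows "(\<forall>j\<in>{1..n}. (\<Sum>\<alpha>=1..j. u j \<alpha> * x \<alpha>) = 0) \<longleftrightarrow> (\<forall>j\<in>{1..n}. x j = 0)"
proof (intro iffI ballI)
  fix j assume z: "\<forall>j\<in>{1..n}. (\<Sum>\<alpha>=1..j. u j \<alpha> * x \<alpha>) = 0" and "j \<in> {1..n}"
  then show "x j = 0"
  proof (induction j rule: less_induct)
    case (less j)
    have "{1..j} = insert j {1..<j}" using less.prems(2) by auto
    moreover have "(\<Sum>\<alpha>\<in>{1..<j}. u j \<alpha> * x \<alpha>) = 0" using less by (intro sum.neutral) auto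
    ultimately have "u j j * x j = 0" using less.prems(1)[rule_format, OF less.prems(2)] by simp
    then show ?case using assms[OF less.prems(2)] by simp
  qed
qed (auto intro!: sum.neutral)

text \<open>The first half of the system prescribes the derivatives of the spline at the left end point. Given
  these, the second half is triangular in the derivatives at the right end point.\<close>
lemma coefficient_system_iff:
  fixes a b h \<omega> :: real
  assumes q: "\<And>k. k \<in> {1..m - 1} \<Longrightarrow> cmod (q k) < 1 \<and> q k \<noteq> 0" and N: "N \<ge> 1"
    and ab: "a < b" and h: "h = (b - a) / real N"
    and p: "p = 2 * of_real pi * \<i> * of_real \<omega> * of_real h"
  shows "coefficient_system m N a b h \<omega> q A B \<longleftrightarrow>
    (\<forall>i\<in>{1..m - 1}. taylor_coeff m N q A B i = wave \<omega> a / p ^ (i + 1)) \<and>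
    (\<forall>i\<in>{1..m - 1}. right_coeff m N q A B i = wave \<omega> b / p ^ (i + 1))"
proof -
  let ?\<pi> = "taylor_coeff m N q A B"
  let ?\<rho> = "\<lambda>i. right_coeff m N q A B i"
  have F2: "(\<Sum>t=1..j. q k ^ t * diff0 t j / (1 - q k) ^ (t + 1)) = polylog j (q k)" if "k \<in> {1..m - 1}" "j \<ge> 1" for k j
    using polylog_eq_diff0(1)[of "q k" j] q that by simp
  have F3: "(\<Sum>t=1..j. q k * diff0 t j / (q k - 1) ^ (t + 1)) = (-1) ^ (j + 1) * polylog j (q k)" if "k \<in> {1..m - 1}" "j \<ge> 1" for k j
    using polylog_eq_diff0(2)[of "q k" j] q that by simp
  have F2N: "(\<Sum>t=1..j. q k ^ (N + t) * diff0 t j / (1 - q k) ^ (t + 1)) = q k ^ N * polylog j (q k)" if "k \<in> {1..m - 1}" "j \<ge> 1" for k j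
    unfolding F2[OF that, symmetric] sum_distrib_left by (intro sum.cong) (auto simp: power_add)
  have F3N: "(\<Sum>t=1..j. q k ^ (N + 1) * diff0 t j / (q k - 1) ^ (t + 1)) = q k ^ N * ((-1) ^ (j + 1) * polylog j (q k))" if "k \<in> {1..m - 1}" "j \<ge> 1" for k j
    unfolding F3[OF that, symmetric] sum_distrib_left by (intro sum.cong) (auto simp: power_add)
  \<comment> \<open>h / (b - a) = 1 / N and the exponent is not positive, so the factor is a natural
    power of N.\<close>
  have pw: "of_real (h / (b - a)) powi (int \<alpha> - int j) = (of_nat N ^ (j - \<alpha>) :: complex)" if "\<alpha> \<le> j" for \<alpha> j
  proof -
    have "h / (b - a) = inverse (real N)" using ab h N by (simp add: field_simps)
    moreover have "int \<alpha> - int j = - int (j - \<alpha>)" using that by simp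
    moreover have "complex_of_real (inverse (real N)) = inverse (of_nat N)" by simp
    ultimately show ?thesis
      by (simp only: power_int_minus power_int_of_nat power_inverse inverse_inverse_eq)
  qed
  have \<rho>_eq: "?\<rho> i = (1 / fact i) * (\<Sum>k=1..m - 1. B k * polylog1 i (q k) - A k * (q k ^ N * ((-1) ^ i * polylog i (q k))))" for i
    by (rule spline_right_end[OF _ N]) (rule q)
  have \<pi>: "fact j * ?\<pi> j = (\<Sum>k=1..m - 1. A k * ((-1) ^ (j + 1) * polylog j (q k))) + (\<Sum>k=1..m - 1. B k * (q k ^ N * polylog j (q k)))"
    if j: "j \<ge> 1" for j
  proof -
    have "fact j * ?\<pi> j = - (\<Sum>k=1..m - 1. A k * ((-1) ^ j * polylog j (q k)) - B k * (q k ^ N * polylog j (q k)))"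
      using j by (simp add: taylor_coeff_def polylog1_def)
    then show ?thesis by (simp add: sum_subtractf sum_negf)
  qed
  have \<rho>: "(-1) ^ (\<alpha> + 1) * fact \<alpha> * ?\<rho> \<alpha> = (\<Sum>k=1..m - 1. A k * (q k ^ N * polylog \<alpha> (q k))) + (\<Sum>k=1..m - 1. B k * ((-1) ^ (\<alpha> + 1) * polylog \<alpha> (q k)))"
    if \<alpha>: "\<alpha> \<ge> 1" for \<alpha>
  proof -
    have "(-1) ^ (\<alpha> + 1) * fact \<alpha> * ?\<rho> \<alpha> = (-1) ^ (\<alpha> + 1) * (\<Sum>k=1..m - 1. B k * polylog \<alpha> (q k) - A k * (q k ^ N * ((-1) ^ \<alpha> * polylog \<alpha> (q k))))"
      using \<alpha> unfolding \<rho>_eq by (simp add: polylog1_def)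
    also have "\<dots> = (\<Sum>k=1..m - 1. A k * (q k ^ N * polylog \<alpha> (q k)) + B k * ((-1) ^ (\<alpha> + 1) * polylog \<alpha> (q k)))"
      unfolding sum_distrib_left by (intro sum.cong refl) (cases "even \<alpha>"; simp add: algebra_simps)
    finally show ?thesis by (simp only: sum.distrib)
  qed
  have E1: "((\<Sum>k=1..m - 1. A k * (\<Sum>t=1..j. q k * diff0 t j / (q k - 1) ^ (t + 1)))
      + (\<Sum>k=1..m - 1. B k * (\<Sum>t=1..j. q k ^ (N + t) * diff0 t j / (1 - q k) ^ (t + 1)))
      = fact j * wave \<omega> a / p ^ (j + 1)) \<longleftrightarrow> ?\<pi> j = wave \<omega> a / p ^ (j + 1)" if j: "j \<in> {1..m - 1}" for j
  proof -
    have "(\<Sum>k=1..m - 1. A k * (\<Sum>t=1..j. q k * diff0 t j / (q k - 1) ^ (t + 1)))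
      + (\<Sum>k=1..m - 1. B k * (\<Sum>t=1..j. q k ^ (N + t) * diff0 t j / (1 - q k) ^ (t + 1))) = fact j * ?\<pi> j"
      using j F3 F2N by (subst \<pi>) (auto intro!: arg_cong2[of _ _ _ _ "(+)"] sum.cong)
    moreover have "fact j * wave \<omega> a / p ^ (j + 1) = fact j * (wave \<omega> a / p ^ (j + 1))" by simp
    ultimately show ?thesis by (simp only: mult_cancel_left fact_nonzero simp_thms)
  qed
  \<comment> \<open>The binomial factor of the equation combined with the factorial and the sign by
    which \<open>\<rho>\<close> relates the sums over k to the data at the right end. The diagonal
    entry is (-1)^j j!, hence nonzero.\<close>
  define u where "u j \<alpha> = (of_nat N ^ (j - \<alpha>) * ((-1) ^ \<alpha> * (fact j / fact (j - \<alpha>))) :: complex)" for j \<alpha> :: nat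
  have u0: "u j j \<noteq> 0" for j by (simp add: u_def)
  \<comment> \<open>Equation j of the first half is assumed because its left-hand side reappears
    here, up to sign, and cancels against the term with \<open>wave \<omega> a\<close>.\<close>
  have E2: "((\<Sum>k=1..m - 1. A k *
           ((\<Sum>t=1..j. q k ^ t * diff0 t j / (1 - q k) ^ (t + 1))
            - (\<Sum>\<alpha>=1..j. of_real (h / (b - a)) powi (int \<alpha> - int j) * of_nat (j choose \<alpha>) *
                 (\<Sum>t=1..\<alpha>. q k ^ (N + t) * diff0 t \<alpha> / (1 - q k) ^ (t + 1)))))
      + (\<Sum>k=1..m - 1. B k *
           ((\<Sum>t=1..j. q k ^ (N + 1) * diff0 t j / (q k - 1) ^ (t + 1))
            - (\<Sum>\<alpha>=1..j. of_real (h / (b - a)) powi (int \<alpha> - int j) * of_nat (j choose \<alpha>) *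
                 (\<Sum>t=1..\<alpha>. q k * diff0 t \<alpha> / (q k - 1) ^ (t + 1)))))
      = (-1) ^ (j + 1) * fact j * wave \<omega> a / p ^ (j + 1)
        + (\<Sum>\<alpha>=1..j. of_real (h / (b - a)) powi (int \<alpha> - int j) *
             ((-1) ^ \<alpha> * fact j * wave \<omega> b / (fact (j - \<alpha>) * p ^ (\<alpha> + 1)))))
     \<longleftrightarrow> (\<Sum>\<alpha>=1..j. u j \<alpha> * (?\<rho> \<alpha> - wave \<omega> b / p ^ (\<alpha> + 1))) = 0"
    (is "?lhs = ?rhs \<longleftrightarrow> _") if j: "j \<in> {1..m - 1}" and \<pi>j: "?\<pi> j = wave \<omega> a / p ^ (j + 1)" for j
  proof -
    have j1: "j \<ge> 1" using j by simp
    have "?lhs = (\<Sum>k=1..m - 1. A k * (polylog j (q k) - (\<Sum>\<alpha>=1..j. of_nat N ^ (j - \<alpha>) * of_nat (j choose \<alpha>) * (q k ^ N * polylog \<alpha> (q k)))))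
      + (\<Sum>k=1..m - 1. B k * (q k ^ N * ((-1) ^ (j + 1) * polylog j (q k)) - (\<Sum>\<alpha>=1..j. of_nat N ^ (j - \<alpha>) * of_nat (j choose \<alpha>) * ((-1) ^ (\<alpha> + 1) * polylog \<alpha> (q k)))))"
    proof (intro arg_cong2[of _ _ _ _ "(+)"] sum.cong refl)
      fix k assume k: "k \<in> {1..m - 1}"
      show "A k * ((\<Sum>t=1..j. q k ^ t * diff0 t j / (1 - q k) ^ (t + 1))
            - (\<Sum>\<alpha>=1..j. of_real (h / (b - a)) powi (int \<alpha> - int j) * of_nat (j choose \<alpha>) *
                 (\<Sum>t=1..\<alpha>. q k ^ (N + t) * diff0 t \<alpha> / (1 - q k) ^ (t + 1))))
        = A k * (polylog j (q k) - (\<Sum>\<alpha>=1..j. of_nat N ^ (j - \<alpha>) * of_nat (j choose \<alpha>) * (q k ^ N * polylog \<alpha> (q k))))"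
        unfolding F2[OF k j1] by (intro arg_cong2[of _ _ _ _ "(*)"] arg_cong2[of _ _ _ _ "(-)"] sum.cong refl F2N[OF k] pw) auto
      show "B k * ((\<Sum>t=1..j. q k ^ (N + 1) * diff0 t j / (q k - 1) ^ (t + 1))
            - (\<Sum>\<alpha>=1..j. of_real (h / (b - a)) powi (int \<alpha> - int j) * of_nat (j choose \<alpha>) *
                 (\<Sum>t=1..\<alpha>. q k * diff0 t \<alpha> / (q k - 1) ^ (t + 1))))
        = B k * (q k ^ N * ((-1) ^ (j + 1) * polylog j (q k)) - (\<Sum>\<alpha>=1..j. of_nat N ^ (j - \<alpha>) * of_nat (j choose \<alpha>) * ((-1) ^ (\<alpha> + 1) * polylog \<alpha> (q k))))"
        unfolding F3N[OF k j1] by (intro arg_cong2[of _ _ _ _ "(*)"] arg_cong2[of _ _ _ _ "(-)"] sum.cong refl F3[OF k] pw) auto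
    qed
    also have "\<dots> = ((\<Sum>k=1..m - 1. A k * polylog j (q k)) + (\<Sum>k=1..m - 1. B k * (q k ^ N * ((-1) ^ (j + 1) * polylog j (q k)))))
      - (\<Sum>\<alpha>=1..j. of_nat N ^ (j - \<alpha>) * of_nat (j choose \<alpha>) *
          ((\<Sum>k=1..m - 1. A k * (q k ^ N * polylog \<alpha> (q k))) + (\<Sum>k=1..m - 1. B k * ((-1) ^ (\<alpha> + 1) * polylog \<alpha> (q k)))))"
    proof -
      have dist: "(\<Sum>k=1..m - 1. X k * (Y k - (\<Sum>\<alpha>=1..j. c \<alpha> * Z k \<alpha>)))
        = (\<Sum>k=1..m - 1. X k * Y k) - (\<Sum>\<alpha>=1..j. c \<alpha> * (\<Sum>k=1..m - 1. X k * Z k \<alpha>))" for X Y c :: "nat \<Rightarrow> complex" and Z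
        unfolding right_diff_distrib sum_subtractf sum_distrib_left
        by (subst sum.swap) (simp add: mult_ac)
      show ?thesis unfolding dist by (simp only: distrib_left sum.distrib add_diff_add)
    qed
    also have "(\<Sum>k=1..m - 1. A k * polylog j (q k)) + (\<Sum>k=1..m - 1. B k * (q k ^ N * ((-1) ^ (j + 1) * polylog j (q k)))) = (-1) ^ (j + 1) * (fact j * ?\<pi> j)"
      unfolding \<pi>[OF j1] distrib_left sum_distrib_left
      by (intro arg_cong2[of _ _ _ _ "(+)"] sum.cong refl) (cases "even j"; simp)+
    also have "(\<Sum>\<alpha>=1..j. of_nat N ^ (j - \<alpha>) * of_nat (j choose \<alpha>) *
          ((\<Sum>k=1..m - 1. A k * (q k ^ N * polylog \<alpha> (q k))) + (\<Sum>k=1..m - 1. B k * ((-1) ^ (\<alpha> + 1) * polylog \<alpha> (q k)))))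
      = - (\<Sum>\<alpha>=1..j. u j \<alpha> * ?\<rho> \<alpha>)"
      unfolding sum_negf[symmetric]
    proof (intro sum.cong refl)
      fix \<alpha> assume \<alpha>: "\<alpha> \<in> {1..j}"
      then have "of_nat (j choose \<alpha>) = (fact j / (fact \<alpha> * fact (j - \<alpha>)) :: complex)" by (simp add: binomial_fact)
      then show "of_nat N ^ (j - \<alpha>) * of_nat (j choose \<alpha>) *
          ((\<Sum>k=1..m - 1. A k * (q k ^ N * polylog \<alpha> (q k))) + (\<Sum>k=1..m - 1. B k * ((-1) ^ (\<alpha> + 1) * polylog \<alpha> (q k))))
        = - (u j \<alpha> * ?\<rho> \<alpha>)"
        using \<alpha> \<rho>[of \<alpha>, symmetric] by (simp add: u_def field_simps)
    qed
    finally have L: "?lhs = (-1) ^ (j + 1) * (fact j * (wave \<omega> a / p ^ (j + 1))) + (\<Sum>\<alpha>=1..j. u j \<alpha> * ?\<rho> \<alpha>)"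
      by (simp add: \<pi>j)
    have R: "?rhs = (-1) ^ (j + 1) * (fact j * (wave \<omega> a / p ^ (j + 1))) + (\<Sum>\<alpha>=1..j. u j \<alpha> * (wave \<omega> b / p ^ (\<alpha> + 1)))"
    proof (intro arg_cong2[of _ _ _ _ "(+)"] sum.cong refl)
      fix \<alpha> assume "\<alpha> \<in> {1..j}"
      then show "of_real (h / (b - a)) powi (int \<alpha> - int j) * ((-1) ^ \<alpha> * fact j * wave \<omega> b / (fact (j - \<alpha>) * p ^ (\<alpha> + 1)))
        = u j \<alpha> * (wave \<omega> b / p ^ (\<alpha> + 1))"
        by (subst pw) (auto simp: u_def)
    qed simp
    show ?thesis unfolding L R by (simp add: right_diff_distrib sum_subtractf)
  qed
  show ?thesis
  proof (cases "\<forall>i\<in>{1..m - 1}. ?\<pi> i = wave \<omega> a / p ^ (i + 1)")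
    case True
    have conj_ball: "(\<forall>j\<in>J. P j) \<and> (\<forall>j\<in>J. Q j) \<longleftrightarrow> (\<forall>j\<in>J. Q' j)"
      if "\<And>j. j \<in> J \<Longrightarrow> P j" "\<And>j. j \<in> J \<Longrightarrow> Q j \<longleftrightarrow> Q' j" for J :: "nat set" and P Q Q'
      using that by auto
    have "coefficient_system m N a b h \<omega> q A B \<longleftrightarrow>
      (\<forall>j\<in>{1..m - 1}. (\<Sum>\<alpha>=1..j. u j \<alpha> * (?\<rho> \<alpha> - wave \<omega> b / p ^ (\<alpha> + 1))) = 0)"
      unfolding coefficient_system_def p[symmetric]
      by (rule conj_ball, rule E1[THEN iffD2], assumption, erule True[rule_format], rule E2, assumption, erule True[rule_format])
    also have "\<dots> \<longleftrightarrow> (\<forall>j\<in>{1..m - 1}. ?\<rho> j - wave \<omega> b / p ^ (j + 1) = 0)"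
      using triangular_sum_zero[of "m - 1" u "\<lambda>\<alpha>. ?\<rho> \<alpha> - wave \<omega> b / p ^ (\<alpha> + 1)"] u0 by simp
    finally show ?thesis using True by simp
  next
    case False
    then obtain i where i: "i \<in> {1..m - 1}" "?\<pi> i \<noteq> wave \<omega> a / p ^ (i + 1)" by blast
    then have "\<not> coefficient_system m N a b h \<omega> q A B"
      unfolding coefficient_system_def p[symmetric] using E1[OF i(1)] by blast
    then show ?thesis using False by blast
  qed
qed

section \<open>Unique solvability of the linear system\<close>

lemma taylor_poly_node_zero:
  assumes q: "\<And>k. k \<in> {1..m - 1} \<Longrightarrow> cmod (q k) < 1 \<and> q k \<noteq> 0 \<and> polylog M (q k) = 0" and M: "M \<ge> 1"
  shows "taylor_poly (taylor_coeff m N q A B) M (real n) + (\<Sum>\<beta>\<in>{1..<n}. knot_coeff m N q A B \<beta> * of_real ((real n - real \<beta>) ^ M / fact M)) = 0"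
proof (cases "n = 0")
  case True
  \<comment> \<open>\<open>node_value\<close> starts at n = 1. At n = 0 the value is this Taylor
    coefficient, and it vanishes because \<open>polylog1 M\<close> agrees with
    \<open>polylog M\<close> for M \<ge> 1.\<close>
  have "taylor_coeff m N q A B M = 0"
    unfolding taylor_coeff_def using q M by (auto intro!: sum.neutral simp: polylog1_def)
  then show ?thesis using True by (simp add: taylor_poly_0)
next
  case False
  have "(\<Sum>k=1..m - 1. B k * (q k ^ N * inverse (q k) ^ n * polylog1 M (q k)) - A k * (q k ^ n * ((-1) ^ M * polylog M (q k)))) = 0"
    using q M by (intro sum.neutral) (auto simp: polylog1_def)
  then show ?thesis
    using node_value[where q = q and m = m and n = n and N = N and A = A and B = B and i = M] q False by simp
qed

text \<open>The spline determines its coefficients \<open>A\<close>, \<open>B\<close> even if \<open>N\<close> is small: its knot coefficients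
  continue beyond \<open>N\<close> as a sequence for which all node values still vanish.\<close>
lemma homogeneous_coefficients_eq_0:
  assumes m: "m \<ge> 2" and N: "N \<ge> 1" "N + 1 \<ge> m"
    and q: "\<And>k. k \<in> {1..m - 1} \<Longrightarrow> cmod (q k) < 1 \<and> q k \<noteq> 0 \<and> polylog (2 * m - 1) (q k) = 0"
    and inj: "inj_on q {1..m - 1}"
    and left: "\<And>i. i \<in> {1..m - 1} \<Longrightarrow> taylor_coeff m N q A B i = 0"
    and right: "\<And>i. i \<in> {1..m - 1} \<Longrightarrow> right_coeff m N q A B i = 0"
    and k: "k \<in> {1..m - 1}"
  shows "A k = 0" and "B k = 0"
proof -
  let ?\<pi> = "taylor_coeff m N q A B" and ?c = "knot_coeff m N q A B"
  have node: "taylor_poly ?\<pi> (2 * m - 1) (real n) + (\<Sum>\<beta>\<in>{1..<n}. ?c \<beta> * of_real ((real n - real \<beta>) ^ (2 * m - 1) / fact (2 * m - 1))) = 0" for n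
    using m by (intro taylor_poly_node_zero q) auto
  have "spline ?\<pi> ?c N (2 * m - 1) (real n) = 0" if "n \<le> N" for n
    using spline_node[OF that] node by simp
  then have \<pi>0: "?\<pi> i = 0" if "i \<le> 2 * m - 1" for i
    using natural_null_spline_eq_0(1)[OF m N left right _ that] by blast
  then have "taylor_poly ?\<pi> (2 * m - 1) y = 0" for y
    unfolding taylor_poly_def by (intro sum.neutral) auto
  then have "(\<Sum>\<beta>\<in>{1..<n}. ?c \<beta> * of_real ((real n - real \<beta>) ^ (2 * m - 1) / fact (2 * m - 1))) = 0" for n
    using node[of n] by simp
  then have c0: "?c \<beta> = 0" if "\<beta> \<ge> 1" for \<beta>
    using sum_power_nodes_eq_0[of "Suc \<beta>" ?c "2 * m - 1" \<beta>] that by simp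
  \<comment> \<open>The knot coefficients are exponential sums with the 2m - 2 bases q_k and 1 /
    q_k. The two groups are separated by the unit circle, so all bases are distinct.\<close>
  define z where "z i = (if fst i then q (snd i) else inverse (q (snd i)))" for i :: "bool \<times> nat"
  define \<xi> where "\<xi> i = (if fst i then A (snd i) else B (snd i) * q (snd i) ^ N)" for i :: "bool \<times> nat"
  have split: "(\<Sum>i\<in>UNIV \<times> {1..m - 1}. f i) = (\<Sum>k=1..m - 1. f (True, k) + f (False, k))" for f :: "bool \<times> nat \<Rightarrow> complex"
    unfolding sum.cartesian_product[symmetric, of "\<lambda>x y. f (x, y)", simplified] UNIV_bool by (simp add: sum.distrib)
  have zero: "\<xi> i = 0" if "i \<in> UNIV \<times> {1..m - 1}" for i
  proof (rule exponentials_independent[OF _ _ _ _ that, of z \<xi>])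
    show "inj_on z (UNIV \<times> {1..m - 1})"
    proof (rule inj_onI)
      fix i j assume ij: "i \<in> UNIV \<times> {1..m - 1}" "j \<in> UNIV \<times> {1..m - 1}" "z i = z j"
      have i: "cmod (q (snd i)) < 1" "q (snd i) \<noteq> 0" and j: "cmod (q (snd j)) < 1" "q (snd j) \<noteq> 0"
        using q[of "snd i"] q[of "snd j"] ij(1,2) by auto
      have "1 < cmod (inverse (q (snd i)))" "1 < cmod (inverse (q (snd j)))"
        using i j by (auto simp: norm_inverse one_less_inverse_iff)
      then have "fst i \<longleftrightarrow> cmod (z i) < 1" "fst j \<longleftrightarrow> cmod (z j) < 1"
        using i(1) j(1) by (simp_all add: z_def not_less less_imp_le)
      then have "fst i = fst j" using ij(3) by simp
      moreover from this ij(3) have qe: "q (snd i) = q (snd j)" by (cases "fst j") (simp_all add: z_def)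
      have "snd i = snd j" by (rule inj_onD[OF inj qe]) (use ij(1,2) in auto)
      ultimately show "i = j" by (simp add: prod_eq_iff)
    qed
    show "z i \<noteq> 0" if "i \<in> UNIV \<times> {1..m - 1}" for i using q[of "snd i"] that by (auto simp: z_def)
    fix n :: nat assume "1 \<le> n"
    then show "(\<Sum>i\<in>UNIV \<times> {1..m - 1}. \<xi> i * z i ^ n) = 0"
      using c0[of n] unfolding split knot_coeff_def by (simp add: \<xi>_def z_def mult.assoc)
  qed auto
  show "A k = 0" using zero[of "(True, k)"] k by (simp add: \<xi>_def)
  show "B k = 0" using zero[of "(False, k)"] k q[OF k] by (simp add: \<xi>_def)
qed

text \<open>The data at the two ends depend linearly on the coefficients, with as many equations as
  unknowns, so the injectivity just shown also yields existence, for arbitrary right-hand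
  sides.\<close>

lemma boundary_system_unique_solution:
  assumes m: "m \<ge> 1" and N: "N \<ge> 1" "N + 1 \<ge> m"
    and q: "\<And>k. k \<in> {1..m - 1} \<Longrightarrow> cmod (q k) < 1 \<and> q k \<noteq> 0 \<and> polylog (2 * m - 1) (q k) = 0"
    and inj: "inj_on q {1..m - 1}"
  defines "L \<equiv> \<lambda>A B i. taylor_coeff m N q A B i"
    and "R \<equiv> \<lambda>A B i. right_coeff m N q A B i"
  shows "\<exists>A B. (\<forall>i\<in>{1..m - 1}. L A B i = l i) \<and> (\<forall>i\<in>{1..m - 1}. R A B i = r i)"
    and "\<lbrakk>\<And>i. i \<in> {1..m - 1} \<Longrightarrow> L A B i = L A' B' i; \<And>i. i \<in> {1..m - 1} \<Longrightarrow> R A B i = R A' B' i; k \<in> {1..m - 1}\<rbrakk>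
      \<Longrightarrow> A k = A' k \<and> B k = B' k"
proof -
  let ?I = "UNIV \<times> {1..m - 1} :: (bool \<times> nat) set"
  \<comment> \<open>In \<open>T j i\<close> the Boolean of \<open>j\<close> selects the end (True is
    left) and that of \<open>i\<close> the kind of coefficient (True is \<open>A\<close>).\<close>
  define T where "T j i = (if fst j
     then (if fst i then - (1 / fact (snd j)) * ((-1) ^ snd j * polylog1 (snd j) (q (snd i))) else (1 / fact (snd j)) * (q (snd i) ^ N * polylog (snd j) (q (snd i))))
     else (if fst i then - (1 / fact (snd j)) * (q (snd i) ^ N * ((-1) ^ snd j * polylog (snd j) (q (snd i)))) else (1 / fact (snd j)) * polylog1 (snd j) (q (snd i))))"
    for j i :: "bool \<times> nat"
  have split: "(\<Sum>i\<in>?I. f i) = (\<Sum>k=1..m - 1. f (True, k) + f (False, k))" for f :: "bool \<times> nat \<Rightarrow> complex"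
    unfolding sum.cartesian_product[symmetric, of "\<lambda>x y. f (x, y)", simplified] UNIV_bool by (simp add: sum.distrib)
  have TL: "(\<Sum>i\<in>?I. T (True, j) i * (if fst i then A (snd i) else B (snd i))) = L A B j" for A B j
    unfolding split L_def taylor_coeff_def sum_distrib_left by (intro sum.cong) (auto simp: T_def algebra_simps)
  have TR: "(\<Sum>i\<in>?I. T (False, j) i * (if fst i then A (snd i) else B (snd i))) = R A B j" for A B j
  proof -
    have qq: "\<And>k. k \<in> {1..m - 1} \<Longrightarrow> cmod (q k) < 1 \<and> q k \<noteq> 0" using q by blast
    have R_eq: "R A B j = (1 / fact j) * (\<Sum>k=1..m - 1. B k * polylog1 j (q k) - A k * (q k ^ N * ((-1) ^ j * polylog j (q k))))"
      unfolding R_def by (rule spline_right_end[OF _ N(1)]) (rule qq)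
    show ?thesis
      unfolding split R_eq sum_distrib_left
      by (intro sum.cong) (auto simp: T_def algebra_simps)
  qed
  have hom: "A k = 0 \<and> B k = 0" if "\<And>i. i \<in> {1..m - 1} \<Longrightarrow> L A B i = 0" "\<And>i. i \<in> {1..m - 1} \<Longrightarrow> R A B i = 0" "k \<in> {1..m - 1}" for A B k
  proof -
    \<comment> \<open>For m = 1 there is no unknown, so the existence of an index already gives the
      bound that the spline argument requires.\<close>
    have "m \<ge> 2" using that(3) by auto
    then show ?thesis
      using homogeneous_coefficients_eq_0[OF _ N q inj, of A B k] that unfolding L_def R_def by blast
  qed
  have "\<exists>x. \<forall>j\<in>?I. (\<Sum>i\<in>?I. T j i * x i) = (if fst j then l (snd j) else r (snd j))"
  proof (rule square_system_solvable)
    fix x i assume x: "\<And>j. j \<in> ?I \<Longrightarrow> (\<Sum>i\<in>?I. T j i * x i) = 0" and i: "i \<in> ?I"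
    have xe: "(if fst i then x (True, snd i) else x (False, snd i)) = x i" for i
      by (cases i) auto
    have "L (\<lambda>k. x (True, k)) (\<lambda>k. x (False, k)) j = 0 \<and> R (\<lambda>k. x (True, k)) (\<lambda>k. x (False, k)) j = 0" if "j \<in> {1..m - 1}" for j
      unfolding TL[symmetric] TR[symmetric] xe using x[of "(True, j)"] x[of "(False, j)"] that by auto
    then have "x (True, snd i) = 0 \<and> x (False, snd i) = 0"
      using hom[of "\<lambda>k. x (True, k)" "\<lambda>k. x (False, k)" "snd i"] i by auto
    then show "x i = 0" by (metis (full_types) prod.collapse)
  qed auto
  then obtain x where x: "\<And>j. j \<in> ?I \<Longrightarrow> (\<Sum>i\<in>?I. T j i * x i) = (if fst j then l (snd j) else r (snd j))" by blast
  have xe: "(if fst i then x (True, snd i) else x (False, snd i)) = x i" for i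
    by (cases i) auto
  have "L (\<lambda>k. x (True, k)) (\<lambda>k. x (False, k)) j = l j \<and> R (\<lambda>k. x (True, k)) (\<lambda>k. x (False, k)) j = r j" if "j \<in> {1..m - 1}" for j
    unfolding TL[symmetric] TR[symmetric] xe using x[of "(True, j)"] x[of "(False, j)"] that by auto
  then show "\<exists>A B. (\<forall>i\<in>{1..m - 1}. L A B i = l i) \<and> (\<forall>i\<in>{1..m - 1}. R A B i = r i)" by blast
  assume eq: "\<And>i. i \<in> {1..m - 1} \<Longrightarrow> L A B i = L A' B' i" "\<And>i. i \<in> {1..m - 1} \<Longrightarrow> R A B i = R A' B' i" and k: "k \<in> {1..m - 1}"
  have "(\<Sum>i\<in>?I. T j i * (if fst i then A (snd i) - A' (snd i) else B (snd i) - B' (snd i)))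
    = (\<Sum>i\<in>?I. T j i * (if fst i then A (snd i) else B (snd i))) - (\<Sum>i\<in>?I. T j i * (if fst i then A' (snd i) else B' (snd i)))" for j
    unfolding sum_subtractf[symmetric] by (intro sum.cong) (auto simp: algebra_simps)
  then have "L (\<lambda>k. A k - A' k) (\<lambda>k. B k - B' k) i = L A B i - L A' B' i"
    "R (\<lambda>k. A k - A' k) (\<lambda>k. B k - B' k) i = R A B i - R A' B' i" for i
    unfolding TL[symmetric] TR[symmetric] by blast+
  then have "A k - A' k = 0 \<and> B k - B' k = 0"
    using hom[of "\<lambda>k. A k - A' k" "\<lambda>k. B k - B' k" k] eq k by simp
  then show "A k = A' k \<and> B k = B' k" by simp
qed

section \<open>Optimality of the explicit coefficients\<close>

lemma optimal_coefficient_sard: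
  fixes a b h \<omega> :: real
  assumes m: "m \<ge> 1" and N: "N \<ge> 1"
    and ab: "a < b" and h: "h = (b - a) / real N" and \<omega>: "\<omega> \<noteq> 0" "\<omega> * h \<in> \<int>"
    and q: "\<And>k. k \<in> {1..m - 1} \<Longrightarrow> cmod (q k) < 1 \<and> q k \<noteq> 0 \<and> polylog (2 * m - 1) (q k) = 0"
    and sys: "coefficient_system m N a b h \<omega> q A B"
  shows "sard_optimal m \<omega> a b h N C \<longleftrightarrow> (\<forall>\<beta>\<in>{0..N}. C \<beta> = optimal_coefficient m N a b h \<omega> q A B \<beta>)"
proof -
  define p where "p = 2 * of_real pi * \<i> * complex_of_real \<omega> * complex_of_real h"
  define w where "w = wave \<omega> a"
  let ?\<pi> = "taylor_coeff m N q A B" and ?c = "knot_coeff m N q A B"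
  let ?C = "optimal_coefficient m N a b h \<omega> q A B"
  have h0: "h > 0" using ab N h by simp
  have p0: "p \<noteq> 0" using h0 \<omega> by (simp add: p_def)
  have qq: "\<And>k. k \<in> {1..m - 1} \<Longrightarrow> cmod (q k) < 1 \<and> q k \<noteq> 0" using q by blast
  have wn: "wave \<omega> (h * real n + a) = w" for n using wave_mult_period[OF \<omega>(2)] by (simp add: w_def)
  have wb: "wave \<omega> b = w" using wn[of N] h N by simp
  have sys': "coefficient_system m N a b h \<omega> q A B \<longleftrightarrow>
    (\<forall>i\<in>{1..m - 1}. ?\<pi> i = wave \<omega> a / p ^ (i + 1)) \<and>
    (\<forall>i\<in>{1..m - 1}. spline ?\<pi> ?c N i (real N) = wave \<omega> b / p ^ (i + 1))"
    by (rule coefficient_system_iff[OF _ N ab h p_def]) (rule qq)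
  have bc: "?\<pi> i = w / p ^ (i + 1)" "spline ?\<pi> ?c N i (real N) = w / p ^ (i + 1)" if "i \<in> {1..m - 1}" for i
    using sys that unfolding sys' wb w_def[symmetric] by auto
  have c: "m \<ge> 2 \<or> (\<forall>\<beta>\<in>{1..<N}. ?c \<beta> = 0)"
  proof (cases "m \<ge> 2")
    case False
    then have "m - 1 = 0" by simp
    then show ?thesis by (simp add: knot_coeff_def)
  qed simp
  \<comment> \<open>The smooth function behind the kernel, with \<open>K\<close> as its m-th
    derivative. Its conjugate will be the extremal function, since the functional pairs
    \<open>K\<close> with the derivative of \<open>f\<close> without conjugation.\<close>
  define D where "D i x = (-1) ^ m * of_real (h ^ (2 * m - i)) *
      (1 * wave \<omega> x / p ^ (2 * m - i) - spline ?\<pi> ?c N (2 * m - 1 - i) ((x - a) / h))" for i x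
  have D: "has_derivs_on m a b D"
    unfolding D_def using h0 p0 m c by (intro spline_has_derivs_on p_def) auto
  define K where "K x = (-1) ^ m * of_real (h ^ m) * (1 * wave \<omega> x / p ^ m - spline ?\<pi> ?c N (m - 1) ((x - a) / h))" for x
  have KD: "K = D m" using m by (auto simp: K_def D_def mult_2)
  have K: "continuous_on {a..b} K" unfolding KD by (rule has_derivs_on_continuous[OF D order_refl])
  have plog0: "q k \<noteq> 1" "polylog 0 (q k) = 1 / (1 - q k)" "polylog1 0 (q k) = q k / (1 - q k)" if "k \<in> {1..m - 1}" for k
  proof -
    show "q k \<noteq> 1" using qq[OF that] by auto
    then show "polylog 0 (q k) = 1 / (1 - q k)" "polylog1 0 (q k) = q k / (1 - q k)"
      using polylog_0[of "q k"] qq[OF that] by (auto simp: polylog1_def field_simps)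
  qed
  \<comment> \<open>The end coefficients contain the values of the degree-0 spline at the ends,
    where \<open>polylog 0\<close> and \<open>polylog1 0\<close> are geometric series; their closed
    forms are the fractions in the formulas.\<close>
  have C0: "?C 0 = of_real h * (- (1 * w / p) + spline ?\<pi> ?c N 0 0)"
  proof -
    have "?\<pi> 0 = (\<Sum>k=1..m - 1. A k * (q k / (q k - 1)) + B k * (q k ^ N / (1 - q k)))"
      unfolding taylor_coeff_def sum_distrib_left
    proof (intro sum.cong refl)
      fix k assume k: "k \<in> {1..m - 1}"
      have "q k / (q k - 1) = - (q k / (1 - q k))" by (metis minus_diff_eq minus_divide_right)
      then show "- (1 / fact 0) * (A k * ((-1) ^ 0 * polylog1 0 (q k)) - B k * (q k ^ N * polylog 0 (q k)))
        = A k * (q k / (q k - 1)) + B k * (q k ^ N / (1 - q k))"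
        using plog0[OF k] by simp
    qed
    then show ?thesis by (simp add: optimal_coefficient_def spline_0 w_def p_def)
  qed
  have end_eq: "spline ?\<pi> ?c N 0 (real N) = (1 / fact 0) * (\<Sum>k=1..m - 1. B k * polylog1 0 (q k) - A k * (q k ^ N * ((-1) ^ 0 * polylog 0 (q k))))"
    by (rule spline_right_end[OF _ N]) (rule qq)
  have CN: "?C N = of_real h * (1 * w / p - spline ?\<pi> ?c N 0 (real N))"
  proof -
    have "spline ?\<pi> ?c N 0 (real N) = - (\<Sum>k=1..m - 1. A k * (q k ^ N / (1 - q k)) + B k * (q k / (q k - 1)))"
      unfolding end_eq sum_negf[symmetric] sum_distrib_left
    proof (intro sum.cong refl)
      fix k assume k: "k \<in> {1..m - 1}"
      have "q k / (q k - 1) = - (q k / (1 - q k))" by (metis minus_diff_eq minus_divide_right)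
      then show "1 / fact 0 * (B k * polylog1 0 (q k) - A k * (q k ^ N * ((-1) ^ 0 * polylog 0 (q k))))
        = - (A k * (q k ^ N / (1 - q k)) + B k * (q k / (q k - 1)))"
        using plog0[OF k] by simp
    qed
    then show ?thesis using N by (simp add: optimal_coefficient_def wb p_def)
  qed
  have C\<beta>: "?C \<beta> = of_real h * ?c \<beta>" if "\<beta> \<in> {1..<N}" for \<beta>
    using that knot_coeff_eq[of m q \<beta> N A B] qq by (simp add: optimal_coefficient_def)
  have rep: "error_functional \<omega> a b h N ?C f = (LINT x:{a..b}|lebesgue. K x * nth_deriv_on a b m f x)"
    if f: "f \<in> sobolev_space m a b" for f
  proof -
    have "((\<lambda>x. K x * nth_deriv_on a b m f x - 1 * (wave \<omega> x * f x)) has_integral - (\<Sum>\<beta>=0..N. ?C \<beta> * f (h * real \<beta> + a))) {a..b}"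
      unfolding K_def
      by (rule spline_by_parts[OF m N ab h \<omega>(1) p_def _ wb _ _ C0 CN C\<beta> f])
        (use bc in \<open>auto simp: w_def spline_0\<close>)
    moreover have fc: "continuous_on {a..b} f"
      using sobolev_space_continuous[OF f ab, of 0] m by simp
    then have "set_integrable lebesgue {a..b} (\<lambda>x. wave \<omega> x * f x)"
      by (intro absolutely_integrable_continuous_real continuous_intros)
    then have "((\<lambda>x. wave \<omega> x * f x) has_integral (LINT x:{a..b}|lebesgue. wave \<omega> x * f x)) {a..b}"
      by (rule set_integral_has_integral)
    ultimately have "((\<lambda>x. (K x * nth_deriv_on a b m f x - 1 * (wave \<omega> x * f x)) + wave \<omega> x * f x) has_integral
        (- (\<Sum>\<beta>=0..N. ?C \<beta> * f (h * real \<beta> + a)) + (LINT x:{a..b}|lebesgue. wave \<omega> x * f x))) {a..b}"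
      by (rule has_integral_add)
    then have "((\<lambda>x. K x * nth_deriv_on a b m f x) has_integral error_functional \<omega> a b h N ?C f) {a..b}"
      by (simp add: error_functional_def)
    moreover have "((\<lambda>x. K x * nth_deriv_on a b m f x) has_integral (LINT x:{a..b}|lebesgue. K x * nth_deriv_on a b m f x)) {a..b}"
      by (rule set_integral_has_integral[OF sobolev_mult_integrable[OF f K]])
    ultimately show ?thesis by (rule has_integral_unique)
  qed
  show ?thesis
  proof (rule sard_optimal_characterization[OF ab m _ K rep has_derivs_on_cnj[OF D]])
    show "h \<noteq> 0" using h0 by simp
    show "cnj (D m x) = cnj (K x)" for x by (simp add: KD)
    fix \<beta> assume \<beta>: "\<beta> \<le> N"
    \<comment> \<open>At the nodes the spline vanishes and the exponential has the common value
      \<open>w\<close>, so the extremal function is constant there.\<close>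
    have "spline ?\<pi> ?c N (2 * m - 1) (real \<beta>) = 0"
      using spline_node[OF \<beta>] taylor_poly_node_zero[where q = q and M = "2 * m - 1", OF q] m by simp
    moreover have "(h * real \<beta> + a - a) / h = real \<beta>" using h0 by simp
    ultimately show "cnj (D 0 (h * real \<beta> + a)) = cnj ((-1) ^ m * of_real (h ^ (2 * m)) * (w / p ^ (2 * m)))"
      by (simp add: D_def wn)
  qed
qed

theorem theorem10:
  fixes m N :: nat and a b h \<omega> :: real and q :: "nat \<Rightarrow> complex"
  assumes "m \<ge> 1" and "N \<ge> 1" and "N + 1 \<ge> m"
    and "a < b" and "h = (b - a) / real N"
    and "\<omega> \<noteq> 0" and "\<omega> * h \<in> \<int>"
    and "bij_betw q {1..m - 1} {x. poly (euler_frobenius (2 * m - 2)) x = 0 \<and> cmod x < 1}"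
  shows "\<exists>A B. coefficient_system m N a b h \<omega> q A B \<and>
           (\<forall>A' B'. coefficient_system m N a b h \<omega> q A' B' \<longrightarrow>
              (\<forall>k\<in>{1..m - 1}. A' k = A k \<and> B' k = B k)) \<and>
           (\<forall>C. sard_optimal m \<omega> a b h N C \<longleftrightarrow>
              (\<forall>\<beta>\<in>{0..N}. C \<beta> = optimal_coefficient m N a b h \<omega> q A B \<beta>))"
proof -
  have q: "cmod (q k) < 1 \<and> q k \<noteq> 0 \<and> polylog (2 * m - 1) (q k) = 0" if k: "k \<in> {1..m - 1}" for k
  proof -
    have "poly (euler_frobenius (2 * m - 2)) (q k) = 0" "cmod (q k) < 1"
      using bij_betwE[OF assms(8)] k by auto
    moreover have "Suc (2 * m - 2) = 2 * m - 1" using assms(1) by simp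
    ultimately show ?thesis using euler_frobenius_root[of "q k" "2 * m - 2"] by simp
  qed
  have inj: "inj_on q {1..m - 1}" using assms(8) by (rule bij_betw_imp_inj_on)
  define p where "p = 2 * of_real pi * \<i> * complex_of_real \<omega> * complex_of_real h"
  have sys: "coefficient_system m N a b h \<omega> q A B \<longleftrightarrow>
    (\<forall>i\<in>{1..m - 1}. taylor_coeff m N q A B i = wave \<omega> a / p ^ (i + 1)) \<and>
    (\<forall>i\<in>{1..m - 1}. right_coeff m N q A B i = wave \<omega> b / p ^ (i + 1))" for A B
    by (rule coefficient_system_iff[OF _ assms(2,4,5) p_def]) (use q in blast)
  note sol = boundary_system_unique_solution[OF assms(1-3) q inj]
  obtain A B where AB: "\<forall>i\<in>{1..m - 1}. taylor_coeff m N q A B i = wave \<omega> a / p ^ (i + 1)"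
    "\<forall>i\<in>{1..m - 1}. right_coeff m N q A B i = wave \<omega> b / p ^ (i + 1)"
    using sol(1)[of "\<lambda>i. wave \<omega> a / p ^ (i + 1)" "\<lambda>i. wave \<omega> b / p ^ (i + 1)"] by blast
  then have AB_sys: "coefficient_system m N a b h \<omega> q A B" unfolding sys by blast
  have "A' k = A k \<and> B' k = B k" if "coefficient_system m N a b h \<omega> q A' B'" "k \<in> {1..m - 1}" for A' B' k
    using that AB unfolding sys by (intro sol(2)) auto
  then show ?thesis
    using AB_sys optimal_coefficient_sard[OF assms(1,2,4-7) q AB_sys] by blast
qed

end
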